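(* Let $n\ge 2$ and let $K, L \in \mathcal{K}(\mathbb{S}^n)$ be spherical convex bodies such that $K \cup L \in \mathcal{K}(\mathbb{S}^n)$. Then, for all Borel sets $\omega \in \mathcal{B}(\mathbb{S}^n)$, $$\Omega(K,\omega) + \Omega(L,\omega) = \Omega(K \cup L, \omega) + \Omega(K \cap L, \omega).$$
   Context: $\mathbb{S}^n$ is the Euclidean unit sphere in $\mathbb{R}^{n+1}$, $\cdot$ the scalar product, $d(u,v)=\arccos(u\cdot v)$. A set $A\subseteq\mathbb{S}^n$ is (spherically) convex if its radial extension $\{rv: r\ge 0, v\in A\}$ is convex in $\mathbb{R}^{n+1}$. A convex body in $\mathbb{S}^n$ is a closed convex subset; $\mathcal{K}(\mathbb{S}^n)$ is the set of convex bodies. $\mathcal{B}(\mathbb{S}^n)$ is the Borel $\sigma$-algebra. Floating measure: for $K\in\mathcal{K}(\mathbb{S}^n)$ and $\omega\in\mathcal{B}(\mathbb{S}^n)$, $\Omega(K,\omega)=\int_{\omega\cap\mathrm{bd}\,K}H_{n-1}^{\mathbb{S}^n}(K,w)^{\frac1{n+1}}\,d\mathcal{H}^{n-1}(w)$, where $\mathcal{H}^{n-1}$ is $(n-1)$-dimensional Hausdorff measure. If $K$ has empty interior, the curvature is taken to be $0$, so $\Omega(K,\cdot)\equiv 0$; also $\Omega(\mathbb{S}^n,\cdot)\equiv0$ since $\mathrm{bd}\,\mathbb{S}^n=\emptyset$. Spherical Gauss-Kronecker curvature (for $K$ with non-empty interior): for $w\in\mathbb{S}^n$ let $\mathbb{R}^n_w=\{x\in\mathbb{R}^{n+1}: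 x\cdot w=0\}$, $C_w(\varepsilon)=\{v: d(v,w)\le\varepsilon\}$, and let $g_w(v)=\frac{v}{w\cdot v}-w$ (for $v\in\mathbb{S}^n$ with $w\cdot v>0$) be the gnomonic projection into $\mathbb{R}^n_w$. For $w\in\mathrm{bd}\,K$, $H_{n-1}^{\mathbb{S}^n}(K,w)$ is the generalized Gauss-Kronecker curvature at $0=g_w(w)$ of the Euclidean convex body $g_w(K\cap C_w(\varepsilon))\subset\mathbb{R}^n_w$ for any $\varepsilon\in(0,\pi/2)$ (independent of $\varepsilon$). Here the generalized Gauss-Kronecker curvature of a Euclidean convex body at a boundary point $x$ is the determinant of the (Alexandrov) second-order Hessian at $x$ of the convex function representing the boundary as a graph over the tangent hyperplane at $x$; it exists $\mathcal{H}^{n-1}$-almost everywhere on $\mathrm{bd}\,K$. *)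

theory Defs
  imports "HOL-Analysis.Analysis"
begin

section \<open>Hausdorff measure\<close>

text \<open>The factor \<open>unit_ball_vol s / 2 ^ s\<close> is the usual normalization, under which the
  \<open>s\<close>-dimensional Hausdorff measure agrees with Lebesgue measure on \<open>s\<close>-dimensional Euclidean
  space. The explicit case for the empty set only matters for \<open>s = 0\<close>, and boundedness is
  required because \<^const>\<open>diameter\<close> is unspecified on unbounded sets.\<close>

definition hausdorff_gauge :: "nat \<Rightarrow> 'a::metric_space set \<Rightarrow> ennreal" where
  "hausdorff_gauge s U =
     (if U = {} then 0 else ennreal (unit_ball_vol (real s) * (diameter U / 2) ^ s))"

definition hausdorff_pre :: "nat \<Rightarrow> real \<Rightarrow> 'a::metric_space set \<Rightarrow> ennreal" where
  "hausdorff_pre s \<delta> A =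
     (INF U \<in> {U :: nat \<Rightarrow> 'a set. A \<subseteq> (\<Union>i. U i) \<and> (\<forall>i. bounded (U i) \<and> diameter (U i) \<le> \<delta>)}.
        \<Sum>i. hausdorff_gauge s (U i))"

definition hausdorff_outer :: "nat \<Rightarrow> 'a::metric_space set \<Rightarrow> ennreal" where
  "hausdorff_outer s A = (SUP \<delta> \<in> {0<..}. hausdorff_pre s \<delta> A)"

text \<open>By \<open>emeasure_hausdorff_measure\<close> below, this is really the restriction of
  \<^const>\<open>hausdorff_outer\<close> to the Borel sets.\<close>

definition hausdorff_measure :: "nat \<Rightarrow> 'a::metric_space measure" where
  "hausdorff_measure s = measure_of UNIV (sets borel) (hausdorff_outer s)"

lemma hausdorff_gauge_empty [simp]: "hausdorff_gauge s {} = 0"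
  by (simp add: hausdorff_gauge_def)

lemma hausdorff_pre_le:
  assumes "A \<subseteq> (\<Union>i::nat. U i)" "\<And>i. bounded (U i)" "\<And>i. diameter (U i) \<le> \<delta>"
  shows "hausdorff_pre s \<delta> A \<le> (\<Sum>i. hausdorff_gauge s (U i))"
  unfolding hausdorff_pre_def by (rule INF_lower) (use assms in auto)

lemma hausdorff_pre_mono: "A \<subseteq> B \<Longrightarrow> hausdorff_pre s \<delta> A \<le> hausdorff_pre s \<delta> B"
  unfolding hausdorff_pre_def by (rule INF_superset_mono) auto

lemma hausdorff_pre_antimono: "\<delta> \<le> \<epsilon> \<Longrightarrow> hausdorff_pre s \<epsilon> A \<le> hausdorff_pre s \<delta> A"
  unfolding hausdorff_pre_def by (rule INF_superset_mono) (auto intro: order_trans)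

lemma hausdorff_pre_empty: "\<delta> > 0 \<Longrightarrow> hausdorff_pre s \<delta> {} = 0"
  using hausdorff_pre_le[of "{}" "\<lambda>_. {}" \<delta> s] by simp

lemma hausdorff_pre_subadd:
  fixes A :: "nat \<Rightarrow> 'a::metric_space set"
  shows "hausdorff_pre s \<delta> (\<Union>i. A i) \<le> (\<Sum>i. hausdorff_pre s \<delta> (A i))"
proof (rule ennreal_le_epsilon)
  fix e :: real assume e: "0 < e" and fin: "(\<Sum>n. hausdorff_pre s \<delta> (A n)) < top"
  have *: "\<exists>U. A n \<subseteq> (\<Union>i::nat. U i) \<and> (\<forall>i. bounded (U i) \<and> diameter (U i) \<le> \<delta>) \<and>
      (\<Sum>i. hausdorff_gauge s (U i)) \<le> hausdorff_pre s \<delta> (A n) + ennreal (e * (1/2)^Suc n)" for n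
  proof -
    have "hausdorff_pre s \<delta> (A n) < top"
      using fin by (auto simp: less_top dest!: ennreal_suminf_lessD)
    then have "hausdorff_pre s \<delta> (A n) < hausdorff_pre s \<delta> (A n) + ennreal (e * (1/2)^Suc n)"
      using e by (auto simp: less_top)
    then show ?thesis
      by (subst (asm) hausdorff_pre_def) (auto simp: INF_less_iff intro: less_imp_le)
  qed
  obtain U where U: "\<And>n. A n \<subseteq> (\<Union>i::nat. U n i)" "\<And>n i. bounded (U n i)" "\<And>n i. diameter (U n i) \<le> \<delta>"
     "\<And>n. (\<Sum>i. hausdorff_gauge s (U n i)) \<le> hausdorff_pre s \<delta> (A n) + ennreal (e * (1/2)^Suc n)"
    using * by metis
  define C where "C = case_prod U o prod_decode"
  have A_C: "(\<Union>i. A i) \<subseteq> (\<Union>i. C i)"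
    using U(1) by (auto simp add: C_def subset_eq) (metis prod.case prod_encode_inverse)
  have "hausdorff_pre s \<delta> (\<Union>i. A i) \<le> (\<Sum>i. hausdorff_gauge s (C i))"
    by (rule hausdorff_pre_le[OF A_C]) (auto simp: C_def U split: prod.split)
  also have "\<dots> = (\<Sum>i. (hausdorff_gauge s \<circ> case_prod U \<circ> prod_decode) i)"
    by (simp add: C_def comp_def)
  also have "\<dots> = (\<Sum>n. \<Sum>i. hausdorff_gauge s (U n i))"
    using suminf_ennreal_2dimen[of "\<lambda>n. \<Sum>i. hausdorff_gauge s (U n i)" "\<lambda>(n,i). hausdorff_gauge s (U n i)"]
    by (simp add: comp_def case_prod_unfold)
  also have "\<dots> \<le> (\<Sum>n. hausdorff_pre s \<delta> (A n) + ennreal (e * (1/2) ^ Suc n))"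
    by (intro suminf_le allI U(4)) auto
  also have "\<dots> = (\<Sum>n. hausdorff_pre s \<delta> (A n)) + (\<Sum>n. ennreal e * ennreal ((1/2) ^ Suc n))"
    using e by (subst suminf_add[symmetric])
               (auto simp del: ennreal_suminf_cmult simp add: ennreal_mult[symmetric])
  also have "\<dots> = (\<Sum>n. hausdorff_pre s \<delta> (A n)) + ennreal e"
    unfolding ennreal_suminf_cmult
    by (subst suminf_ennreal_eq[OF zero_le_power power_half_series]) auto
  finally show "hausdorff_pre s \<delta> (\<Union>i. A i) \<le> (\<Sum>n. hausdorff_pre s \<delta> (A n)) + ennreal e" .
qed

lemma hausdorff_pre_le_outer: "\<delta> > 0 \<Longrightarrow> hausdorff_pre s \<delta> A \<le> hausdorff_outer s A"
  unfolding hausdorff_outer_def by (rule SUP_upper) simp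

lemma hausdorff_outer_mono: "A \<subseteq> B \<Longrightarrow> hausdorff_outer s A \<le> hausdorff_outer s B"
  unfolding hausdorff_outer_def by (intro SUP_mono) (auto intro: hausdorff_pre_mono)

lemma hausdorff_outer_empty [simp]: "hausdorff_outer s {} = 0"
  unfolding hausdorff_outer_def by (simp add: hausdorff_pre_empty SUP_constant)

lemma hausdorff_outer_subadd:
  "hausdorff_outer s (\<Union>i::nat. A i) \<le> (\<Sum>i. hausdorff_outer s (A i))"
proof -
  have "hausdorff_pre s \<delta> (\<Union>i. A i) \<le> (\<Sum>i. hausdorff_outer s (A i))" if "\<delta> > 0" for \<delta>
    by (rule order_trans[OF hausdorff_pre_subadd])
       (intro suminf_le allI hausdorff_pre_le_outer that summableI)
  then show ?thesis
    unfolding hausdorff_outer_def[of s "\<Union>i. A i"] by (intro SUP_least) auto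
qed

lemma outer_measure_space_hausdorff_outer: "outer_measure_space UNIV (hausdorff_outer s)"
  by (auto simp: outer_measure_space_def positive_def increasing_def countably_subadditive_def
      intro: hausdorff_outer_mono hausdorff_outer_subadd)

lemma hausdorff_outer_subadd2:
  "hausdorff_outer s (A \<union> B) \<le> hausdorff_outer s A + hausdorff_outer s B"
proof -
  interpret sigma_algebra UNIV "UNIV :: 'a set set" using sigma_algebra_Pow[of UNIV] by simp
  have "subadditive UNIV (hausdorff_outer s :: 'a set \<Rightarrow> ennreal)"
    using outer_measure_space_hausdorff_outer countably_subadditive_subadditive
    unfolding outer_measure_space_def by metis
  then have "hausdorff_outer s (A \<union> (B - A)) \<le> hausdorff_outer s A + hausdorff_outer s (B - A)"
    by (rule subadditiveD) auto
  also have "\<dots> \<le> hausdorff_outer s A + hausdorff_outer s B"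
    by (intro add_left_mono hausdorff_outer_mono) auto
  finally show ?thesis by simp
qed

lemma hausdorff_outer_add_separated:
  assumes d: "d > 0" and sep: "\<And>x y. x \<in> A \<Longrightarrow> y \<in> B \<Longrightarrow> d \<le> dist x y"
  shows "hausdorff_outer s A + hausdorff_outer s B \<le> hausdorff_outer s (A \<union> B)"
proof -
  have key: "hausdorff_pre s \<delta> A + hausdorff_pre s \<delta> B \<le> hausdorff_pre s \<delta> (A \<union> B)"
    if \<delta>: "0 < \<delta>" "\<delta> < d" for \<delta>
    unfolding hausdorff_pre_def[of s \<delta> "A \<union> B"]
  proof (rule INF_greatest, clarify)
    fix U :: "nat \<Rightarrow> 'a set"
    assume cov: "A \<union> B \<subseteq> (\<Union>i. U i)" and U: "\<forall>i. bounded (U i) \<and> diameter (U i) \<le> \<delta>"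
    have disj: "U i \<inter> A = {} \<or> U i \<inter> B = {}" for i
    proof (rule ccontr)
      assume "\<not> ?thesis"
      then obtain x y where xy: "x \<in> U i" "x \<in> A" "y \<in> U i" "y \<in> B" by blast
      have "dist x y \<le> diameter (U i)"
        using U xy by (intro diameter_bounded_bound) auto
      with sep[OF xy(2,4)] U \<delta> show False by (smt (verit))
    qed
    define P where "P C i = (if U i \<inter> C = {} then {} else U i)" for C i
    have le: "hausdorff_pre s \<delta> C \<le> (\<Sum>i. hausdorff_gauge s (P C i))" if "C \<subseteq> (\<Union>i. U i)" for C
    proof (rule hausdorff_pre_le)
      show "C \<subseteq> (\<Union>i. P C i)" 
      proof
        fix x assume x: "x \<in> C"
        then obtain i where "x \<in> U i" using \<open>C \<subseteq> _\<close> by blast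
        then have "x \<in> P C i" using x by (auto simp: P_def)
        then show "x \<in> (\<Union>i. P C i)" by blast
      qed
    qed (use U \<delta> in \<open>auto simp: P_def\<close>)
    have "hausdorff_pre s \<delta> A + hausdorff_pre s \<delta> B
        \<le> (\<Sum>i. hausdorff_gauge s (P A i)) + (\<Sum>i. hausdorff_gauge s (P B i))"
      using cov by (intro add_mono le) auto
    also have "\<dots> = (\<Sum>i. hausdorff_gauge s (P A i) + hausdorff_gauge s (P B i))"
      by (rule suminf_add) auto
    also have "\<dots> \<le> (\<Sum>i. hausdorff_gauge s (U i))"
      using disj by (intro suminf_le allI) (auto simp: P_def)
    finally show "hausdorff_pre s \<delta> A + hausdorff_pre s \<delta> B \<le> (\<Sum>i. hausdorff_gauge s (U i))" .
  qed
  have "hausdorff_pre s \<delta> A + hausdorff_pre s \<epsilon> B \<le> hausdorff_outer s (A \<union> B)"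
    if "\<delta> > 0" "\<epsilon> > 0" for \<delta> \<epsilon>
  proof -
    define \<eta> where "\<eta> = min (d / 2) (min \<delta> \<epsilon>)"
    have \<eta>: "0 < \<eta>" "\<eta> < d" "\<eta> \<le> \<delta>" "\<eta> \<le> \<epsilon>" using that d by (auto simp: \<eta>_def)
    have "hausdorff_pre s \<delta> A + hausdorff_pre s \<epsilon> B \<le> hausdorff_pre s \<eta> A + hausdorff_pre s \<eta> B"
      using \<eta> by (intro add_mono hausdorff_pre_antimono) auto
    also have "\<dots> \<le> hausdorff_pre s \<eta> (A \<union> B)" by (rule key) (use \<eta> in auto)
    also have "\<dots> \<le> hausdorff_outer s (A \<union> B)" by (rule hausdorff_pre_le_outer) fact
    finally show ?thesis .
  qed
  note * = this
  have "(SUP \<delta>\<in>{0<..}. hausdorff_pre s \<delta> A) + (SUP \<epsilon>\<in>{0<..}. hausdorff_pre s \<epsilon> B) = (SUP \<delta>\<in>{0<..}. hausdorff_pre s \<delta> A + (SUP \<epsilon>\<in>{0<..}. hausdorff_pre s \<epsilon> B))"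
    by (rule ennreal_SUP_add_left[symmetric]) simp
  also have "\<dots> = (SUP \<delta>\<in>{0<..}. SUP \<epsilon>\<in>{0<..}. hausdorff_pre s \<delta> A + hausdorff_pre s \<epsilon> B)"
    by (intro SUP_cong refl ennreal_SUP_add_right) simp
  also have "\<dots> \<le> hausdorff_outer s (A \<union> B)"
    using * by (intro SUP_least) auto
  finally show ?thesis
    unfolding hausdorff_outer_def[of s A] hausdorff_outer_def[of s B] .
qed

lemma closed_lambda_system_hausdorff_outer:
  fixes C :: "'a::metric_space set"
  assumes C: "closed C"
  shows "C \<in> lambda_system UNIV UNIV (hausdorff_outer s)"
proof -
  have le: "hausdorff_outer s (X \<inter> C) + hausdorff_outer s (X - C) \<le> hausdorff_outer s X" for X
  proof (cases "C = {} \<or> hausdorff_outer s X = top")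
    case False
    then have ne: "C \<noteq> {}" and fin: "hausdorff_outer s X < top" by (auto simp: less_top)
    define D where "D n = {x \<in> X. 1 / real (Suc n) \<le> infdist x C}" for n
    define R where "R n = D (Suc n) - D n" for n
    have mono: "1 / real (Suc m) \<le> 1 / real (Suc n)" if "n \<le> m" for m n
      using that by (simp add: frac_le)
    have Dmono: "D n \<subseteq> D m" if "n \<le> m" for n m
      using mono[OF that] by (auto simp: D_def)
    have D1: "hausdorff_outer s (X \<inter> C) + hausdorff_outer s (D n) \<le> hausdorff_outer s X" for n
    proof -
      have "hausdorff_outer s (X \<inter> C) + hausdorff_outer s (D n) \<le> hausdorff_outer s (X \<inter> C \<union> D n)"
      proof (rule hausdorff_outer_add_separated)
        show "1 / real (Suc n) \<le> dist x y" if "x \<in> X \<inter> C" "y \<in> D n" for x y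
          using that infdist_le[of x C y] by (auto simp: D_def dist_commute intro: order_trans)
      qed simp
      also have "\<dots> \<le> hausdorff_outer s X" by (rule hausdorff_outer_mono) (auto simp: D_def)
      finally show ?thesis .
    qed
    have XC: "X - C = (\<Union>n. D n)"
    proof (intro set_eqI iffI)
      fix x assume x: "x \<in> X - C"
      then have "infdist x C > 0"
        using C ne by (metis DiffD2 in_closed_iff_infdist_zero infdist_nonneg less_eq_real_def)
      then obtain n where "inverse (real (Suc n)) < infdist x C" using reals_Archimedean by blast
      then show "x \<in> (\<Union>n. D n)" using x by (auto simp: D_def inverse_eq_divide intro!: exI[of _ n])
    next
      fix x assume "x \<in> (\<Union>n. D n)"
      then obtain n where "x \<in> X" "1 / real (Suc n) \<le> infdist x C" by (auto simp: D_def)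
      moreover have "0 < 1 / real (Suc n)" by simp
      ultimately show "x \<in> X - C" by (metis Diff_iff infdist_zero leD)
    qed
    have sepR: "hausdorff_outer s (\<Union>i<k. R (2*i+j)) + hausdorff_outer s (R (2*k+j))
         \<le> hausdorff_outer s ((\<Union>i<k. R (2*i+j)) \<union> R (2*k+j))" for k j
    proof (rule hausdorff_outer_add_separated)
      define m where "m = 2*k+j"
      show "0 < 1 / real (Suc m) - 1 / real (Suc (Suc m))" by (simp add: frac_less2)
      fix x y assume x: "x \<in> (\<Union>i<k. R (2*i+j))" and y: "y \<in> R (2*k+j)"
      from x obtain i where i: "i < k" "x \<in> R (2*i+j)" by auto
      have "y \<notin> D m" "y \<in> X" using y by (auto simp: m_def R_def D_def)
      then have y2: "infdist y C < 1 / real (Suc m)" by (auto simp: D_def)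
      have "x \<in> D (Suc (2*i+j))" using i by (auto simp: R_def)
      moreover have "Suc (2*i+j) \<le> m - 1" using i by (auto simp: m_def)
      ultimately have "x \<in> D (m - 1)" using Dmono by blast
      moreover have "m \<ge> 2" using i by (auto simp: m_def)
      ultimately have x2: "1 / real m \<le> infdist x C" by (auto simp: D_def)
      have "infdist x C \<le> infdist y C + dist x y" by (rule infdist_triangle)
      with x2 y2 have "1 / real m - 1 / real (Suc m) \<le> dist x y" by linarith
      moreover have "1 / real (Suc m) - 1 / real (Suc (Suc m)) \<le> 1 / real m - 1 / real (Suc m)"
      proof -
        have "1 / real m - 1 / real (Suc m) = 1 / (real m * real (Suc m))"
          "1 / real (Suc m) - 1 / real (Suc (Suc m)) = 1 / (real (Suc m) * real (Suc (Suc m)))"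
          using \<open>m \<ge> 2\<close> by (simp_all add: divide_simps)
        moreover have "real m * real (Suc m) \<le> real (Suc m) * real (Suc (Suc m))"
          by (simp add: algebra_simps)
        moreover from this have "1 / (real (Suc m) * real (Suc (Suc m))) \<le> 1 / (real m * real (Suc m))"
          using \<open>m \<ge> 2\<close> by (intro divide_left_mono) auto
        ultimately show ?thesis by linarith
      qed
      ultimately show "1 / real (Suc m) - 1 / real (Suc (Suc m)) \<le> dist x y" by linarith
    qed
    have sumR: "(\<Sum>i<k. hausdorff_outer s (R (2*i+j))) \<le> hausdorff_outer s (\<Union>i<k. R (2*i+j))" for k j
    proof (induction k)
      case (Suc k)
      have "(\<Sum>i<Suc k. hausdorff_outer s (R (2*i+j)))
          \<le> hausdorff_outer s (\<Union>i<k. R (2*i+j)) + hausdorff_outer s (R (2*k+j))"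
        using Suc by (simp add: add_right_mono)
      also note sepR
      also have "(\<Union>i<k. R (2*i+j)) \<union> R (2*k+j) = (\<Union>i<Suc k. R (2*i+j))"
        by (auto simp: less_Suc_eq)
      finally show ?case .
    qed simp
    have sumX: "(\<Sum>i<k. hausdorff_outer s (R (2*i+j))) \<le> hausdorff_outer s X" for k j
      by (rule order_trans[OF sumR]) (rule hausdorff_outer_mono, auto simp: R_def D_def)
    have "(\<Sum>i<k. hausdorff_outer s (R i)) \<le> hausdorff_outer s X + hausdorff_outer s X" for k
    proof -
      have "(\<Sum>i<k. hausdorff_outer s (R i)) \<le> (\<Sum>i<2*k. hausdorff_outer s (R i))"
        by (rule sum_mono2) auto
      also have "\<dots> = (\<Sum>i<k. hausdorff_outer s (R (2*i+0))) + (\<Sum>i<k. hausdorff_outer s (R (2*i+1)))"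
        by (induction k) (auto simp: algebra_simps)
      also have "\<dots> \<le> hausdorff_outer s X + hausdorff_outer s X"
        by (intro add_mono sumX)
      finally show ?thesis .
    qed
    then have "(\<Sum>i. hausdorff_outer s (R i)) \<le> hausdorff_outer s X + hausdorff_outer s X"
      by (intro suminf_le_const summableI)
    then have finR: "(\<Sum>i. hausdorff_outer s (R i)) \<noteq> top"
      using fin by (metis ennreal_add_less_top leD top.not_eq_extremum)
    have tail: "(\<lambda>n. \<Sum>i. hausdorff_outer s (R (i + n))) \<longlonglongrightarrow> 0"
    proof -
      have f1: "hausdorff_outer s (R i) \<noteq> top" for i
        using ennreal_suminf_lessD[of "\<lambda>i. hausdorff_outer s (R i)" top i] finR
        by (auto simp: less_top)
      define r where "r i = enn2real (hausdorff_outer s (R i))" for i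
      have r: "hausdorff_outer s (R i) = ennreal (r i)" "0 \<le> r i" for i
        using f1 by (auto simp: r_def less_top)
      have sr: "summable r" 
        using finR by (intro summable_suminf_not_top) (auto simp: r)
      have "(\<Sum>i. hausdorff_outer s (R (i + n))) = ennreal (\<Sum>i. r (i + n))" for n
        unfolding r using sr r by (intro suminf_ennreal2) (auto simp: summable_iff_shift)
      moreover have "(\<lambda>n. ennreal (\<Sum>i. r (i + n))) \<longlonglongrightarrow> ennreal 0"
        by (intro tendsto_ennrealI suminf_exist_split2 sr)
      ultimately show ?thesis by simp
    qed
    have bd: "hausdorff_outer s (X \<inter> C) + hausdorff_outer s (X - C)
        \<le> hausdorff_outer s X + (\<Sum>i. hausdorff_outer s (R (i + n)))" for n
    proof -
      have "(\<Union>m. D m) \<subseteq> D n \<union> (\<Union>i. R (i + n))"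
      proof
        fix x assume "x \<in> (\<Union>m. D m)"
        then obtain m where m: "x \<in> D m" by auto
        have "x \<in> D n \<union> (\<Union>i. R (i + n))" if "x \<in> D (k + n)" for k
          using that by (induction k) (auto simp: R_def)
        moreover have "x \<in> D (m + n)" using m Dmono[of m "m + n"] by auto
        ultimately show "x \<in> D n \<union> (\<Union>i. R (i + n))" by blast
      qed
      then have "hausdorff_outer s (X - C) \<le> hausdorff_outer s (D n \<union> (\<Union>i. R (i + n)))"
        unfolding XC by (rule hausdorff_outer_mono)
      also have "\<dots> \<le> hausdorff_outer s (D n) + hausdorff_outer s (\<Union>i. R (i + n))"
        by (rule hausdorff_outer_subadd2)
      also have "\<dots> \<le> hausdorff_outer s (D n) + (\<Sum>i. hausdorff_outer s (R (i + n)))"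
        by (intro add_left_mono hausdorff_outer_subadd)
      finally have "hausdorff_outer s (X \<inter> C) + hausdorff_outer s (X - C)
         \<le> hausdorff_outer s (X \<inter> C) + hausdorff_outer s (D n) + (\<Sum>i. hausdorff_outer s (R (i + n)))"
        by (simp add: add.assoc add_left_mono)
      also have "\<dots> \<le> hausdorff_outer s X + (\<Sum>i. hausdorff_outer s (R (i + n)))"
        by (intro add_right_mono D1)
      finally show ?thesis .
    qed
    have "(\<lambda>n. hausdorff_outer s X + (\<Sum>i. hausdorff_outer s (R (i + n)))) \<longlonglongrightarrow> hausdorff_outer s X + 0"
      by (intro tendsto_add tendsto_const tail)
    then show ?thesis
      using bd by (intro LIMSEQ_le_const) (auto simp del: add_0_right simp: add_0_right)
  qed auto
  have "hausdorff_outer s X \<le> hausdorff_outer s (X \<inter> C) + hausdorff_outer s (X - C)" for X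
    using hausdorff_outer_subadd2[of s "X \<inter> C" "X - C"] by (simp add: Int_Diff_Un)
  with le show ?thesis
    by (auto simp: lambda_system_def Int_commute Diff_eq intro: antisym)
qed

theorem measure_space_hausdorff:
  "measure_space UNIV (sets borel) (hausdorff_outer s :: 'a::metric_space set \<Rightarrow> ennreal)"
proof -
  interpret sigma_algebra UNIV "UNIV :: 'a set set" using sigma_algebra_Pow[of UNIV] by simp
  let ?L = "lambda_system UNIV UNIV (hausdorff_outer s :: 'a set \<Rightarrow> ennreal)"
  have ms: "measure_space UNIV ?L (hausdorff_outer s)"
    by (rule caratheodory_lemma[OF outer_measure_space_hausdorff_outer])
  then interpret L: sigma_algebra UNIV ?L by (simp add: measure_space_def)
  have "sets borel \<subseteq> ?L"
    unfolding borel_eq_closed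
    by (subst sets_measure_of, simp, rule L.sigma_sets_subset)
       (auto intro: closed_lambda_system_hausdorff_outer)
  then show ?thesis
    using ms sets.sigma_algebra_axioms[of "borel :: 'a measure"]
    by (auto simp: measure_space_def countably_additive_def positive_def subset_eq image_subset_iff)
qed

theorem emeasure_hausdorff_measure:
  "A \<in> sets borel \<Longrightarrow> emeasure (hausdorff_measure s) A = hausdorff_outer s A"
  unfolding hausdorff_measure_def using measure_space_hausdorff[of s]
  by (intro emeasure_measure_of_sigma) (auto simp: measure_space_def)

lemma sets_hausdorff_measure [simp]: "sets (hausdorff_measure s) = sets borel"
  unfolding hausdorff_measure_def using sets.sigma_sets_eq[of borel] by (simp add: sets_measure_of_conv)

lemma space_hausdorff_measure [simp]: "space (hausdorff_measure s) = UNIV"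
  unfolding hausdorff_measure_def by (simp add: space_measure_of_conv)

section \<open>Spherical convex bodies\<close>

text \<open>The sphere of dimension \<open>n\<close> is \<open>sphere 0 1\<close> in \<open>real ^ 'n\<close>, where \<open>CARD('n) = n + 1\<close>.\<close>

definition sph_dist :: "real ^ 'n \<Rightarrow> real ^ 'n \<Rightarrow> real" where
  "sph_dist u v = arccos (u \<bullet> v)"

definition sph_convex :: "(real ^ 'n) set \<Rightarrow> bool" where
  "sph_convex A \<longleftrightarrow> A \<subseteq> sphere 0 1 \<and> convex {r *\<^sub>R v | r v. 0 \<le> r \<and> v \<in> A}"

definition sph_convex_body :: "(real ^ 'n) set \<Rightarrow> bool" where
  "sph_convex_body K \<longleftrightarrow> closed K \<and> sph_convex K"

definition sph_interior :: "(real ^ 'n) set \<Rightarrow> (real ^ 'n) set" where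
  "sph_interior K = top_of_set (sphere 0 1) interior_of K"

definition sph_boundary :: "(real ^ 'n) set \<Rightarrow> (real ^ 'n) set" where
  "sph_boundary K = top_of_set (sphere 0 1) frontier_of K"

section \<open>Generalized Gauss-Kronecker curvature of Euclidean convex bodies\<close>

text \<open>Throughout, \<open>B\<close> is a convex body with non-empty interior relative to a linear subspace \<open>V\<close>
  (later a linear hyperplane), and \<open>x\<close> is a boundary point of \<open>B\<close>.\<close>

definition inner_unit_normals :: "(real ^ 'n) set \<Rightarrow> (real ^ 'n) set \<Rightarrow> real ^ 'n \<Rightarrow> (real ^ 'n) set" where
  "inner_unit_normals V B x = {\<nu> \<in> V. norm \<nu> = 1 \<and> (\<forall>z\<in>B. 0 \<le> (z - x) \<bullet> \<nu>)}"

text \<open>Near \<open>0\<close> in the orthogonal complement of the inner normal \<open>\<nu>\<close> in \<open>V\<close>, this is the convex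
  function whose graph over the tangent hyperplane is the boundary of \<open>B\<close> close to \<open>x\<close>. (If \<open>\<nu>\<close> is the only
  inner unit normal at \<open>x\<close>, then the infimum is over a non-empty set for all small \<open>y\<close>.)\<close>

definition boundary_graph :: "(real ^ 'n) set \<Rightarrow> real ^ 'n \<Rightarrow> real ^ 'n \<Rightarrow> real ^ 'n \<Rightarrow> real" where
  "boundary_graph B x \<nu> y = Inf {t. x + y + t *\<^sub>R \<nu> \<in> B}"

text \<open>\<open>A\<close> is the Hessian in Alexandrov's sense at \<open>0\<close> of \<open>f\<close>, a function on the subspace \<open>T\<close>:
  \<open>f y = f 0 + a \<bullet> y + (A y \<bullet> y) / 2 + o((norm y)\<^sup>2)\<close>.\<close>

definition has_alexandrov_hessian ::
    "(real ^ 'n) set \<Rightarrow> (real ^ 'n \<Rightarrow> real) \<Rightarrow> (real ^ 'n \<Rightarrow> real ^ 'n) \<Rightarrow> bool" where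
  "has_alexandrov_hessian T f A \<longleftrightarrow>
     linear A \<and> A ` T \<subseteq> T \<and> (\<forall>y\<in>T. \<forall>z\<in>T. A y \<bullet> z = y \<bullet> A z) \<and>
     (\<exists>a\<in>T. ((\<lambda>y. (f y - f 0 - a \<bullet> y - (A y \<bullet> y) / 2) / (norm y)\<^sup>2) \<longlongrightarrow> 0) (at 0 within T))"

text \<open>Determinant of an endomorphism \<open>A\<close> of a subspace \<open>T\<close>: \<open>A\<close> is extended to the whole space by
  the identity on the orthogonal complement of \<open>T\<close>, which does not change the determinant.
  Here \<open>closest_point T\<close> is the orthogonal projection onto \<open>T\<close>.\<close>

definition det_on :: "(real ^ 'n) set \<Rightarrow> (real ^ 'n \<Rightarrow> real ^ 'n) \<Rightarrow> real" where
  "det_on T A = det (matrix (\<lambda>x. A (closest_point T x) + (x - closest_point T x)))"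

definition has_gauss_kronecker_curvature ::
    "(real ^ 'n) set \<Rightarrow> (real ^ 'n) set \<Rightarrow> real ^ 'n \<Rightarrow> real \<Rightarrow> bool" where
  "has_gauss_kronecker_curvature V B x \<kappa> \<longleftrightarrow>
     (\<exists>\<nu> A. inner_unit_normals V B x = {\<nu>} \<and>
        (let T = {y \<in> V. y \<bullet> \<nu> = 0} in
          has_alexandrov_hessian T (boundary_graph B x \<nu>) A \<and> \<kappa> = det_on T A))"

lemma alexandrov_hessian_unique:
  assumes T: "subspace T" and A: "has_alexandrov_hessian T f A" and B: "has_alexandrov_hessian T f B"
    and y: "y \<in> T"
  shows "A y = B y"
proof -
  obtain a where a: "((\<lambda>y. (f y - f 0 - a \<bullet> y - (A y \<bullet> y) / 2) / (norm y)\<^sup>2) \<longlongrightarrow> 0) (at 0 within T)"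
    using A by (auto simp: has_alexandrov_hessian_def)
  obtain b where b: "((\<lambda>y. (f y - f 0 - b \<bullet> y - (B y \<bullet> y) / 2) / (norm y)\<^sup>2) \<longlongrightarrow> 0) (at 0 within T)"
    using B by (auto simp: has_alexandrov_hessian_def)
  define g where "g y = ((a - b) \<bullet> y + ((A y - B y) \<bullet> y) / 2) / (norm y)\<^sup>2" for y
  have lin: "linear A" "linear B" using A B by (auto simp: has_alexandrov_hessian_def)
  have g: "(g \<longlongrightarrow> 0) (at 0 within T)"
  proof -
    have "(a - b) \<bullet> y + ((A y - B y) \<bullet> y) / 2 = (f y - f 0 - b \<bullet> y - (B y \<bullet> y) / 2) - (f y - f 0 - a \<bullet> y - (A y \<bullet> y) / 2)" for y
      by (simp add: inner_diff_left field_simps)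
    then have "g = (\<lambda>y. (f y - f 0 - b \<bullet> y - (B y \<bullet> y) / 2) / (norm y)\<^sup>2 - (f y - f 0 - a \<bullet> y - (A y \<bullet> y) / 2) / (norm y)\<^sup>2)"
      unfolding g_def by (intro ext) (simp only: diff_divide_distrib[symmetric])
    with tendsto_diff[OF b a] show ?thesis by (simp only: diff_self)
  qed
  have q: "(A y - B y) \<bullet> y = 0" if y: "y \<in> T" for y
  proof (cases "y = 0")
    case False
    define k where "k n = (1 / real (Suc n)) *\<^sub>R y" for n
    have k: "filterlim k (at 0 within T) sequentially"
    proof -
      have "(\<lambda>n. (1 / real (Suc n)) *\<^sub>R y) \<longlonglongrightarrow> 0 *\<^sub>R y"
        using LIMSEQ_inverse_real_of_nat by (intro tendsto_intros) (simp add: inverse_eq_divide)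
      then show ?thesis
        unfolding filterlim_at k_def using T y False by (auto simp: subspace_scale)
    qed
    have k': "filterlim (\<lambda>n. - k n) (at 0 within T) sequentially"
      using k T tendsto_minus[of k 0 sequentially] unfolding filterlim_at by (auto simp: subspace_neg elim!: eventually_mono)
    have "(\<lambda>n. g (k n) + g (- k n)) \<longlonglongrightarrow> 0 + 0"
      by (intro tendsto_add filterlim_compose[OF g] k k')
    moreover have "g (k n) + g (- k n) = (A y - B y) \<bullet> y / (norm y)\<^sup>2" for n
      using lin False
    proof -
      define c where "c = 1 / real (Suc n)"
      have c: "c > 0" by (simp add: c_def)
      have eq: "A (c *\<^sub>R y) = c *\<^sub>R A y" "B (c *\<^sub>R y) = c *\<^sub>R B y"
         "A (- (c *\<^sub>R y)) = - (c *\<^sub>R A y)" "B (- (c *\<^sub>R y)) = - (c *\<^sub>R B y)"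
        using lin by (simp_all add: linear_scale linear_neg)
      have "g (k n) + g (- k n) = c\<^sup>2 * ((A y - B y) \<bullet> y) / (c\<^sup>2 * (norm y)\<^sup>2)"
        unfolding k_def c_def[symmetric] g_def eq
        using c False by (simp add: inner_diff_left) (simp add: field_simps power2_eq_square)
      then show ?thesis using c by simp
    qed
    ultimately have "(A y - B y) \<bullet> y / (norm y)\<^sup>2 = 0"
      by (simp add: LIMSEQ_const_iff)
    then show ?thesis using False by simp
  qed simp
  have "(A y - B y) \<bullet> z = 0" if z: "z \<in> T" for z
  proof -
    have "(A (y + z) - B (y + z)) \<bullet> (y + z) = 0" using T y z by (intro q) (auto simp: subspace_add)
    moreover have "A z \<bullet> y = A y \<bullet> z" "B z \<bullet> y = B y \<bullet> z"
      using A B y z by (auto simp: has_alexandrov_hessian_def inner_commute)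
    ultimately show ?thesis
      using q[OF y] q[OF z] lin
      by (simp add: linear_add inner_add_left inner_add_right inner_diff_left algebra_simps)
  qed
  moreover have "A y - B y \<in> T"
    using A B T y by (auto simp: has_alexandrov_hessian_def intro!: subspace_diff)
  ultimately have "(A y - B y) \<bullet> (A y - B y) = 0" by blast
  then show ?thesis by simp
qed

lemma has_gauss_kronecker_curvature_unique:
  assumes V: "subspace V"
    and "has_gauss_kronecker_curvature V B x \<kappa>" "has_gauss_kronecker_curvature V B x \<kappa>'"
  shows "\<kappa> = \<kappa>'"
proof -
  obtain \<nu> A A' where *:
    "has_alexandrov_hessian {y \<in> V. y \<bullet> \<nu> = 0} (boundary_graph B x \<nu>) A"
    "has_alexandrov_hessian {y \<in> V. y \<bullet> \<nu> = 0} (boundary_graph B x \<nu>) A'"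
    "\<kappa> = det_on {y \<in> V. y \<bullet> \<nu> = 0} A" "\<kappa>' = det_on {y \<in> V. y \<bullet> \<nu> = 0} A'"
    using assms(2,3) by (auto simp: has_gauss_kronecker_curvature_def Let_def)
  define T where "T = {y \<in> V. y \<bullet> \<nu> = 0}"
  have T: "subspace T"
    using V by (auto simp: T_def subspace_def inner_add_left)
  have "closest_point T z \<in> T" for z
    using T closed_subspace[OF T] subspace_0[OF T] by (intro closest_point_in_set) auto
  then have "A (closest_point T z) = A' (closest_point T z)" for z
    using alexandrov_hessian_unique[OF T] * by (auto simp: T_def)
  then show ?thesis
    using *(3,4) by (simp add: det_on_def flip: T_def)
qed

section \<open>Spherical Gauss-Kronecker curvature and floating measure\<close>

definition sph_cap :: "real ^ 'n \<Rightarrow> real \<Rightarrow> (real ^ 'n) set" where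
  "sph_cap w \<epsilon> = {v \<in> sphere 0 1. sph_dist v w \<le> \<epsilon>}"

definition gnomonic :: "real ^ 'n \<Rightarrow> real ^ 'n \<Rightarrow> real ^ 'n" where
  "gnomonic w v = (1 / (w \<bullet> v)) *\<^sub>R v - w"

definition has_sph_curvature :: "(real ^ 'n) set \<Rightarrow> real ^ 'n \<Rightarrow> real \<Rightarrow> bool" where
  "has_sph_curvature K w \<kappa> \<longleftrightarrow>
     (\<forall>\<epsilon>. 0 < \<epsilon> \<and> \<epsilon> < pi / 2 \<longrightarrow>
        has_gauss_kronecker_curvature {x. x \<bullet> w = 0} (gnomonic w ` (K \<inter> sph_cap w \<epsilon>)) 0 \<kappa>)"

lemma has_sph_curvature_unique:
  assumes "has_sph_curvature K w \<kappa>" "has_sph_curvature K w \<kappa>'"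
  shows "\<kappa> = \<kappa>'"
proof (rule has_gauss_kronecker_curvature_unique)
  show "subspace {x. x \<bullet> w = 0}"
    by (auto simp: subspace_def inner_add_left)
qed (use assms pi_gt_zero in \<open>auto simp: has_sph_curvature_def dest!: spec[of _ "pi / 4"]\<close>)

text \<open>The value \<open>0\<close> is a genuine convention if \<open>K\<close> has empty interior; otherwise it is a dummy value
  on the exceptional null set of boundary points at which the curvature does not exist.\<close>

definition sph_curvature :: "(real ^ 'n) set \<Rightarrow> real ^ 'n \<Rightarrow> real" where
  "sph_curvature K w =
     (if sph_interior K \<noteq> {} \<and> (\<exists>\<kappa>. has_sph_curvature K w \<kappa>)
      then THE \<kappa>. has_sph_curvature K w \<kappa> else 0)"

text \<open>With \<open>CARD('n) = n + 1\<close>, the measure is \<open>(n - 1)\<close>-dimensional Hausdorff measure and the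
  exponent is \<open>1 / (n + 1)\<close>.\<close>

definition floating_measure :: "(real ^ 'n) set \<Rightarrow> (real ^ 'n) set \<Rightarrow> ennreal" where
  "floating_measure K \<omega> =
     (\<integral>\<^sup>+ w \<in> \<omega> \<inter> sph_boundary K.
        ennreal (sph_curvature K w powr (1 / real CARD('n))) \<partial>hausdorff_measure (CARD('n) - 2))"

end

theory Submission
  imports Defs
begin

text \<open>Each boundary splits into finitely many Borel pieces. Where the boundary of \<open>K\<close> lies outside
  \<open>L\<close> or in the interior of \<open>L\<close>, the body \<open>K\<close> coincides locally with \<open>K \<union> L\<close> or \<open>K \<inter> L\<close>, and
  curvature is local. At common boundary points of \<open>K\<close> and \<open>L\<close> inside \<open>K \<union> L\<close> the curvatures vanish:
  if \<open>K\<close> has a unique normal there, then \<open>L\<close> has the opposite one, and \<open>K\<close> is locally a half-space.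
  The essential piece \<open>E\<close> consists of the common boundary points of \<open>K\<close>, \<open>L\<close> and \<open>K \<union> L\<close>. By a
  Lebesgue density argument in bi-Lipschitz charts, at almost every point \<open>w\<close> of \<open>E\<close> the distance of
  boundary points \<open>v\<close> of \<open>K \<union> L\<close> to \<open>E\<close> is \<open>o(d v w)\<close>. At such a point the convex functions
  representing the boundaries of \<open>K\<close>, \<open>L\<close>, \<open>K \<union> L\<close> and \<open>K \<inter> L\<close> agree on a set so dense that
  convexity makes them share every second-order expansion. Hence the four curvatures agree almost
  everywhere on \<open>E\<close>, whether or not they exist, and Alexandrov's theorem is not needed.\<close>

section \<open>Porous sets and Hausdorff null sets\<close>

text \<open>Where no curvature exists the value is \<open>0\<close> by default, so on
  \<open>E\<close> the aim is that the predicate \<open>has_sph_curvature\<close> agrees for the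
  four bodies. The definition of \<open>thick\<close> has the strength this takes: a convex function
  known at points within o(|y|) of \<open>y\<close> is controlled at \<open>y\<close> up to a term
  quadratic in that distance, hence o(|y|^2), the accuracy of an Alexandrov expansion. Points of
  \<open>E\<close> that are not thick fall, in a chart, into countably many porous sets. Two graphs
  can be compared only over the same tangent space, so the normals must agree beforehand. Seen from
  a thick point, \<open>E\<close> follows every tangential direction of the union, which pins the
  normals of the smaller bodies to \<open>\<nu>\<close> or \<open>- \<nu>\<close>. Bodies are
  replaced by their cones: hulls commute with unions and with nonempty intersections, and a gnomonic
  image is a flat slice of the cone. Charts drop two dimensions, one radial and one transversal to
  the boundary. A body with empty interior is contained in the other one unless the union has empty
  interior too.\<close>

definition thick :: "'a::metric_space set \<Rightarrow> 'a set \<Rightarrow> 'a \<Rightarrow> bool" where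
  "thick E S w \<longleftrightarrow>
     (\<forall>\<epsilon>>0. \<exists>\<delta>>0. \<forall>v\<in>S. dist v w < \<delta> \<longrightarrow> (\<exists>e\<in>E. dist e v \<le> \<epsilon> * dist v w))"

text \<open>At every point of \<open>Q\<close> and at arbitrarily small scales there is a hole whose
  size is comparable with its distance from the point. Vitali's theorem picks disjoint balls inside
  an open superset \<open>U\<close> that cover almost all of \<open>Q\<close>, each with a hole that
  takes up the fixed proportion \<open>c\<close> of its volume. Deleting the holes loses no point of
  \<open>Q\<close>, so the infimum \<open>m\<close> of the measures of bounded open supersets
  satisfies m <= (1 - c) m and vanishes. Since \<open>Q\<close> may be nonmeasurable,
  \<open>m\<close> is taken over open supersets.\<close>

lemma negligible_porous:
  fixes P :: "'a::euclidean_space set"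
  assumes e: "0 < e"
    and bounded: "bounded Q"
    and porous: "\<And>x d. x \<in> Q \<Longrightarrow> 0 < d \<Longrightarrow>
      \<exists>y. dist y x < d \<and> (\<forall>z\<in>Q. e * dist y x < dist z y)"
  shows "negligible (Q :: 'a set)"
proof -
  let ?M = "measure lebesgue :: 'a set \<Rightarrow> real"
  define V where "V = {?M U | U. open U \<and> bounded U \<and> Q \<subseteq> U}"
  obtain R where R: "Q \<subseteq> ball 0 R" using bounded bounded_subset_ballD by metis
  have V: "V \<noteq> {}" "bdd_below V" 
    using R by (auto simp: V_def intro!: bdd_belowI[of _ 0] exI[of _ "ball 0 R"])
  define m where "m = Inf V"
  have m0: "0 \<le> m" unfolding m_def by (rule cInf_greatest[OF V(1)]) (auto simp: V_def)
  \<comment> \<open>The hole has radius \<open>2 * k * dist y x\<close> about \<open>y\<close>: the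
    bound 1/4 keeps it inside the ball of radius \<open>2 * dist y x\<close> about \<open>x\<close>,
    the bound \<open>e/4\<close> keeps it away from \<open>Q\<close>.\<close>
  define k where "k = min (e/4) (1/4)"
  have k: "0 < k" "k < 1" "k \<le> e/4" "k \<le> 1/4" using e by (auto simp: k_def)
  define c where "c = k ^ DIM('a)"
  have c: "0 < c" "c \<le> 1" using k by (auto simp: c_def intro: power_le_one)
  have step: "m \<le> (1 - c) * (m + \<eta>) + \<eta>" if \<eta>: "0 < \<eta>" for \<eta>
  proof -
    obtain U where U: "open U" "bounded U" "Q \<subseteq> U" "?M U < m + \<eta>"
      using cInf_lessD[OF V(1), of "m + \<eta>"] \<eta> by (auto simp: V_def m_def)
    define I where "I = {(x, y). x \<in> Q \<and> y \<noteq> x \<and> ball x (2 * dist y x) \<subseteq> U \<and>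
        (\<forall>z\<in>Q. e * dist y x < dist z y)}"
    obtain C where C: "countable C" "C \<subseteq> I"
      "pairwise (\<lambda>i j. disjnt (ball (fst i) (2 * dist (snd i) (fst i))) (ball (fst j) (2 * dist (snd j) (fst j)))) C"
      "negligible (Q - (\<Union>i\<in>C. ball (fst i) (2 * dist (snd i) (fst i))))"
    proof (rule Vitali_covering_theorem_balls[of Q I fst "\<lambda>i. 2 * dist (snd i) (fst i)"])
      fix x d assume x: "x \<in> Q" and d: "(0::real) < d"
      obtain r where r: "0 < r" "ball x r \<subseteq> U" using U x by (meson openE subsetD)
      obtain y where y: "dist y x < min (d/2) (r/2)" "\<forall>z\<in>Q. e * dist y x < dist z y"
        using porous[OF x, of "min (d/2) (r/2)"] r d by auto
      have "y \<noteq> x" using y(2) x by force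
      moreover have "ball x (2 * dist y x) \<subseteq> U" using y(1) r by (auto simp: subset_eq)
      ultimately show "\<exists>i. i \<in> I \<and> x \<in> ball (fst i) (2 * dist (snd i) (fst i)) \<and> 2 * dist (snd i) (fst i) < d"
        using x y by (intro exI[of _ "(x, y)"]) (auto simp: I_def)
    qed
    define B where "B i = ball (fst i) (2 * dist (snd i) (fst i))" for i :: "'a \<times> 'a"
    define H where "H i = cball (snd i) (2 * k * dist (snd i) (fst i))" for i :: "'a \<times> 'a"
    have HB: "H i \<subseteq> B i" if "i \<in> I" for i
    proof 
      fix z assume "z \<in> H i"
      then have "dist (snd i) z \<le> 2 * k * dist (snd i) (fst i)" by (simp add: H_def)
      also have "\<dots> \<le> 1/2 * dist (snd i) (fst i)" using k by (intro mult_right_mono) auto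
      finally have "dist (snd i) z \<le> 1/2 * dist (snd i) (fst i)" .
      moreover have "dist (snd i) (fst i) > 0" using that by (auto simp: I_def)
      moreover have "dist (fst i) z \<le> dist (snd i) (fst i) + dist (snd i) z" by (rule dist_triangle3)
      ultimately show "z \<in> B i" unfolding B_def mem_ball by linarith
    qed
    have QH: "Q \<inter> H i = {}" if "i \<in> I" for i
    proof -
      have "z \<notin> H i" if z: "z \<in> Q" for z
      proof
        assume "z \<in> H i"
        then have "dist (snd i) z \<le> 2 * k * dist (snd i) (fst i)" by (simp add: H_def)
        also have "\<dots> \<le> e * dist (snd i) (fst i)" using k e by (intro mult_right_mono) auto
        finally show False using \<open>i \<in> I\<close> z by (auto simp: I_def dist_commute)
      qed
      then show ?thesis by auto
    qed
    have mH: "?M (H i) = c * ?M (B i)" for i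
    proof -
      have "?M (H i) = unit_ball_vol (real DIM('a)) * (2 * k * dist (snd i) (fst i)) ^ DIM('a)"
        unfolding H_def using k content_cball[of "2 * k * dist (snd i) (fst i)" "snd i"] by simp
      moreover have "?M (B i) = unit_ball_vol (real DIM('a)) * (2 * dist (snd i) (fst i)) ^ DIM('a)"
        unfolding B_def using content_ball[of "2 * dist (snd i) (fst i)" "fst i"] by simp
      ultimately show ?thesis by (simp add: c_def power_mult_distrib)
    qed
    define W where "W = (\<Union>i\<in>C. B i - H i)"
    have lm: "B i - H i \<in> lmeasurable" "B i \<in> lmeasurable" "H i \<in> lmeasurable" for i
      by (auto simp: B_def H_def)
    have WU: "W \<subseteq> U" using C by (auto simp: W_def B_def I_def subset_eq)
    have oW: "open W" by (auto simp: W_def B_def H_def intro!: open_Diff)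
    have disj: "disjoint_family_on B C"
      using C(3) by (auto simp: disjoint_family_on_def pairwise_def disjnt_def B_def)
    have eD: "emeasure lebesgue (B i - H i) = ennreal (1 - c) * emeasure lebesgue (B i)" if "i \<in> C" for i
    proof -
      have "?M (B i - H i) = ?M (B i) - ?M (H i)"
        using HB[of i] that C lm by (subst measurable_measure_Diff) (auto simp: fmeasurableD)
      then have "?M (B i - H i) = (1 - c) * ?M (B i)" by (simp add: mH algebra_simps)
      then show ?thesis
        using lm[of i] c by (simp add: emeasure_eq_measure2 ennreal_mult)
    qed
    have disj': "disjoint_family_on (\<lambda>i. B i - H i) C"
      using disj unfolding disjoint_family_on_def by blast
    have "emeasure lebesgue W = (\<integral>\<^sup>+i. emeasure lebesgue (B i - H i) \<partial>count_space C)"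
      unfolding W_def using C(1) disj' lm by (intro emeasure_UN_countable) (auto simp: fmeasurableD)
    also have "\<dots> = (\<integral>\<^sup>+i. ennreal (1 - c) * emeasure lebesgue (B i) \<partial>count_space C)"
      using eD by (intro nn_integral_cong) simp
    also have "\<dots> = ennreal (1 - c) * (\<integral>\<^sup>+i. emeasure lebesgue (B i) \<partial>count_space C)"
      by (rule nn_integral_cmult) simp
    also have "(\<integral>\<^sup>+i. emeasure lebesgue (B i) \<partial>count_space C) = emeasure lebesgue (\<Union>i\<in>C. B i)"
      using C(1) disj lm by (intro emeasure_UN_countable[symmetric]) (auto simp: fmeasurableD)
    also have "emeasure lebesgue (\<Union>i\<in>C. B i) \<le> emeasure lebesgue U"
      using C U(1) by (intro emeasure_mono) (auto simp: B_def I_def subset_eq)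
    also have "emeasure lebesgue U = ennreal (?M U)"
      using U by (intro emeasure_eq_measure2) (auto intro: lmeasurable_open)
    also have "ennreal (1 - c) * ennreal (?M U) = ennreal ((1 - c) * ?M U)"
      using c by (simp add: ennreal_mult)
    finally have W: "emeasure lebesgue W \<le> ennreal ((1 - c) * ?M U)"
      using mult_left_mono by (metis zero_le)
    have bW: "W \<in> lmeasurable" using oW U(2) WU by (meson bounded_subset lmeasurable_open)
    have W': "?M W \<le> (1 - c) * ?M U"
      using W c bW by (subst (asm) emeasure_eq_measure2) auto
    define N where "N = Q - W"
    have "N \<subseteq> Q - (\<Union>i\<in>C. B i)" using QH C(2) unfolding N_def W_def by fast
    then have N: "negligible N" using C(4) by (auto simp: B_def intro: negligible_subset)
    obtain T where T: "open T" "N \<subseteq> T" "T \<in> lmeasurable" "?M T < \<eta>"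
    proof -
      obtain T where T: "open T" "N \<subseteq> T" "T - N \<in> lmeasurable" "emeasure lebesgue (T - N) < ennreal \<eta>"
        using sets_lebesgue_outer_open[OF negligible_imp_sets[OF N] \<eta>] by metis
      have *: "T = (T - N) \<union> N" using T by auto
      have "T \<in> lmeasurable"
        by (subst *) (intro fmeasurable.Un T negligible_imp_measurable N)
      moreover have "?M T = ?M (T - N)"
        using N by (subst measure_Diff_null_set) (auto simp: negligible_iff_null_sets \<open>T \<in> lmeasurable\<close> fmeasurableD)
      moreover have "?M (T - N) < \<eta>"
        using T(3,4) by (subst (asm) emeasure_eq_measure2) (auto simp: ennreal_less_iff)
      ultimately show ?thesis using that T by metis
    qed
    \<comment> \<open>Members of \<open>V\<close> are bounded, hence the cut with a ball that
      contains \<open>Q\<close>.\<close>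
    let ?T = "T \<inter> ball 0 R"
    have "m \<le> ?M (W \<union> ?T)"
      unfolding m_def
    proof (rule cInf_lower[OF _ V(2)])
      have "Q \<subseteq> W \<union> ?T" using T(2) R by (auto simp: N_def)
      moreover have "bounded (W \<union> ?T)" using WU U(2) by (auto intro: bounded_subset bounded_Int)
      ultimately show "?M (W \<union> ?T) \<in> V"
        using oW T(1) by (auto simp: V_def intro!: exI[of _ "W \<union> ?T"])
    qed
    also have "\<dots> \<le> ?M W + ?M ?T"
      using bW T by (intro measure_Un_le) (auto simp: fmeasurableD)
    also have "?M ?T \<le> ?M T"
      using T by (intro measure_mono_fmeasurable) auto
    also have "?M W + ?M T \<le> (1 - c) * ?M U + \<eta>" using W' T by linarith
    also have "\<dots> \<le> (1 - c) * (m + \<eta>) + \<eta>" using U(4) c by (intro add_right_mono mult_left_mono) auto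
    finally show ?thesis by simp
  qed
  have "c * m \<le> 0"
  proof (rule field_le_epsilon)
    fix t :: real assume t: "0 < t"
    have "m \<le> (1 - c) * (m + t/2) + t/2" using step[of "t/2"] t by simp
    moreover have "(1 - c) * (m + t/2) \<le> m - c*m + t/2" using c t by (simp add: algebra_simps)
    ultimately show "c * m \<le> 0 + t" by linarith
  qed
  then have "m = 0" using m0 c by (simp add: mult_le_0_iff)
  show ?thesis
    unfolding negligible_outer
  proof (intro allI impI)
    fix t :: real assume "0 < t"
    then obtain v where "v \<in> V" "v < t" using cInf_lessD[OF V(1), of t] \<open>m = 0\<close> by (auto simp: m_def)
    then show "\<exists>T. Q \<subseteq> T \<and> T \<in> lmeasurable \<and> ?M T < t"
      by (auto simp: V_def intro: lmeasurable_open)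
  qed
qed

section \<open>Lipschitz images of Lebesgue null sets\<close>

lemma diameter_image_lipschitz_le:
  fixes f :: "'b::metric_space \<Rightarrow> 'a::metric_space"
  assumes lip: "\<And>x y. x \<in> S \<Longrightarrow> y \<in> S \<Longrightarrow> dist (f x) (f y) \<le> L * dist x y"
    and L: "0 \<le> L" and d: "\<And>x y. x \<in> S \<Longrightarrow> y \<in> S \<Longrightarrow> dist x y \<le> d" and d0: "0 \<le> d"
  shows "bounded (f ` S)" "diameter (f ` S) \<le> L * d"
proof -
  have le: "dist x y \<le> L * d" if xy: "x \<in> f ` S" "y \<in> f ` S" for x y
  proof -
    obtain a b where ab: "a \<in> S" "b \<in> S" "x = f a" "y = f b" using xy by blast
    show ?thesis using lip[OF ab(1,2)] mult_left_mono[OF d[OF ab(1,2)] L] ab by simp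
  qed
  show "bounded (f ` S)"
    unfolding bounded_def using le by blast
  show "diameter (f ` S) \<le> L * d"
    using le L d0 by (auto simp: diameter_def intro!: cSUP_least)
qed

text \<open>A null set lies in an open set of measure below \<open>e\<close> and is covered by
  non-overlapping cubes inside it. As \<open>m\<close> is the dimension of the domain, the gauge of
  the image of a cube is at most a constant times the volume of the cube, so the image has
  arbitrarily small premeasure at every scale.\<close>

lemma hausdorff_outer_lipschitz_image_negligible:
  fixes f :: "'b::euclidean_space \<Rightarrow> 'a::metric_space"
  assumes neg: "negligible S" and bounded: "bounded S"
    and lip: "\<And>x y. x \<in> S \<Longrightarrow> y \<in> S \<Longrightarrow> dist (f x) (f y) \<le> L * dist x y"
    and L: "0 \<le> L"
  shows "hausdorff_outer DIM('b) (f ` S) = 0"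
proof -
  define m where "m = DIM('b)"
  have m: "0 < m" by (simp add: m_def)
  \<comment> \<open>Gauge per unit volume: a cube of side \<open>h\<close> has diameter at most
    \<open>m * h\<close>, by summing coordinates, and its image has diameter at most
    \<open>L * (m * h)\<close>.\<close>
  define c where "c = unit_ball_vol (real m) * (L * m / 2) ^ m"
  have c: "0 \<le> c" using L by (simp add: c_def)
  \<comment> \<open>All edges of the bounding box are equally long, so that its dyadic parts are
    cubes; thin boxes would have small volume but large diameter.\<close>
  obtain a b where ab: "S \<subseteq> cbox a b" "box a b \<noteq> {}" "\<And>i. i \<in> Basis \<Longrightarrow> b \<bullet> i - a \<bullet> i = b \<bullet> (SOME i. i \<in> Basis) - a \<bullet> (SOME i. i \<in> Basis)"
  proof -
    obtain r where r: "\<And>x. x \<in> S \<Longrightarrow> norm x \<le> r" "0 < r"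
      using bounded bounded_pos by metis
    have "(SOME i::'b. i \<in> Basis) \<in> Basis" by (rule someI_ex) (use nonempty_Basis in blast)
    show ?thesis
    proof
      show "S \<subseteq> cbox (- r *\<^sub>R One) (r *\<^sub>R One)"
      proof
        fix x assume "x \<in> S"
        then have "\<bar>x \<bullet> i\<bar> \<le> r" if "i \<in> Basis" for i
          using r(1)[of x] Basis_le_norm[OF that, of x] by linarith
        then show "x \<in> cbox (- r *\<^sub>R One) (r *\<^sub>R One)"
          by (force simp: mem_box abs_le_iff)
      qed
    qed (use r \<open>_ \<in> Basis\<close> in \<open>auto simp: box_ne_empty\<close>)
  qed
  have pre: "hausdorff_pre m \<delta> (f ` S) \<le> ennreal (c * e)" if \<delta>: "0 < \<delta>" and e: "0 < e" for \<delta> e :: real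
  proof -
    obtain U where U: "open U" "S \<subseteq> U" "U - S \<in> lmeasurable" "emeasure lebesgue (U - S) < ennreal e"
      using sets_lebesgue_outer_open[OF negligible_imp_sets[OF neg] e] by metis
    have "emeasure lebesgue U = emeasure lebesgue (U - S)"
      using neg U by (subst emeasure_Diff_null_set) (auto simp: negligible_iff_null_sets)
    then have eU: "emeasure lebesgue U \<le> ennreal e" using U(4) by simp
    \<comment> \<open>Parts of \<open>S\<close> in balls of radius \<open>\<eta>\<close> have images
      of diameter at most \<open>\<delta>\<close>; the summand 1 admits
      \<open>L = 0\<close>.\<close>
    define \<eta> where "\<eta> = \<delta> / (2 * L + 1)"
    have \<eta>: "0 < \<eta>" "L * (2 * \<eta>) \<le> \<delta>" using L \<delta> by (auto simp: \<eta>_def field_simps)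
    obtain D where D: "countable D" "\<Union>D \<subseteq> cbox a b"
      "\<And>K. K \<in> D \<Longrightarrow> interior K \<noteq> {} \<and> (\<exists>c d. K = cbox c d)"
      "pairwise (\<lambda>A B. interior A \<inter> interior B = {}) D"
      "\<And>K. K \<in> D \<Longrightarrow> \<exists>x \<in> S \<inter> K. K \<subseteq> (if x \<in> S then ball x \<eta> \<inter> U else UNIV)"
      "\<And>u v. cbox u v \<in> D \<Longrightarrow> \<exists>n. \<forall>i \<in> Basis. v \<bullet> i - u \<bullet> i = (b \<bullet> i - a \<bullet> i) / 2^n"
      "S \<subseteq> \<Union>D"
      by (rule covering_lemma[OF ab(1,2), of "\<lambda>x. if x \<in> S then ball x \<eta> \<inter> U else UNIV"])
        (use U \<eta> in \<open>auto simp: gauge_def\<close>)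
    define I where "I = to_nat_on D ` D"
    define K where "K = from_nat_into D"
    have K: "K i \<in> D" "to_nat_on D (K i) = i" if "i \<in> I" for i
      using that D(1) by (auto simp: I_def K_def)
    define A where "A i = (if i \<in> I then f ` (S \<inter> K i) else {})" for i
    \<comment> \<open>The cubes cover \<open>S\<close>, but only their interiors are disjoint, so
      the volumes are summed over interiors.\<close>
    define V where "V i = (if i \<in> I then interior (K i) else {})" for i
    have cover: "f ` S \<subseteq> (\<Union>i. A i)"
    proof
      fix y assume "y \<in> f ` S"
      then obtain x where x: "x \<in> S" "y = f x" by auto
      then obtain C where "C \<in> D" "x \<in> C" using D(7) by auto
      then have "to_nat_on D C \<in> I" "K (to_nat_on D C) = C" using D(1) by (auto simp: I_def K_def)
      then have "y \<in> A (to_nat_on D C)" using x \<open>x \<in> C\<close> by (auto simp: A_def)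
      then show "y \<in> (\<Union>i. A i)" by blast
    qed
    have A: "bounded (A i) \<and> diameter (A i) \<le> \<delta> \<and> hausdorff_gauge m (A i) \<le> ennreal c * emeasure lebesgue (V i)" for i
    proof (cases "i \<in> I")
      case False
      then show ?thesis using \<delta> by (auto simp: A_def diameter_def)
    next
      case True
      note Ki = K[OF True]
      obtain u v where uv: "K i = cbox u v" using D(3) Ki by metis
      obtain n where n: "\<forall>j\<in>Basis. v \<bullet> j - u \<bullet> j = (b \<bullet> j - a \<bullet> j) / 2^n" using D(6) Ki uv by metis
      define h where "h = (b \<bullet> (SOME i. i \<in> Basis) - a \<bullet> (SOME i. i \<in> Basis)) / 2^n"
      have h: "v \<bullet> j - u \<bullet> j = h" if "j \<in> Basis" for j
        using n ab(3) that by (simp add: h_def)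
      have ne: "box u v \<noteq> {}" using D(3)[OF Ki(1)] uv by (auto simp: interior_cbox)
      have h0: "0 < h"
      proof -
        obtain j :: 'b where "j \<in> Basis" using nonempty_Basis by blast
        then show ?thesis using ne h[of j] by (auto simp: box_ne_empty)
      qed
      have mu: "emeasure lebesgue (V i) = ennreal (h ^ m)"
      proof -
        have "emeasure lebesgue (V i) = emeasure lborel (box u v)"
          using True by (simp add: V_def uv interior_cbox)
        also have "\<dots> = ennreal (\<Prod>j\<in>Basis. (v - u) \<bullet> j)"
          using ne by (intro emeasure_lborel_box) (auto simp: box_ne_empty intro: less_imp_le)
        also have "(\<Prod>j\<in>Basis. (v - u) \<bullet> j) = h ^ m" using h by (simp add: inner_diff_left m_def)
        finally show ?thesis .
      qed
      have small: "dist x y \<le> m * h" if "x \<in> K i" "y \<in> K i" for x y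
      proof -
        have "dist x y \<le> (\<Sum>j\<in>Basis. \<bar>(x - y) \<bullet> j\<bar>)" unfolding dist_norm by (rule norm_le_l1)
        also have "\<dots> \<le> (\<Sum>j\<in>(Basis::'b set). h)"
        proof (rule sum_mono)
          fix j :: 'b assume j: "j \<in> Basis"
          have "u \<bullet> j \<le> x \<bullet> j \<and> x \<bullet> j \<le> v \<bullet> j" "u \<bullet> j \<le> y \<bullet> j \<and> y \<bullet> j \<le> v \<bullet> j"
            using that j by (auto simp: uv mem_box)
          then show "\<bar>(x - y) \<bullet> j\<bar> \<le> h" using h[OF j] by (auto simp: inner_diff_left)
        qed
        finally show ?thesis by (simp add: m_def)
      qed
      have small2: "dist x y \<le> 2 * \<eta>" if "x \<in> K i" "y \<in> K i" for x y
      proof -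
        obtain z where "z \<in> S" "K i \<subseteq> ball z \<eta>" using D(5)[OF Ki(1)] by auto
        then have "dist z x < \<eta>" "dist z y < \<eta>" using that by auto
        then show ?thesis using dist_triangle3[of x y z] by linarith
      qed
      have Ai: "A i = f ` (S \<inter> K i)" using True by (simp add: A_def)
      have lip': "dist (f x) (f y) \<le> L * dist x y" if "x \<in> S \<inter> K i" "y \<in> S \<inter> K i" for x y
        using lip that by blast
      have 1: "bounded (A i)" "diameter (A i) \<le> L * (m * h)"
        unfolding Ai
        by (rule diameter_image_lipschitz_le[where d = "m * h", OF lip' L]; use small h0 in auto)+
      have 2: "diameter (A i) \<le> L * (2 * \<eta>)"
        unfolding Ai
        by (rule diameter_image_lipschitz_le[where d = "2 * \<eta>", OF lip' L]; use small2 \<eta> in auto)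
      have "hausdorff_gauge m (A i) \<le> ennreal (unit_ball_vol (real m) * (diameter (A i) / 2) ^ m)"
        by (simp add: hausdorff_gauge_def)
      also have "\<dots> \<le> ennreal (unit_ball_vol (real m) * (L * (m * h) / 2) ^ m)"
        using 1 diameter_ge_0[OF 1(1)] by (intro ennreal_leI mult_left_mono power_mono divide_right_mono) auto
      also have "unit_ball_vol (real m) * (L * (m * h) / 2) ^ m = c * h ^ m"
        by (simp add: c_def power_mult_distrib field_simps)
      also have "ennreal (c * h ^ m) = ennreal c * emeasure lebesgue (V i)"
        using c h0 by (simp add: mu ennreal_mult)
      finally show ?thesis using 1 2 \<eta> by auto
    qed
    have "hausdorff_pre m \<delta> (f ` S) \<le> (\<Sum>i. hausdorff_gauge m (A i))"
      using A by (intro hausdorff_pre_le cover) auto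
    also have "\<dots> \<le> (\<Sum>i. ennreal c * emeasure lebesgue (V i))"
      using A by (intro suminf_le) auto
    also have "\<dots> = ennreal c * (\<Sum>i. emeasure lebesgue (V i))"
      by (rule ennreal_suminf_cmult)
    also have "(\<Sum>i. emeasure lebesgue (V i)) = emeasure lebesgue (\<Union>i. V i)"
    proof (rule suminf_emeasure)
      show "range V \<subseteq> sets lebesgue" by (auto simp: V_def)
      show "disjoint_family V"
      proof (unfold disjoint_family_on_def, intro ballI impI)
        fix i j :: nat assume "i \<noteq> j"
        show "V i \<inter> V j = {}"
        proof (cases "i \<in> I \<and> j \<in> I")
          case True
          then have "K i \<noteq> K j" using K \<open>i \<noteq> j\<close> by metis
          then show ?thesis using D(4) K True by (auto simp: V_def pairwise_def)
        qed (auto simp: V_def)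
      qed
    qed
    also have "emeasure lebesgue (\<Union>i. V i) \<le> emeasure lebesgue U"
    proof (rule emeasure_mono)
      have "V i \<subseteq> U" for i
      proof (cases "i \<in> I")
        case True
        then have "K i \<subseteq> U" using D(5)[OF K(1)[OF True]] by auto
        then show ?thesis using interior_subset by (auto simp: V_def)
      qed (simp add: V_def)
      then show "(\<Union>i. V i) \<subseteq> U" by blast
    qed (use U in auto)
    also note eU
    also have "ennreal c * ennreal e = ennreal (c * e)" using c e by (simp add: ennreal_mult)
    finally show ?thesis by (simp add: mult_left_mono)
  qed
  have "hausdorff_pre m \<delta> (f ` S) = 0" if \<delta>: "0 < \<delta>" for \<delta> :: real
  proof -
    have "hausdorff_pre m \<delta> (f ` S) \<le> 0"
    proof (rule ennreal_le_epsilon)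
      fix e :: real assume e: "0 < e"
      have "hausdorff_pre m \<delta> (f ` S) \<le> ennreal (c * (e / (c + 1)))"
        using c e by (intro pre \<delta>) auto
      also have "\<dots> \<le> ennreal e" using c e by (intro ennreal_leI) (simp add: field_simps)
      finally show "hausdorff_pre m \<delta> (f ` S) \<le> 0 + ennreal e" by simp
    qed
    then show ?thesis by simp
  qed
  then show ?thesis unfolding hausdorff_outer_def m_def[symmetric] by simp
qed

text \<open>Passing to closures keeps the gauge of a covering set, so intersecting ever finer closed
  covers gives a Borel null set around \<open>N\<close>. This serves the set of points that are not
  thick: it is not known to be Borel, while \<open>emeasure\<close> of the Hausdorff measure is tied
  to \<open>hausdorff_outer\<close> on Borel sets.\<close>

lemma hausdorff_outer_null_borel:
  fixes N :: "'a::metric_space set"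
  assumes "hausdorff_outer s N = 0"
  obtains B where "B \<in> sets borel" "N \<subseteq> B" "hausdorff_outer s B = 0"
proof -
  have "\<exists>U. N \<subseteq> (\<Union>i::nat. U i) \<and> (\<forall>i. bounded (U i) \<and> diameter (U i) \<le> 1 / Suc k) \<and>
      (\<Sum>i. hausdorff_gauge s (U i)) < ennreal (1 / Suc k)" for k
  proof -
    have "hausdorff_pre s (1 / Suc k) N = 0"
      using hausdorff_pre_le_outer[of "1 / Suc k" s N] assms by simp
    then have "hausdorff_pre s (1 / Suc k) N < ennreal (1 / Suc k)" by simp
    then show ?thesis unfolding hausdorff_pre_def INF_less_iff by auto
  qed
  then obtain U where U: "\<And>k. N \<subseteq> (\<Union>i::nat. U k i)" "\<And>k i. bounded (U k i)"
      "\<And>k i. diameter (U k i) \<le> 1 / Suc k" "\<And>k. (\<Sum>i. hausdorff_gauge s (U k i)) < ennreal (1 / Suc k)"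
    by metis
  define B where "B = (\<Inter>k. \<Union>i. closure (U k i))"
  have gauge: "hausdorff_gauge s (closure (U k i)) = hausdorff_gauge s (U k i)" for k i
    using U(2) by (simp add: hausdorff_gauge_def diameter_closure)
  have pre: "hausdorff_pre s \<delta> B = 0" if \<delta>: "0 < \<delta>" for \<delta>
  proof -
    have le: "hausdorff_pre s \<delta> B \<le> 0 + ennreal e" if e: "0 < e" for e
    proof -
      obtain k where k: "1 / Suc k < min \<delta> e" using \<delta> e reals_Archimedean[of "min \<delta> e"] by (auto simp: inverse_eq_divide)
      have "hausdorff_pre s \<delta> B \<le> (\<Sum>i. hausdorff_gauge s (closure (U k i)))"
      proof (rule hausdorff_pre_le)
        show "diameter (closure (U k i)) \<le> \<delta>" for i
          using U(2,3)[of k i] k by (simp add: diameter_closure)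
      qed (use U(2) in \<open>auto simp: B_def\<close>)
      also have "\<dots> \<le> ennreal (1 / Suc k)" unfolding gauge using U(4)[of k] by simp
      also have "\<dots> \<le> ennreal e" using k by (intro ennreal_leI) simp
      finally show ?thesis by simp
    qed
    have "hausdorff_pre s \<delta> B \<le> 0" by (rule ennreal_le_epsilon) (use le in auto)
    then show ?thesis by simp
  qed
  show ?thesis
  proof
    have "(\<Union>i. U k i) \<subseteq> (\<Union>i. closure (U k i))" for k
      by (intro UN_mono closure_subset) auto
    then show "N \<subseteq> B" using order_trans[OF U(1)] unfolding B_def by (metis INT_greatest)
    show "B \<in> sets borel" unfolding B_def by auto
    show "hausdorff_outer s B = 0" unfolding hausdorff_outer_def by (simp add: pre)
  qed
qed

section \<open>Transfer of second-order expansions\<close>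

text \<open>For the upper bound on \<open>g y\<close>, the point \<open>y\<close> is a convex combination of coincidence points at
  distance at most \<open>\<epsilon> * norm y\<close>. The lower bound follows by reflecting \<open>y\<close> at a nearby coincidence
  point.\<close>

lemma has_alexandrov_hessian_transfer:
  fixes f g :: "real ^ 'n \<Rightarrow> real"
  assumes T: "subspace T" and f: "has_alexandrov_hessian T f A"
    and zero: "f 0 = g 0"
    and \<rho>: "0 < \<rho>" and conv: "convex_on (T \<inter> ball 0 \<rho>) g"
    and dense: "thick {y\<in>T. f y = g y} T 0"
  shows "has_alexandrov_hessian T g A"
proof -
  obtain a where a: "a \<in> T"
    and lim: "((\<lambda>y. (f y - f 0 - a \<bullet> y - (A y \<bullet> y) / 2) / (norm y)\<^sup>2) \<longlongrightarrow> 0) (at 0 within T)"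
    and A: "linear A" "A ` T \<subseteq> T" "\<forall>y\<in>T. \<forall>z\<in>T. A y \<bullet> z = y \<bullet> A z"
    using f by (auto simp: has_alexandrov_hessian_def)
  obtain C where C: "0 < C" "\<And>y. norm (A y) \<le> C * norm y"
    using linear_bounded_pos[OF A(1)] by blast
  have quad: "\<bar>A y \<bullet> y\<bar> \<le> C * (norm y)\<^sup>2" for y
  proof -
    have "\<bar>A y \<bullet> y\<bar> \<le> norm (A y) * norm y" by (rule Cauchy_Schwarz_ineq2)
    also have "\<dots> \<le> (C * norm y) * norm y" by (intro mult_right_mono C) auto
    finally show ?thesis by (simp add: power2_eq_square)
  qed
  \<comment> \<open>The second-order polynomial of \<open>f\<close> at \<open>0\<close>, with
    constant term \<open>g 0\<close>, which equals \<open>f 0\<close>.\<close>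
  define h where "h y = g 0 + a \<bullet> y + (A y \<bullet> y) / 2" for y
  have h: "h (y + z) = h y + (a + A y) \<bullet> z + (A z \<bullet> z) / 2" if "y \<in> T" "z \<in> T" for y z
  proof -
    have "A z \<bullet> y = A y \<bullet> z" using A(3) that by (metis inner_commute)
    then show ?thesis
      by (simp add: h_def linear_add[OF A(1)] inner_add_left inner_add_right field_simps)
  qed
  have onZ: "\<exists>\<delta>>0. \<forall>z\<in>T. f z = g z \<longrightarrow> norm z < \<delta> \<longrightarrow> \<bar>g z - h z\<bar> \<le> \<eta> * (norm z)\<^sup>2" if \<eta>: "0 < \<eta>" for \<eta>
  proof -
    obtain \<delta> where \<delta>: "0 < \<delta>" and d: "\<And>y. y \<in> T \<Longrightarrow> y \<noteq> 0 \<Longrightarrow> norm y < \<delta> \<Longrightarrow>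
        \<bar>(f y - f 0 - a \<bullet> y - (A y \<bullet> y) / 2) / (norm y)\<^sup>2\<bar> < \<eta>"
      using lim \<eta> unfolding tendsto_iff eventually_at dist_norm real_norm_def diff_zero by metis
    have "\<bar>g z - h z\<bar> \<le> \<eta> * (norm z)\<^sup>2" if z: "z \<in> T" "f z = g z" "norm z < \<delta>" for z
    proof (cases "z = 0")
      case True
      then show ?thesis by (simp add: h_def linear_0[OF A(1)])
    next
      case False
      then have "\<bar>g z - h z\<bar> / (norm z)\<^sup>2 < \<eta>"
        using d[OF z(1) False z(3)] z(2) zero by (simp add: h_def abs_divide algebra_simps)
      then show ?thesis using False by (simp add: field_simps)
    qed
    then show ?thesis using \<delta> by blast
  qed
  have denseD: "\<exists>\<delta>>0. \<forall>y\<in>T. norm y < \<delta> \<longrightarrow> (\<exists>z\<in>T. f z = g z \<and> norm (z - y) \<le> \<epsilon> * norm y)"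
    if "0 < \<epsilon>" for \<epsilon>
    using dense that unfolding thick_def dist_norm diff_zero by fast
  have upper: "\<exists>\<delta>>0. \<forall>y\<in>T. norm y < \<delta> \<longrightarrow> g y - h y \<le> \<kappa> * (norm y)\<^sup>2" if \<kappa>: "0 < \<kappa>" for \<kappa>
  proof -
    \<comment> \<open>Over a distance \<open>\<epsilon> * norm y\<close> the quadratic remainder of
      \<open>h\<close> is at most half of \<open>\<kappa> * (norm y)\<^sup>2\<close>. The other half
      is for the values at coincidence points \<open>z\<close>, where
      \<open>norm z \<le> 2 * norm y\<close> turns \<open>\<kappa>/8\<close> into
      \<open>\<kappa>/2\<close>.\<close>
    define \<epsilon> where "\<epsilon> = min 1 (\<kappa> / C)"
    have \<epsilon>: "0 < \<epsilon>" "\<epsilon> \<le> 1" "C * \<epsilon> \<le> \<kappa>" using \<kappa> C by (auto simp: \<epsilon>_def min_def field_simps)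
    obtain \<delta>1 where \<delta>1: "0 < \<delta>1" "\<And>z. z \<in> T \<Longrightarrow> f z = g z \<Longrightarrow> norm z < \<delta>1 \<Longrightarrow> \<bar>g z - h z\<bar> \<le> (\<kappa>/8) * (norm z)\<^sup>2"
      using onZ[of "\<kappa>/8"] \<kappa> by auto
    obtain \<delta>2 where \<delta>2: "0 < \<delta>2" "\<And>y. y \<in> T \<Longrightarrow> norm y < \<delta>2 \<Longrightarrow> \<exists>z\<in>T. f z = g z \<and> norm (z - y) \<le> (\<epsilon>/8) * norm y"
      using denseD[of "\<epsilon>/8"] \<epsilon> by auto
    define \<delta> where "\<delta> = min (min \<delta>1 \<delta>2) \<rho> / 2"
    have \<delta>: "0 < \<delta>" "2 * \<delta> \<le> \<delta>1" "2 * \<delta> \<le> \<delta>2" "2 * \<delta> \<le> \<rho>"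
      using \<delta>1 \<delta>2 \<rho> by (auto simp: \<delta>_def)
    have "g y - h y \<le> \<kappa> * (norm y)\<^sup>2" if y: "y \<in> T" "norm y < \<delta>" for y
    proof (cases "y = 0")
      case True then show ?thesis by (simp add: h_def linear_0[OF A(1)])
    next
      case False
      define Z where "Z = {z\<in>T. f z = g z \<and> norm (z - y) \<le> \<epsilon> * norm y}"
      have near: "norm z \<le> 2 * norm y" if "norm (z - y) \<le> \<epsilon> * norm y" for z
      proof -
        have "norm z \<le> norm (z - y) + norm y" by (metis diff_add_cancel norm_triangle_ineq)
        also have "\<dots> \<le> 1 * norm y + norm y"
          using that mult_right_mono[OF \<epsilon>(2), of "norm y"] by simp
        finally show ?thesis by simp
      qed
      \<comment> \<open>Otherwise a hyperplane through \<open>y\<close> has \<open>Z\<close> on one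
        side. A step of length \<open>\<epsilon>/2 * norm y\<close> to the other side ends at a
        point with a coincidence point within \<open>\<epsilon>/4 * norm y\<close>, which belongs to
        \<open>Z\<close> and lies on the wrong side.\<close>
      have "y \<in> convex hull Z"
      proof (rule ccontr)
        assume ny: "y \<notin> convex hull Z"
        have "y \<in> T" "norm y < \<delta>2" using y \<delta> by auto
        then obtain z0 where "z0 \<in> T" "f z0 = g z0" "norm (z0 - y) \<le> \<epsilon>/8 * norm y" using \<delta>2(2) by blast
        moreover have "\<epsilon>/8 * norm y \<le> \<epsilon> * norm y" using \<epsilon> by (intro mult_right_mono) auto
        ultimately have "z0 \<in> Z" by (auto simp: Z_def)
        then have ne: "(\<lambda>x. x - y) ` (convex hull Z) \<noteq> {}" using hull_inc by fastforce
        have "convex ((\<lambda>x. x - y) ` (convex hull Z))"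
          using convex_translation[of "convex hull Z" "- y"] convex_convex_hull by (simp add: image_def)
        moreover have "0 \<notin> (\<lambda>x. x - y) ` (convex hull Z)" using ny by auto
        \<comment> \<open>Separation within the span keeps \<open>b\<close> in \<open>T\<close>, so
          that the displaced point \<open>x\<close> stays in \<open>T\<close>, where coincidence
          points are at hand.\<close>
        ultimately obtain b where
          b: "b \<in> span ((\<lambda>x. x - y) ` (convex hull Z))" "b \<noteq> 0" "\<And>x. x \<in> convex hull Z \<Longrightarrow> 0 \<le> b \<bullet> (x - y)"
          using separating_hyperplane_set_0_inspan[OF _ ne] by (metis imageI)
        have "convex hull Z \<subseteq> T" by (rule hull_minimal) (auto simp: Z_def subspace_imp_convex[OF T])
        then have "(\<lambda>x. x - y) ` (convex hull Z) \<subseteq> T" using T y by (auto intro: subspace_diff)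
        then have bT: "b \<in> T" using b(1) T span_minimal by blast
        define x where "x = y - (\<epsilon>/2 * norm y / norm b) *\<^sub>R b"
        have x: "x \<in> T" using T y bT by (auto simp: x_def intro!: subspace_diff subspace_scale)
        have nx: "norm (x - y) = \<epsilon>/2 * norm y" using b(2) \<epsilon> by (simp add: x_def)
        moreover have "\<epsilon>/2 * norm y \<le> \<epsilon> * norm y" using \<epsilon> by (intro mult_right_mono) auto
        ultimately have x2: "norm x \<le> 2 * norm y" using near by simp
        then have "norm x < \<delta>2" using y(2) \<delta> by linarith
        then obtain z where z: "z \<in> T" "f z = g z" "norm (z - x) \<le> \<epsilon>/8 * norm x" using \<delta>2(2)[OF x] by blast
        have zx: "norm (z - x) \<le> \<epsilon>/4 * norm y"
        proof -
          have "\<epsilon>/8 * norm x \<le> \<epsilon>/8 * (2 * norm y)" using x2 \<epsilon> by (intro mult_left_mono) auto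
          then show ?thesis using z(3) by simp
        qed
        have "norm (z - y) \<le> norm (z - x) + norm (x - y)" using norm_triangle_ineq[of "z - x" "x - y"] by simp
        also have "\<dots> \<le> \<epsilon>/4 * norm y + \<epsilon>/2 * norm y" using zx nx by linarith
        also have "\<dots> \<le> \<epsilon> * norm y" using \<epsilon>(1) by (simp flip: distrib_right)
        finally have "z \<in> Z" using z by (simp add: Z_def)
        then have "0 \<le> b \<bullet> (z - y)" using b(3) hull_inc by metis
        also have "b \<bullet> (z - y) = b \<bullet> (z - x) - \<epsilon>/2 * norm y * norm b"
          using b(2) by (simp add: x_def inner_diff_right inner_add_right power2_norm_eq_inner[symmetric] power2_eq_square)
        also have "b \<bullet> (z - x) \<le> norm b * (\<epsilon>/4 * norm y)"
          using norm_cauchy_schwarz[of b "z - x"] mult_left_mono[OF zx, of "norm b"] by simp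
        finally have "\<epsilon>/4 * norm y * norm b \<le> 0" by (simp add: field_simps)
        then show False using b(2) False \<epsilon> by (simp add: mult_le_0_iff)
      qed
      \<comment> \<open>Subtracting the tangent of \<open>h\<close> at \<open>y\<close> leaves a
        convex function, so a bound on \<open>Z\<close> passes to \<open>y\<close> itself, where the
        tangent takes the value \<open>h y\<close>.\<close>
      moreover have "\<forall>x\<in>convex hull Z. g x - (h y + (a + A y) \<bullet> (x - y)) \<le> \<kappa> * (norm y)\<^sup>2"
      proof (rule convex_on_convex_hull_bound)
        have "convex hull Z \<subseteq> T \<inter> ball 0 \<rho>"
        proof (rule hull_minimal)
          show "convex (T \<inter> ball 0 \<rho>)" by (intro convex_Int convex_ball subspace_imp_convex T)
          show "Z \<subseteq> T \<inter> ball 0 \<rho>"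
          proof
            fix z assume "z \<in> Z"
            then have "z \<in> T" "norm z \<le> 2 * norm y" using near by (auto simp: Z_def)
            then show "z \<in> T \<inter> ball 0 \<rho>" using y(2) \<delta> by simp
          qed
        qed
        then have "convex_on (convex hull Z) g" by (intro convex_on_subset[OF conv]) auto
        moreover have "convex_on (convex hull Z) (\<lambda>x. - (h y + (a + A y) \<bullet> (x - y)))"
        proof (rule convex_onI)
          fix t :: real and u v :: "real^'n"
          show "- (h y + (a + A y) \<bullet> ((1 - t) *\<^sub>R u + t *\<^sub>R v - y))
            \<le> (1 - t) * - (h y + (a + A y) \<bullet> (u - y)) + t * - (h y + (a + A y) \<bullet> (v - y))"
            by (simp add: inner_add_right inner_diff_right algebra_simps)
        qed simp
        ultimately have "convex_on (convex hull Z) (\<lambda>x. g x + (- (h y + (a + A y) \<bullet> (x - y))))"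
          by (rule convex_on_add)
        then show "convex_on (convex hull Z) (\<lambda>x. g x - (h y + (a + A y) \<bullet> (x - y)))"
          by (simp only: diff_conv_add_uminus)
        show "\<forall>x\<in>Z. g x - (h y + (a + A y) \<bullet> (x - y)) \<le> \<kappa> * (norm y)\<^sup>2"
        proof
          fix z assume "z \<in> Z"
          then have z: "z \<in> T" "f z = g z" "norm (z - y) \<le> \<epsilon> * norm y" by (auto simp: Z_def)
          then have n: "norm z \<le> 2 * norm y" using near by blast
          then have "norm z < \<delta>1" using y(2) \<delta> by linarith
          then have 1: "g z - h z \<le> \<kappa>/8 * (norm z)\<^sup>2" using \<delta>1(2)[OF z(1,2)] by linarith
          have "(norm z)\<^sup>2 \<le> (2 * norm y)\<^sup>2" using n by (intro power_mono) auto
          then have 2: "\<kappa>/8 * (norm z)\<^sup>2 \<le> \<kappa>/2 * (norm y)\<^sup>2" using \<kappa> by (simp add: field_simps power2_eq_square)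
          have 3: "h z - (h y + (a + A y) \<bullet> (z - y)) = (A (z - y) \<bullet> (z - y)) / 2"
            using h[of y "z - y"] y z T by (simp add: subspace_diff)
          have "A (z - y) \<bullet> (z - y) \<le> C * (norm (z - y))\<^sup>2" using quad[of "z - y"] by linarith
          also have "\<dots> \<le> C * (\<epsilon> * norm y)\<^sup>2" using z C by (intro mult_left_mono power_mono) auto
          also have "\<dots> = (C * \<epsilon>) * \<epsilon> * (norm y)\<^sup>2" by (simp add: power2_eq_square)
          also have "\<dots> \<le> \<kappa> * 1 * (norm y)\<^sup>2" using \<epsilon> \<kappa> C by (intro mult_right_mono mult_mono) auto
          finally show "g z - (h y + (a + A y) \<bullet> (z - y)) \<le> \<kappa> * (norm y)\<^sup>2" using 1 2 3 by linarith
        qed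
      qed
      ultimately show ?thesis by fastforce
    qed
    then show ?thesis using \<delta> by blast
  qed
  have lower: "\<exists>\<delta>>0. \<forall>y\<in>T. norm y < \<delta> \<longrightarrow> - \<kappa> * (norm y)\<^sup>2 \<le> g y - h y" if \<kappa>: "0 < \<kappa>" for \<kappa>
  proof -
    \<comment> \<open>The errors add up to 25/32 of \<open>\<kappa>\<close>: 1/4 from the second
      difference \<open>h x + h y - 2 * h z\<close>, 1/4 from twice the error at \<open>z\<close>,
      and 9/32 from the upper bound at the reflected point \<open>x\<close>.\<close>
    define \<epsilon> where "\<epsilon> = min 1 (\<kappa> / (4 * C))"
    have \<epsilon>: "0 < \<epsilon>" "\<epsilon> \<le> 1" "C * \<epsilon> \<le> \<kappa>/4" using \<kappa> C by (auto simp: \<epsilon>_def min_def field_simps)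
    obtain \<delta>1 where \<delta>1: "0 < \<delta>1" "\<And>z. z \<in> T \<Longrightarrow> f z = g z \<Longrightarrow> norm z < \<delta>1 \<Longrightarrow> \<bar>g z - h z\<bar> \<le> (\<kappa>/32) * (norm z)\<^sup>2"
      using onZ[of "\<kappa>/32"] \<kappa> by auto
    obtain \<delta>2 where \<delta>2: "0 < \<delta>2" "\<And>y. y \<in> T \<Longrightarrow> norm y < \<delta>2 \<Longrightarrow> \<exists>z\<in>T. f z = g z \<and> norm (z - y) \<le> \<epsilon> * norm y"
      using denseD[of "\<epsilon>"] \<epsilon> by auto
    obtain \<delta>3 where \<delta>3: "0 < \<delta>3" "\<And>z. z \<in> T \<Longrightarrow> norm z < \<delta>3 \<Longrightarrow> g z - h z \<le> (\<kappa>/32) * (norm z)\<^sup>2"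
      using upper[of "\<kappa>/32"] \<kappa> by auto
    define \<delta> where "\<delta> = min (min \<delta>1 \<delta>2) (min \<delta>3 \<rho>) / 3"
    have \<delta>: "0 < \<delta>" "3 * \<delta> \<le> \<delta>1" "3 * \<delta> \<le> \<delta>2" "3 * \<delta> \<le> \<delta>3" "3 * \<delta> \<le> \<rho>"
      using \<delta>1 \<delta>2 \<delta>3 \<rho> by (auto simp: \<delta>_def)
    have "- \<kappa> * (norm y)\<^sup>2 \<le> g y - h y" if y: "y \<in> T" "norm y < \<delta>" for y
    proof -
      have "norm y < \<delta>2" using y \<delta> by auto
      then obtain z where z: "z \<in> T" "f z = g z" "norm (z - y) \<le> \<epsilon> * norm y" using \<delta>2(2) y by blast
      define x where "x = z + (z - y)"
      have e1: "\<epsilon> * norm y \<le> norm y" using mult_right_mono[OF \<epsilon>(2), of "norm y"] by simp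
      have "norm z \<le> norm (z - y) + norm y" by (metis diff_add_cancel norm_triangle_ineq)
      then have nz: "norm z \<le> 2 * norm y" using z e1 by linarith
      have "norm x \<le> norm z + norm (z - y)" unfolding x_def by (rule norm_triangle_ineq)
      then have nx: "norm x \<le> 3 * norm y" using z nz e1 by linarith
      have xT: "x \<in> T" unfolding x_def using z y by (intro subspace_add subspace_diff T) auto
      have yy: "g z \<le> (1/2) * g y + (1/2) * g x"
      proof -
        have "g ((1 - 1/2) *\<^sub>R y + (1/2) *\<^sub>R x) \<le> (1 - 1/2) * g y + (1/2) * g x"
          using y xT nx \<delta> by (intro convex_onD[OF conv]) auto
        moreover have "(1 - 1/2) *\<^sub>R y + (1/2) *\<^sub>R x = z"
          by (simp add: x_def algebra_simps scaleR_2[symmetric])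
        ultimately show ?thesis by simp
      qed
      have "norm z < \<delta>1" using nz y \<delta> by linarith
      then have 1: "- (\<kappa>/32 * (norm z)\<^sup>2) \<le> g z - h z" using \<delta>1(2)[OF z(1,2)] by linarith
      have "norm x < \<delta>3" using nx y \<delta> by linarith
      then have 2: "g x - h x \<le> \<kappa>/32 * (norm x)\<^sup>2" using \<delta>3(2)[OF xT] by linarith
      have "(norm z)\<^sup>2 \<le> (2 * norm y)\<^sup>2" "(norm x)\<^sup>2 \<le> (3 * norm y)\<^sup>2"
        using nz nx by (intro power_mono; simp)+
      then have 3: "\<kappa>/32 * (norm z)\<^sup>2 \<le> \<kappa>/8 * (norm y)\<^sup>2" "\<kappa>/32 * (norm x)\<^sup>2 \<le> \<kappa>*9/32 * (norm y)\<^sup>2"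
        using \<kappa> by (simp_all add: field_simps power2_eq_square)
      have hx: "h x = h z + (a + A z) \<bullet> (z - y) + (A (z - y) \<bullet> (z - y)) / 2"
        unfolding x_def using z y T by (intro h) (auto intro: subspace_diff)
      have "h y = h (z + (y - z))" by simp
      also have "\<dots> = h z + (a + A z) \<bullet> (y - z) + (A (y - z) \<bullet> (y - z)) / 2"
        using z y T by (intro h) (auto intro: subspace_diff)
      also have "A (y - z) \<bullet> (y - z) = A (z - y) \<bullet> (z - y)"
        by (simp add: linear_diff[OF A(1)] inner_diff_left inner_diff_right)
      finally have "h x + h y = 2 * h z + A (z - y) \<bullet> (z - y)"
        using hx by (simp add: inner_diff_right)
      moreover have "\<bar>A (z - y) \<bullet> (z - y)\<bar> \<le> \<kappa>/4 * (norm y)\<^sup>2"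
      proof -
        have "\<bar>A (z - y) \<bullet> (z - y)\<bar> \<le> C * (norm (z - y))\<^sup>2" by (rule quad)
        also have "\<dots> \<le> C * (\<epsilon> * norm y)\<^sup>2" using z C by (intro mult_left_mono power_mono) auto
        also have "\<dots> = (C * \<epsilon>) * \<epsilon> * (norm y)\<^sup>2" by (simp add: power2_eq_square)
        also have "\<dots> \<le> \<kappa>/4 * 1 * (norm y)\<^sup>2" using \<epsilon> \<kappa> C by (intro mult_right_mono mult_mono) auto
        finally show ?thesis by simp
      qed
      moreover have "0 \<le> \<kappa> * (norm y)\<^sup>2" using \<kappa> by simp
      ultimately show ?thesis using yy 1 2 3 by (simp add: abs_le_iff)
    qed
    then show ?thesis using \<delta> by blast
  qed
  have "((\<lambda>y. (g y - g 0 - a \<bullet> y - (A y \<bullet> y) / 2) / (norm y)\<^sup>2) \<longlongrightarrow> 0) (at 0 within T)"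
    unfolding tendsto_iff eventually_at dist_norm
  proof (intro allI impI)
    fix e :: real assume e: "0 < e"
    obtain \<delta>1 where \<delta>1: "0 < \<delta>1" "\<And>y. y \<in> T \<Longrightarrow> norm y < \<delta>1 \<Longrightarrow> g y - h y \<le> e/2 * (norm y)\<^sup>2"
      using upper[of "e/2"] e by auto
    obtain \<delta>2 where \<delta>2: "0 < \<delta>2" "\<And>y. y \<in> T \<Longrightarrow> norm y < \<delta>2 \<Longrightarrow> - (e/2) * (norm y)\<^sup>2 \<le> g y - h y"
      using lower[of "e/2"] e by auto
    have "norm ((g y - g 0 - a \<bullet> y - (A y \<bullet> y) / 2) / (norm y)\<^sup>2 - 0) < e"
      if y: "y \<in> T" "y \<noteq> 0" "norm y < min \<delta>1 \<delta>2" for y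
    proof -
      have "\<bar>g y - h y\<bar> \<le> e/2 * (norm y)\<^sup>2"
        using \<delta>1(2)[of y] \<delta>2(2)[of y] y by (simp add: abs_le_iff del: times_divide_eq_left)
      then have "\<bar>g y - h y\<bar> / (norm y)\<^sup>2 \<le> e/2" using y(2) by (simp add: field_simps)
      then show ?thesis using e by (simp add: h_def abs_divide algebra_simps)
    qed
    then show "\<exists>d>0. \<forall>x\<in>T. x \<noteq> 0 \<and> norm (x - 0) < d \<longrightarrow>
        norm ((g x - g 0 - a \<bullet> x - (A x \<bullet> x) / 2) / (norm x)\<^sup>2 - 0) < e"
      using \<delta>1(1) \<delta>2(1) by (intro exI[of _ "min \<delta>1 \<delta>2"]) auto
  qed
  then show ?thesis using a A by (auto simp: has_alexandrov_hessian_def)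
qed

section \<open>Thick points of the boundary of a convex cone\<close>

lemma hausdorff_outer_null_subset:
  "hausdorff_outer s B = 0 \<Longrightarrow> A \<subseteq> B \<Longrightarrow> hausdorff_outer s A = 0"
  using hausdorff_outer_mono[of A B s] by simp

lemma hausdorff_outer_countable_null:
  "(\<And>i::nat. hausdorff_outer s (A i) = 0) \<Longrightarrow> hausdorff_outer s (\<Union>i. A i) = 0"
  using hausdorff_outer_subadd[of s A] by simp

text \<open>Failure of \<open>thick\<close> at \<open>w\<close> provides, for some \<open>k\<close>
  and at all small scales, points \<open>v\<close> of \<open>S\<close> with no point of
  \<open>E\<close> within \<open>dist v w / (k + 1)\<close>. Projected, these become holes next to
  points of \<open>N k\<close>; as \<open>N k\<close> is part of \<open>E\<close>, the holes miss
  it. So the projection of \<open>N k\<close> is porous, hence null, and the Lipschitz inverse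
  carries nullity back to \<open>N k\<close>.\<close>

lemma hausdorff_outer_not_thick_bilipschitz:
  fixes S E :: "'a::metric_space set" and \<pi> :: "'a \<Rightarrow> 'b::euclidean_space"
  assumes E: "E \<subseteq> S" and S: "bounded S" and c: "0 < c"
    and le: "\<And>x y. x \<in> S \<Longrightarrow> y \<in> S \<Longrightarrow> dist (\<pi> x) (\<pi> y) \<le> dist x y"
    and ge: "\<And>x y. x \<in> S \<Longrightarrow> y \<in> S \<Longrightarrow> dist x y \<le> c * dist (\<pi> x) (\<pi> y)"
  shows "hausdorff_outer DIM('b) {w \<in> E. \<not> thick E S w} = 0"
proof -
  define N where "N k = {w\<in>E. \<forall>\<delta>>0. \<exists>v\<in>S. dist v w < \<delta> \<and> (\<forall>e\<in>E. 1 / real (Suc k) * dist v w < dist e v)}" for k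
  have "hausdorff_outer DIM('b) (N k) = 0" for k
  proof -
    have NS: "N k \<subseteq> S" using E by (auto simp: N_def)
    have bQ: "bounded (\<pi> ` N k)"
    proof -
      obtain x e where "\<forall>y\<in>S. dist x y \<le> e" "x \<in> S \<or> S = {}"
        using S unfolding bounded_any_center[of S] 
        by (metis S all_not_in_conv bounded_any_center)
      then have "\<forall>y\<in>S. dist (\<pi> x) (\<pi> y) \<le> e" using le by (metis empty_iff order_trans)
      then show ?thesis using NS unfolding bounded_def by blast
    qed
    have neg: "negligible (\<pi> ` N k)"
    \<comment> \<open>The projection may shrink the hole by the factor \<open>c\<close>, but it does
      not increase \<open>dist v w\<close>.\<close>
    proof (rule negligible_porous[where e = "1 / real (Suc k) / c"])
      fix x and d :: real assume "x \<in> \<pi> ` N k" and d: "0 < d"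
      then obtain w where w: "w \<in> N k" "x = \<pi> w" by auto
      then obtain v where v: "v \<in> S" "dist v w < d" "\<forall>e\<in>E. 1 / real (Suc k) * dist v w < dist e v"
        using d by (auto simp: N_def)
      have wS: "w \<in> S" using w NS by auto
      have "1 / real (Suc k) / c * dist (\<pi> v) x < dist z (\<pi> v)" if "z \<in> \<pi> ` N k" for z
      proof -
        obtain e where e: "e \<in> E" "e \<in> S" "z = \<pi> e" using \<open>z \<in> \<pi> ` N k\<close> E by (auto simp: N_def)
        have "1 / real (Suc k) * dist (\<pi> v) x \<le> 1 / real (Suc k) * dist v w"
          using le[OF v(1) wS] w by (intro mult_left_mono) auto
        also have "\<dots> < dist e v" using v(3) e by blast
        also have "\<dots> \<le> c * dist z (\<pi> v)" using ge[of e v] e v by simp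
        finally have "1 / real (Suc k) * dist (\<pi> v) x < c * dist z (\<pi> v)" .
        then show ?thesis using c by (simp add: field_simps del: of_nat_Suc)
      qed
      moreover have "dist (\<pi> v) x < d" using le[OF v(1) wS] v(2) w(2) by simp
      ultimately show "\<exists>y. dist y x < d \<and> (\<forall>z\<in>\<pi> ` N k. 1 / real (Suc k) / c * dist y x < dist z y)"
        by blast
    qed (use c bQ in auto)
    define g where "g = the_inv_into S \<pi>"
    have "inj_on \<pi> S"
    proof (rule inj_onI)
      fix x y assume "x \<in> S" "y \<in> S" "\<pi> x = \<pi> y"
      then show "x = y" using ge[of x y] by simp
    qed
    then have g: "g (\<pi> x) = x" if "x \<in> S" for x using that by (simp add: g_def the_inv_into_f_f)
    have "hausdorff_outer DIM('b) (g ` \<pi> ` N k) = 0"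
    proof (rule hausdorff_outer_lipschitz_image_negligible[OF neg bQ])
      fix x y assume "x \<in> \<pi> ` N k" "y \<in> \<pi> ` N k"
      then obtain u v where "u \<in> S" "v \<in> S" "x = \<pi> u" "y = \<pi> v" using NS by auto
      then show "dist (g x) (g y) \<le> c * dist x y" using ge g by simp
    qed (use c in simp)
    moreover have "g ` \<pi> ` N k = N k" using g NS by (force simp: image_image)
    ultimately show ?thesis by simp
  qed
  then have "hausdorff_outer DIM('b) (\<Union>k. N k) = 0" by (rule hausdorff_outer_countable_null)
  moreover have "{w \<in> E. \<not> thick E S w} \<subseteq> (\<Union>k. N k)"
  proof
    fix w assume "w \<in> {w \<in> E. \<not> thick E S w}"
    then obtain \<epsilon> where w: "w \<in> E" and \<epsilon>: "0 < \<epsilon>"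
      "\<And>\<delta>. 0 < \<delta> \<Longrightarrow> \<exists>v\<in>S. dist v w < \<delta> \<and> (\<forall>e\<in>E. \<epsilon> * dist v w < dist e v)"
      unfolding thick_def by (auto simp: not_le)
    obtain k where k: "1 / real (Suc k) < \<epsilon>"
      using reals_Archimedean[OF \<epsilon>(1)] by (auto simp: inverse_eq_divide)
    have "w \<in> N k"
      unfolding N_def
    proof (intro CollectI conjI allI impI w)
      fix \<delta> :: real assume "0 < \<delta>"
      then obtain v where v: "v \<in> S" "dist v w < \<delta>" "\<forall>e\<in>E. \<epsilon> * dist v w < dist e v" using \<epsilon>(2) by blast
      have "1 / real (Suc k) * dist v w \<le> \<epsilon> * dist v w" using k by (intro mult_right_mono) auto
      then show "\<exists>v\<in>S. dist v w < \<delta> \<and> (\<forall>e\<in>E. 1 / real (Suc k) * dist v w < dist e v)"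
        using v by (meson le_less_trans)
    qed
    then show "w \<in> (\<Union>k. N k)" by blast
  qed
  ultimately show ?thesis by (rule hausdorff_outer_null_subset)
qed

text \<open>An index type for the \<open>(n - 1)\<close>-dimensional Euclidean space in which the boundary is charted.
  The case distinction only keeps the type non-empty.\<close>

typedef ('n::finite) codim2 =
  "(if 3 \<le> CARD('n) then SOME S. card S = CARD('n) - 2 else UNIV) :: 'n set"
proof (cases "3 \<le> CARD('n)")
  case True
  have "\<exists>S::'n set. card S = CARD('n) - 2"
    by (rule exE[OF obtain_subset_with_card_n[of "CARD('n) - 2" "UNIV::'n set"]]) auto
  then have "card (SOME S::'n set. card S = CARD('n) - 2) = CARD('n) - 2"
    by (rule someI_ex)
  then have "(SOME S::'n set. card S = CARD('n) - 2) \<noteq> {}"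
    using True by auto
  with True show ?thesis by auto
qed auto

instance codim2 :: (finite) finite
proof
  have "(UNIV :: 'a codim2 set) = Abs_codim2 ` (if 3 \<le> CARD('a) then SOME S. card S = CARD('a) - 2 else UNIV)"
    by (rule type_definition.Abs_image[OF type_definition_codim2, symmetric])
  then show "finite (UNIV :: 'a codim2 set)" by (metis finite finite_imageI)
qed

lemma card_codim2:
  assumes "3 \<le> CARD('n::finite)"
  shows "CARD('n codim2) = CARD('n) - 2"
proof -
  have "\<exists>S::'n set. card S = CARD('n) - 2"
    by (rule exE[OF obtain_subset_with_card_n[of "CARD('n) - 2" "UNIV::'n set"]]) auto
  then have "card (SOME S::'n set. card S = CARD('n) - 2) = CARD('n) - 2"
    by (rule someI_ex)
  then show ?thesis
    using assms by (simp add: type_definition.card[OF type_definition_codim2])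
qed

section \<open>Projection charts for the boundary of a convex cone\<close>

lemma convex_cone_add:
  fixes C :: "'a::real_vector set"
  assumes *: "convex C" "conic C" "x \<in> C" "y \<in> C"
  shows "x + y \<in> C"
proof -
  have "(1/2) *\<^sub>R x + (1/2) *\<^sub>R y \<in> C" using * by (intro convexD) auto
  then have "2 *\<^sub>R ((1/2) *\<^sub>R x + (1/2) *\<^sub>R y) \<in> C" using *(2) unfolding conic_def by (metis zero_le_numeral)
  then show ?thesis by (simp add: scaleR_add_right)
qed

lemma interior_cone_add:
  fixes C :: "'a::real_normed_vector set"
  assumes "convex C" "conic C" "x \<in> C" "y \<in> interior C"
  shows "x + y \<in> interior C"
proof -
  have "(+) x ` interior C \<subseteq> C"
    using assms interior_subset by (auto intro!: convex_cone_add)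
  moreover have "open ((+) x ` interior C)" by (intro open_translation open_interior)
  ultimately show ?thesis using assms(4) by (metis imageI interior_maximal subsetD)
qed

lemma interior_cone_scale:
  fixes C :: "'a::real_normed_vector set"
  assumes "conic C" "0 < c" "y \<in> interior C"
  shows "c *\<^sub>R y \<in> interior C"
proof -
  have "(\<lambda>x. c *\<^sub>R x) ` interior C \<subseteq> C"
  proof
    fix z assume "z \<in> (\<lambda>x. c *\<^sub>R x) ` interior C"
    then obtain x where "x \<in> C" "z = c *\<^sub>R x" using interior_subset by blast
    then show "z \<in> C" using assms(1,2) by (simp add: conic_def)
  qed
  moreover have "open ((\<lambda>x. c *\<^sub>R x) ` interior C)" using assms by (intro open_scaling) auto
  ultimately show ?thesis using assms(3) by (metis (no_types, lifting) imageI interior_maximal subsetD)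
qed

text \<open>The map \<open>Q\<close> is the orthogonal projection along the span of \<open>w\<close> and \<open>p\<close>, directions which are
  transversal to the sphere and to the boundary of the cone, respectively.\<close>

lemma cone_frontier_projection_bilipschitz:
  fixes C :: "(real ^ 'n) set"
  assumes C: "closed C" "convex C" "conic C" and p: "p \<in> interior C"
    and w: "w \<in> frontier C" "norm w = 1" and card: "3 \<le> CARD('n)"
  obtains r c and Q :: "real ^ 'n \<Rightarrow> real ^ 'n codim2"
  where "0 < r" "0 < c" "linear Q" "\<And>x. norm (Q x) \<le> norm x"
    "\<And>v v'. v \<in> frontier C \<inter> sphere 0 1 \<inter> ball w r \<Longrightarrow> v' \<in> frontier C \<inter> sphere 0 1 \<inter> ball w r \<Longrightarrow>
      norm (v - v') \<le> c * norm (Q (v - v'))"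
proof -
  have wC: "w \<in> C" "w \<notin> interior C" using w C(1) by (auto simp: frontier_def)
  have w1: "w \<bullet> w = 1" using w(2) by (simp add: dot_square_norm)
  define a where "a = p \<bullet> w"
  define b where "b = norm (p - a *\<^sub>R w)"
  \<comment> \<open>\<open>p\<close> is not a multiple of \<open>w\<close>: a positive multiple
    would make \<open>w\<close> interior at once, any other one would make \<open>0\<close> interior
    and with it \<open>w\<close>.\<close>
  have "p - a *\<^sub>R w \<noteq> 0"
  proof
    assume "p - a *\<^sub>R w = 0"
    then have pa: "p = a *\<^sub>R w" by simp
    show False
    proof (cases "0 < a")
      case True
      then have "(1/a) *\<^sub>R p \<in> interior C" using interior_cone_scale[OF C(3) _ p] by simp
      then show False using wC True by (simp add: pa)
    next
      case False
      then have "0 \<le> - a" by simp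
      then have "(- a) *\<^sub>R w \<in> C" using wC(1) C(3) unfolding conic_def by blast
      then have "(- a) *\<^sub>R w + p \<in> interior C" by (rule interior_cone_add[OF C(2,3) _ p])
      then have "0 \<in> interior C" by (simp add: pa)
      then have "w + 0 \<in> interior C" by (rule interior_cone_add[OF C(2,3) wC(1)])
      then show False using wC by simp
    qed
  qed
  then have b: "0 < b" by (simp add: b_def)
  define u where "u = (1/b) *\<^sub>R (p - a *\<^sub>R w)"
  have u: "u \<bullet> u = 1" "u \<bullet> w = 0" "w \<bullet> u = 0"
  proof -
    have "norm u = 1" using b by (simp add: u_def b_def)
    then show "u \<bullet> u = 1" by (simp add: dot_square_norm)
    show "u \<bullet> w = 0" by (simp add: u_def inner_diff_left w1 a_def)
    then show "w \<bullet> u = 0" by (simp add: inner_commute)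
  qed
  have pu: "p = a *\<^sub>R w + b *\<^sub>R u" using b by (simp add: u_def)
  define q where "q x = x - (x \<bullet> w) *\<^sub>R w - (x \<bullet> u) *\<^sub>R u" for x
  have lq: "linear q"
    by (rule linearI) (simp_all add: q_def inner_add_left scaleR_add_left scaleR_diff_right)
  have nu: "norm u = 1" using u by (simp add: norm_eq_sqrt_inner)
  have nq: "norm (q x) \<le> norm x" for x
  proof -
    have "(norm (q x))\<^sup>2 = (norm x)\<^sup>2 - (x \<bullet> w)\<^sup>2 - (x \<bullet> u)\<^sup>2"
      unfolding power2_norm_eq_inner q_def
      using u w1 by (simp add: inner_diff_left inner_diff_right inner_commute power2_eq_square algebra_simps)
    then have "(norm (q x))\<^sup>2 \<le> (norm x)\<^sup>2" by (smt (verit) zero_le_power2)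
    then show ?thesis by (rule power2_le_imp_le) simp
  qed
  define W where "W = {y :: real^'n. \<forall>x\<in>span {w, u}. orthogonal x y}"
  have sW: "subspace W"
    unfolding W_def using subspace_orthogonal_to_vectors by auto
  have qW: "q x \<in> W" for x
  proof -
    have "orthogonal (q x) y" if "y \<in> span {w, u}" for y
    proof (rule orthogonal_to_span[OF that])
      show "orthogonal (q x) z" if "z \<in> {w, u}" for z
        using that u w1 by (auto simp: orthogonal_def q_def inner_diff_left)
    qed
    then show ?thesis by (auto simp: W_def orthogonal_commute)
  qed
  have "dim W + dim (span {w, u}) = dim (UNIV :: (real^'n) set)"
    using dim_subspace_orthogonal_to_vectors[of "span {w, u}" UNIV] by (simp add: W_def)
  moreover have "dim (span {w, u}) = 2"
  proof -
    have "w \<noteq> u" "w \<noteq> 0" "u \<noteq> 0" using u w1 by auto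
    moreover have "pairwise orthogonal {w, u}"
      using u by (auto simp: pairwise_def orthogonal_def)
    ultimately have "independent {w, u}" by (intro pairwise_orthogonal_independent) auto
    then show ?thesis using \<open>w \<noteq> u\<close> by (simp add: dim_span dim_eq_card_independent)
  qed
  ultimately have "dim W \<le> dim (UNIV :: (real ^ 'n codim2) set)"
    using card by (simp add: card_codim2)
  from isometry_subset_subspace[OF sW subspace_UNIV this] obtain f :: "real ^ 'n \<Rightarrow> real ^ 'n codim2"
    where f: "linear f" "\<And>x. x \<in> W \<Longrightarrow> norm (f x) = norm x" by auto
  define Q where "Q = f \<circ> q"
  have Q: "linear Q" "norm (Q x) = norm (q x)" for x
    using linear_compose[OF lq f(1)] f(2) qW by (auto simp: Q_def)
  obtain \<rho> where \<rho>: "0 < \<rho>" "ball p \<rho> \<subseteq> interior C"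
    using p open_interior by (meson openE)
  define K where "K = \<bar>a\<bar> / b"
  have K: "0 \<le> K" using b by (simp add: K_def)
  define \<sigma> where "\<sigma> = \<rho> / b"
  have \<sigma>: "0 < \<sigma>" using b \<rho> by (simp add: \<sigma>_def)
  \<comment> \<open>\<open>r \<le> 1/2\<close> bounds the component of a chord along
    \<open>w\<close> by the other two, the second bound yields \<open>s \<le> 1\<close>, and the
    third lets the term \<open>r * s\<close> be absorbed.\<close>
  define r where "r = min (1/2) (min (1 / (2 * (1 + K))) (\<sigma> / (2 * (1 + K))))"
  have r: "0 < r" "r \<le> 1/2" "r * (1 + K) \<le> 1/2" "r * (1 + K) \<le> \<sigma>/2"
  proof -
    have "0 < 1 + K" using K by simp
    then show "0 < r" using \<sigma> by (simp add: r_def)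
    show "r \<le> 1/2" unfolding r_def by (rule min.cobounded1)
    have "r \<le> 1 / (2 * (1 + K))" "r \<le> \<sigma> / (2 * (1 + K))" by (auto simp: r_def)
    then show "r * (1 + K) \<le> 1/2" "r * (1 + K) \<le> \<sigma>/2"
      using K by (auto simp: pos_le_divide_eq algebra_simps)
  qed
  \<comment> \<open>If the component of \<open>d\<close> along \<open>u\<close> dominated,
    \<open>v'\<close> would be interior. Taking \<open>\<beta> *\<^sub>R p\<close> out of
    \<open>d\<close> removes this component and leaves \<open>s *\<^sub>R w + q d\<close>. Trading
    \<open>w\<close> for \<open>v\<close> writes \<open>v'\<close> as a nonnegative multiple of
    \<open>v\<close> plus an interior point near \<open>\<beta> *\<^sub>R p\<close>; the price of
    the trade is \<open>s *\<^sub>R (w - v)\<close>, which is small near \<open>w\<close>.\<close>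
  have key: "\<sigma> * (d \<bullet> u) \<le> norm (q d) + r * \<bar>(d \<bullet> w) - a * (d \<bullet> u) / b\<bar>"
    if v: "v \<in> frontier C \<inter> sphere 0 1 \<inter> ball w r" and v': "v' \<in> frontier C \<inter> sphere 0 1 \<inter> ball w r"
      and d: "d = v' - v" and pos: "0 < d \<bullet> u" and small: "\<bar>(d \<bullet> w) - a * (d \<bullet> u) / b\<bar> \<le> 1" for v v' d
  proof (rule ccontr)
    assume contr: "\<not> ?thesis"
    define s where "s = (d \<bullet> w) - a * (d \<bullet> u) / b"
    define \<beta> where "\<beta> = (d \<bullet> u) / b"
    have \<beta>: "0 < \<beta>" "\<beta> * \<rho> = \<sigma> * (d \<bullet> u)" using pos b by (auto simp: \<beta>_def \<sigma>_def)
    define e where "e = q d + s *\<^sub>R (w - v)"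
    have "norm e \<le> norm (q d) + \<bar>s\<bar> * norm (w - v)"
      unfolding e_def using norm_triangle_ineq[of "q d" "s *\<^sub>R (w - v)"] by simp
    also have "\<dots> \<le> norm (q d) + \<bar>s\<bar> * r"
      using v by (intro add_left_mono mult_left_mono) (auto simp: dist_norm)
    also have "\<dots> < \<beta> * \<rho>" using contr \<beta> by (simp add: s_def mult.commute)
    finally have e: "norm ((1/\<beta>) *\<^sub>R e) < \<rho>" using \<beta> by (simp add: field_simps)
    have "p + (1/\<beta>) *\<^sub>R e \<in> interior C" using \<rho>(2) e by (auto simp: dist_norm)
    then have "\<beta> *\<^sub>R (p + (1/\<beta>) *\<^sub>R e) \<in> interior C" by (rule interior_cone_scale[OF C(3) \<beta>(1)])
    then have 1: "\<beta> *\<^sub>R p + e \<in> interior C" using \<beta> by (simp add: scaleR_add_right)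
    have "v \<in> C" using v C(1) by (auto simp: frontier_def)
    moreover have "0 \<le> 1 + s" using small by (simp add: s_def abs_le_iff)
    ultimately have "(1 + s) *\<^sub>R v \<in> C" using C(3) by (auto simp: conic_def)
    then have "(1 + s) *\<^sub>R v + (\<beta> *\<^sub>R p + e) \<in> interior C" by (rule interior_cone_add[OF C(2,3) _ 1])
    moreover have "(1 + s) *\<^sub>R v + (\<beta> *\<^sub>R p + e) = v'"
    proof -
      have "\<beta> *\<^sub>R p = (\<beta> * a) *\<^sub>R w + (d \<bullet> u) *\<^sub>R u"
        using b by (simp add: pu \<beta>_def scaleR_add_right)
      moreover have "s = (d \<bullet> w) - \<beta> * a" by (simp add: s_def \<beta>_def)
      moreover have "q d = d - (d \<bullet> w) *\<^sub>R w - (d \<bullet> u) *\<^sub>R u" by (simp add: q_def)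
      moreover have "v' = v + d" by (simp add: d)
      ultimately show ?thesis by (simp only: e_def) (simp add: algebra_simps)
    qed
    ultimately show False using v' by (auto simp: frontier_def)
  qed
  define c where "c = 2 + 8 / \<sigma>"
  have c: "0 < c" using \<sigma> by (simp add: c_def add_pos_pos)
  have main: "norm (v - v') \<le> c * norm (Q (v - v'))"
    if v: "v \<in> frontier C \<inter> sphere 0 1 \<inter> ball w r" and v': "v' \<in> frontier C \<inter> sphere 0 1 \<inter> ball w r" for v v'
  proof -
    define d where "d = v - v'"
    have nv: "norm v = 1" "norm v' = 1" "norm (v - w) < r" "norm (v' - w) < r"
      using v v' by (auto simp: dist_norm norm_minus_commute)
    have d2: "norm d \<le> 2 * r"
      using norm_triangle_ineq4[of "v - w" "v' - w"] nv by (simp add: d_def)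
    \<comment> \<open>A chord of the sphere is orthogonal to the sum of its end points, and this sum
      is close to \<open>2 *\<^sub>R w\<close>.\<close>
    have \<alpha>: "\<bar>d \<bullet> w\<bar> \<le> r * norm d"
    proof -
      have "d \<bullet> (v + v') = 0"
        using nv by (simp add: d_def inner_diff_left inner_add_right inner_commute[of v' v] dot_square_norm)
      then have "d \<bullet> ((v - w) + (v' - w)) = - 2 * (d \<bullet> w)"
        unfolding inner_add_right inner_diff_right by linarith
      then have "\<bar>d \<bullet> w\<bar> = 1/2 * \<bar>d \<bullet> ((v - w) + (v' - w))\<bar>" by (simp add: abs_mult)
      also have "\<dots> \<le> 1/2 * (norm d * norm ((v - w) + (v' - w)))"
        by (intro mult_left_mono Cauchy_Schwarz_ineq2) simp
      also have "\<dots> \<le> 1/2 * (norm d * (r + r))"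
        using norm_triangle_ineq[of "v - w" "v' - w"] nv by (intro mult_left_mono) auto
      finally show ?thesis by (simp add: mult.commute)
    qed
    define A where "A = \<bar>d \<bullet> w\<bar>" define B where "B = \<bar>d \<bullet> u\<bar>" define N where "N = norm (q d)"
    have nonneg: "0 \<le> A" "0 \<le> B" "0 \<le> N" by (auto simp: A_def B_def N_def)
    have "d = (d \<bullet> w) *\<^sub>R w + (d \<bullet> u) *\<^sub>R u + q d" by (simp add: q_def)
    then have "norm d \<le> norm ((d \<bullet> w) *\<^sub>R w + (d \<bullet> u) *\<^sub>R u) + norm (q d)" by (metis norm_triangle_ineq)
    also have "norm ((d \<bullet> w) *\<^sub>R w + (d \<bullet> u) *\<^sub>R u) \<le> A + B"
      using norm_triangle_ineq[of "(d \<bullet> w) *\<^sub>R w" "(d \<bullet> u) *\<^sub>R u"] w nu by (simp add: A_def B_def)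
    finally have dd: "norm d \<le> A + B + N" by (simp add: N_def)
    have "A \<le> 1/2 * (A + B + N)"
      using \<alpha> dd r mult_mono[of r "1/2" "norm d" "A + B + N"] nonneg by (simp add: A_def)
    then have AB: "A \<le> B + N" by simp
    have Bd: "B \<le> norm d" using Cauchy_Schwarz_ineq2[of d u] nu by (simp add: B_def)
    have Ad: "A \<le> norm d" using Cauchy_Schwarz_ineq2[of d w] w by (simp add: A_def)
    define s where "s = \<bar>(d \<bullet> w) - a * (d \<bullet> u) / b\<bar>"
    have "s \<le> A + \<bar>a * (d \<bullet> u) / b\<bar>" unfolding s_def A_def by (rule abs_triangle_ineq4)
    also have "\<bar>a * (d \<bullet> u) / b\<bar> = K * B" using b by (simp add: K_def B_def abs_mult)
    finally have sAB: "s \<le> A + K * B" .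
    have "s \<le> norm d + K * norm d" using sAB Ad Bd K mult_left_mono[OF Bd K] by linarith
    also have "\<dots> = norm d * (1 + K)" by (simp add: algebra_simps)
    also have "\<dots> \<le> (2 * r) * (1 + K)" using d2 K by (intro mult_right_mono) auto
    also have "\<dots> \<le> 1" using r by simp
    finally have s1: "s \<le> 1" .
    \<comment> \<open>\<open>key\<close> bounds only a positive component along \<open>u\<close>; a
      negative one is treated by exchanging \<open>v\<close> and \<open>v'\<close>.\<close>
    have *: "\<sigma> * B \<le> N + r * s"
    proof (cases "d \<bullet> u" "0::real" rule: linorder_cases)
      case greater
      then show ?thesis using key[OF v' v d_def greater] s1 by (simp add: s_def B_def N_def)
    next
      case equal
      then show ?thesis using nonneg r by (simp add: B_def s_def)
    next
      case less
      have qm: "q (- d) = - q d" using linear_neg[OF lq] by simp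
      have md: "- d = v' - v" by (simp add: d_def)
      have s: "\<bar>((- d) \<bullet> w) - a * ((- d) \<bullet> u) / b\<bar> = s"
        unfolding s_def by (subst abs_minus_cancel[symmetric]) simp
      have "\<sigma> * ((- d) \<bullet> u) \<le> norm (q (- d)) + r * s"
        using key[OF v v' md, unfolded s] less s1 by simp
      then show ?thesis using less by (simp add: qm B_def N_def)
    qed
    have "r * s \<le> r * ((1 + K) * B + N)"
      using sAB AB r by (intro mult_left_mono) (auto simp: algebra_simps)
    also have "\<dots> = (r * (1 + K)) * B + r * N" by (simp add: algebra_simps)
    also have "\<dots> \<le> \<sigma>/2 * B + 1 * N"
      using r nonneg by (intro add_mono mult_right_mono) auto
    finally have "\<sigma> * B \<le> 4 * N" using * by simp
    then have "B \<le> 4 * N / \<sigma>" using \<sigma> by (simp add: field_simps)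
    then have "norm d \<le> c * N" using dd AB by (simp add: c_def distrib_right)
    then show ?thesis using Q(2) by (simp add: N_def d_def)
  qed
  show ?thesis
    by (rule that[of r c Q]) (use r c Q nq main in auto)
qed

lemma thick_open:
  assumes U: "open U" "w \<in> U" and th: "thick (E \<inter> U) (S \<inter> U) w"
  shows "thick E S w"
  unfolding thick_def
proof (intro allI impI)
  fix \<epsilon> :: real assume "0 < \<epsilon>"
  then obtain \<delta> where \<delta>: "0 < \<delta>" "\<forall>v\<in>S \<inter> U. dist v w < \<delta> \<longrightarrow> (\<exists>e\<in>E \<inter> U. dist e v \<le> \<epsilon> * dist v w)"
    using th by (auto simp: thick_def)
  obtain r where r: "0 < r" "ball w r \<subseteq> U" using U by (meson openE)
  show "\<exists>\<delta>>0. \<forall>v\<in>S. dist v w < \<delta> \<longrightarrow> (\<exists>e\<in>E. dist e v \<le> \<epsilon> * dist v w)"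
  proof (intro exI[of _ "min \<delta> r"] conjI ballI impI)
    fix v assume v: "v \<in> S" "dist v w < min \<delta> r"
    then have "v \<in> S \<inter> U" using r by (auto simp: dist_commute)
    then show "\<exists>e\<in>E. dist e v \<le> \<epsilon> * dist v w" using \<delta> v by auto
  qed (use \<delta> r in auto)
qed

text \<open>By compactness finitely many chart balls suffice, and a point that is not thick fails to
  be thick already within any open ball around it in which the chart lives.\<close>

lemma hausdorff_outer_not_thick_cone:
  fixes C :: "(real ^ 'n) set"
  assumes C: "closed C" "convex C" "conic C" and int: "interior C \<noteq> {}"
    and E: "E \<subseteq> frontier C \<inter> sphere 0 1" and card: "3 \<le> CARD('n)"
  shows "hausdorff_outer (CARD('n) - 2) {w \<in> E. \<not> thick E (frontier C \<inter> sphere 0 1) w} = 0"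
proof -
  define S where "S = frontier C \<inter> sphere 0 1"
  have ES: "E \<subseteq> S" using E by (simp add: S_def)
  have cS: "compact S" unfolding S_def by (intro closed_Int_compact) auto
  obtain p where p: "p \<in> interior C" using int by auto
  define N where "N = {w \<in> E. \<not> thick E S w}"
  have "\<exists>r>0. hausdorff_outer (CARD('n) - 2) (N \<inter> ball w r) = 0" if w: "w \<in> S" for w
  proof -
    have w': "w \<in> frontier C" "norm w = 1" using w by (auto simp: S_def)
    obtain r c and Q :: "real ^ 'n \<Rightarrow> real ^ 'n codim2"
      where Q: "0 < r" "0 < c" "linear Q" "\<And>x. norm (Q x) \<le> norm x"
      "\<And>v v'. v \<in> S \<inter> ball w r \<Longrightarrow> v' \<in> S \<inter> ball w r \<Longrightarrow>
        norm (v - v') \<le> c * norm (Q (v - v'))"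
      using cone_frontier_projection_bilipschitz[OF C p w' card] unfolding S_def by metis
    have "hausdorff_outer DIM(real ^ 'n codim2) {v \<in> E \<inter> ball w r. \<not> thick (E \<inter> ball w r) (S \<inter> ball w r) v} = 0"
    proof (rule hausdorff_outer_not_thick_bilipschitz[where \<pi> = Q and c = c])
      fix x y assume xy: "x \<in> S \<inter> ball w r" "y \<in> S \<inter> ball w r"
      have eq: "Q x - Q y = Q (x - y)" by (simp add: linear_diff[OF Q(3)])
      show "dist (Q x) (Q y) \<le> dist x y" unfolding dist_norm eq by (rule Q(4))
      show "dist x y \<le> c * dist (Q x) (Q y)" unfolding dist_norm eq using xy by (rule Q(5))
    qed (use ES Q bounded_ball bounded_Int in auto)
    moreover have "N \<inter> ball w r \<subseteq> {v \<in> E \<inter> ball w r. \<not> thick (E \<inter> ball w r) (S \<inter> ball w r) v}"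
      using thick_open[OF open_ball, of _ w r E S] by (fastforce simp: N_def)
    ultimately have "hausdorff_outer (CARD('n) - 2) (N \<inter> ball w r) = 0"
      using hausdorff_outer_null_subset card by (fastforce simp: card_codim2)
    then show ?thesis using Q(1) by blast
  qed
  then obtain r where r: "\<And>w. w \<in> S \<Longrightarrow> 0 < r w" "\<And>w. w \<in> S \<Longrightarrow> hausdorff_outer (CARD('n) - 2) (N \<inter> ball w (r w)) = 0"
    by metis
  obtain F where F: "F \<subseteq> S" "finite F" "S \<subseteq> (\<Union>w\<in>F. ball w (r w))"
    by (rule compactE_image[OF cS, of S "\<lambda>w. ball w (r w)"]) (use r in auto)
  have "hausdorff_outer (CARD('n) - 2) (\<Union>w\<in>G. N \<inter> ball w (r w)) = 0" if "G \<subseteq> S" "finite G" for G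
    using that(2,1)
  proof (induction G rule: finite_induct)
    case (insert x G)
    then have "hausdorff_outer (CARD('n) - 2) (N \<inter> ball x (r x) \<union> (\<Union>w\<in>G. N \<inter> ball w (r w))) = 0"
      using hausdorff_outer_subadd2[of "CARD('n) - 2" "N \<inter> ball x (r x)" "\<Union>w\<in>G. N \<inter> ball w (r w)"] r(2)[of x] by auto
    then show ?case by simp
  qed simp
  then have "hausdorff_outer (CARD('n) - 2) (\<Union>w\<in>F. N \<inter> ball w (r w)) = 0" using F by blast
  moreover have "N \<subseteq> (\<Union>w\<in>F. N \<inter> ball w (r w))" using F ES by (auto simp: N_def)
  ultimately have "hausdorff_outer (CARD('n) - 2) N = 0" by (rule hausdorff_outer_null_subset)
  then show ?thesis by (simp add: N_def S_def)
qed

section \<open>Normals and boundary graphs of convex cones\<close>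

text \<open>A supporting hyperplane of a cone at \<open>w\<close> contains the ray through
  \<open>w\<close> and hence \<open>0\<close>, so support becomes a linear condition. The normals
  lie in the hyperplane orthogonal to \<open>w\<close>, which carries the gnomonic image, and
  involve no choice of a cap.\<close>

definition cone_unit_normals :: "'a::real_inner set \<Rightarrow> 'a \<Rightarrow> 'a set" where
  "cone_unit_normals C w = {\<nu>. norm \<nu> = 1 \<and> \<nu> \<bullet> w = 0 \<and> (\<forall>z\<in>C. 0 \<le> z \<bullet> \<nu>)}"

lemma cone_unit_normals_antimono: "C \<subseteq> D \<Longrightarrow> cone_unit_normals D w \<subseteq> cone_unit_normals C w"
  by (auto simp: cone_unit_normals_def)

text \<open>If the open ray from \<open>w\<close> in direction \<open>d\<close> missed the interior,
  a hyperplane would separate them. Scaling inside the cone shows that the parallel hyperplane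
  through \<open>0\<close> supports \<open>C\<close> at \<open>w\<close>; its unit normal is then a
  member of \<open>cone_unit_normals C w\<close> with nonpositive product with \<open>d\<close>.
  Once one point of the ray is interior, so are all points between it and \<open>w\<close>.\<close>

lemma interior_direction:
  fixes C :: "'a::euclidean_space set"
  assumes C: "convex C" "conic C" "interior C \<noteq> {}" and w: "w \<in> C"
    and d: "\<And>\<mu>. \<mu> \<in> cone_unit_normals C w \<Longrightarrow> 0 < d \<bullet> \<mu>"
  obtains t0 where "0 < t0" "\<And>t. 0 < t \<Longrightarrow> t \<le> t0 \<Longrightarrow> w + t *\<^sub>R d \<in> interior C"
proof -
  define R where "R = (\<lambda>t. w + t *\<^sub>R d) ` {0<..}"
  have "\<exists>t>0. w + t *\<^sub>R d \<in> interior C"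
  proof (rule ccontr)
    assume "\<not> ?thesis"
    then have disj: "R \<inter> interior C = {}" by (auto simp: R_def)
    have "convex R"
    proof (rule convexI)
      fix x y and u v :: real
      assume "x \<in> R" "y \<in> R" and uv: "0 \<le> u" "0 \<le> v" "u + v = 1"
      then obtain s t where st: "0 < s" "0 < t" "x = w + s *\<^sub>R d" "y = w + t *\<^sub>R d" by (auto simp: R_def)
      have "u *\<^sub>R x + v *\<^sub>R y = (u + v) *\<^sub>R w + (u * s + v * t) *\<^sub>R d"
        by (simp add: st algebra_simps)
      moreover have "0 < u * s + v * t"
        using uv st by (cases "u = 0") (auto intro: add_pos_nonneg)
      ultimately show "u *\<^sub>R x + v *\<^sub>R y \<in> R" using uv by (auto simp: R_def)
    qed
    then obtain a b where a: "a \<noteq> 0" "\<And>x. x \<in> R \<Longrightarrow> a \<bullet> x \<le> b" "\<And>x. x \<in> interior C \<Longrightarrow> b \<le> a \<bullet> x"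
      using separating_hyperplane_sets[OF _ convex_interior[OF C(1)] _ C(3) disj] by (auto simp: R_def)
    obtain p where p: "p \<in> interior C" using C(3) by auto
    have nonneg: "0 \<le> a \<bullet> c" if c: "c \<in> C" for c
    proof (rule ccontr)
      assume neg: "\<not> 0 \<le> a \<bullet> c"
      define k where "k = (\<bar>b - a \<bullet> p\<bar> + 1) / (- (a \<bullet> c))"
      have k: "0 \<le> k" "k * (a \<bullet> c) = - (\<bar>b - a \<bullet> p\<bar> + 1)" using neg by (auto simp: k_def divide_nonneg_neg field_simps)
      have "k *\<^sub>R c \<in> C" using c k C(2) by (simp add: conic_def)
      then have "k *\<^sub>R c + p \<in> interior C" using interior_cone_add[OF C(1,2)] p by blast
      then have "b \<le> k * (a \<bullet> c) + a \<bullet> p" using a(3) by (fastforce simp: inner_add_right)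
      then show False using k(2) by linarith
    qed
    have b0: "b \<le> 0"
    proof (rule field_le_epsilon)
      fix e :: real assume e: "0 < e"
      have ap: "0 \<le> a \<bullet> p" using nonneg p interior_subset by blast
      define s where "s = e / (a \<bullet> p + 1)"
      have s: "0 < s" "s * (a \<bullet> p) \<le> e" using e ap by (auto simp: s_def field_simps)
      have "b \<le> a \<bullet> (s *\<^sub>R p)" using interior_cone_scale[OF C(2) s(1) p] by (rule a(3))
      then show "b \<le> 0 + e" using s by simp
    qed
    have le: "a \<bullet> w + t * (a \<bullet> d) \<le> 0" if "0 < t" for t
    proof -
      have "w + t *\<^sub>R d \<in> R" using that by (auto simp: R_def)
      then show ?thesis using a(2)[of "w + t *\<^sub>R d"] b0 by (simp add: inner_add_right)
    qed
    have aw: "a \<bullet> w = 0"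
    proof (rule antisym)
      show "a \<bullet> w \<le> 0"
      proof (rule field_le_epsilon)
        fix e :: real assume e: "0 < e"
        define s where "s = e / (\<bar>a \<bullet> d\<bar> + 1)"
        have s: "0 < s" "s * \<bar>a \<bullet> d\<bar> \<le> e" using e by (auto simp: s_def field_simps)
        have "- (s * (a \<bullet> d)) \<le> s * \<bar>a \<bullet> d\<bar>" using s(1) by (simp add: abs_if)
        then show "a \<bullet> w \<le> 0 + e" using le[OF s(1)] s by linarith
      qed
    qed (rule nonneg[OF w])
    have ad: "a \<bullet> d \<le> 0" using le[of 1] aw by simp
    have "(1 / norm a) *\<^sub>R a \<in> cone_unit_normals C w"
      using a(1) aw nonneg by (auto simp: cone_unit_normals_def inner_commute[of _ a])
    then have "0 < d \<bullet> ((1 / norm a) *\<^sub>R a)" by (rule d)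
    then show False using ad a(1) by (simp add: inner_commute zero_less_divide_iff)
  qed
  then obtain t0 where t0: "0 < t0" "w + t0 *\<^sub>R d \<in> interior C" by blast
  show ?thesis
  proof (rule that[OF t0(1)])
    fix t assume t: "0 < t" "t \<le> t0"
    have "(1 - t/t0) *\<^sub>R w + (t/t0) *\<^sub>R (w + t0 *\<^sub>R d) \<in> interior C"
    proof (cases "t = t0")
      case False
      have "(1 - t/t0) *\<^sub>R w \<in> C" using w t C(2) by (auto simp: conic_def)
      moreover have "(t/t0) *\<^sub>R (w + t0 *\<^sub>R d) \<in> interior C"
        using t t0 by (intro interior_cone_scale C) auto
      ultimately show ?thesis by (rule interior_cone_add[OF C(1,2)])
    qed (use t0 in simp)
    moreover have "(1 - t/t0) *\<^sub>R w + (t/t0) *\<^sub>R (w + t0 *\<^sub>R d) = w + t *\<^sub>R d"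
      using t0 by (simp add: algebra_simps)
    ultimately show "w + t *\<^sub>R d \<in> interior C" by simp
  qed
qed

text \<open>Without normals, the direction \<open>0\<close> meets the hypothesis of
  \<open>interior_direction\<close> vacuously, and \<open>w\<close> would be interior.\<close>

lemma cone_unit_normals_nonempty:
  fixes C :: "'a::euclidean_space set"
  assumes "closed C" "convex C" "conic C" "interior C \<noteq> {}" "w \<in> frontier C"
  shows "cone_unit_normals C w \<noteq> {}"
proof
  assume "cone_unit_normals C w = {}"
  moreover have "w \<in> C" using assms by (auto simp: frontier_def)
  ultimately obtain t0 where "0 < t0" "\<And>t. 0 < t \<Longrightarrow> t \<le> t0 \<Longrightarrow> w + t *\<^sub>R 0 \<in> interior C"
    using interior_direction[OF assms(2-4), of w 0] by auto
  then have "w \<in> interior C" by auto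
  then show False using assms(5) by (auto simp: frontier_def)
qed

text \<open>Opposite normals would confine \<open>C\<close> to a hyperplane. This settles the sign
  left open by \<open>cone_unit_normals_thick\<close>.\<close>

lemma cone_unit_normals_not_opposite:
  fixes C :: "'a::euclidean_space set"
  assumes "interior C \<noteq> {}" "\<nu> \<in> cone_unit_normals C w"
  shows "- \<nu> \<notin> cone_unit_normals C w"
proof
  assume "- \<nu> \<in> cone_unit_normals C w"
  then have "C \<subseteq> {x. \<nu> \<bullet> x = 0}" "\<nu> \<noteq> 0"
    using assms(2) by (force simp: cone_unit_normals_def inner_commute)+
  then have "interior C \<subseteq> {}" using interior_mono interior_hyperplane by metis
  then show False using assms(1) by simp
qed

section \<open>Flat slices of a cone and their boundary graphs\<close>

definition cone_section :: "'a::real_inner set \<Rightarrow> 'a \<Rightarrow> real \<Rightarrow> 'a set" where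
  "cone_section C w R = {x. x \<bullet> w = 0 \<and> w + x \<in> C \<and> norm x \<le> R}"

text \<open>A point at angle \<theta> from \<open>w\<close> goes to a vector of length tan \<theta>,
  so the cap of radius \<open>\<epsilon>\<close> becomes a ball of radius
  \<open>tan \<epsilon>\<close>, and the body becomes the slice of its cone by the hyperplane
  tangent to the sphere at \<open>w\<close>.\<close>

lemma gnomonic_image_eq:
  fixes K :: "(real ^ 'n) set"
  assumes K: "K \<subseteq> sphere 0 1" and w: "norm w = 1" and \<epsilon>: "0 < \<epsilon>" "\<epsilon> < pi / 2"
  shows "gnomonic w ` (K \<inter> sph_cap w \<epsilon>) = cone_section (conic hull K) w (tan \<epsilon>)"
proof -
  have cos: "0 < cos \<epsilon>" using \<epsilon> by (intro cos_gt_zero_pi) auto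
  have tan: "0 < tan \<epsilon>" using \<epsilon> by (intro tan_gt_zero) auto
  have tan2: "1 + (tan \<epsilon>)\<^sup>2 = (1 / cos \<epsilon>)\<^sup>2"
    using tan_sec[of \<epsilon>] cos by (simp add: divide_inverse)
  have w1: "w \<bullet> w = 1" using w by (simp add: dot_square_norm)
  have cap: "v \<in> sph_cap w \<epsilon> \<longleftrightarrow> cos \<epsilon> \<le> v \<bullet> w" if v: "norm v = 1" for v
  proof -
    have "\<bar>v \<bullet> w\<bar> \<le> 1" using Cauchy_Schwarz_ineq2[of v w] v w by simp
    then have a: "0 \<le> arccos (v \<bullet> w)" "arccos (v \<bullet> w) \<le> pi" "cos (arccos (v \<bullet> w)) = v \<bullet> w"
      by (auto simp: arccos_lbound arccos_ubound abs_le_iff)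
    have "arccos (v \<bullet> w) \<le> \<epsilon> \<longleftrightarrow> cos \<epsilon> \<le> cos (arccos (v \<bullet> w))"
      using a \<epsilon> by (intro cos_mono_le_eq[symmetric]) auto
    then show ?thesis using v a by (simp add: sph_cap_def sph_dist_def)
  qed
  show ?thesis
  proof (intro set_eqI iffI)
    fix x assume "x \<in> gnomonic w ` (K \<inter> sph_cap w \<epsilon>)"
    then obtain v where v: "v \<in> K" "v \<in> sph_cap w \<epsilon>" "x = gnomonic w v" by auto
    have nv: "norm v = 1" using v(1) K by auto
    define c where "c = v \<bullet> w"
    have c: "cos \<epsilon> \<le> c" "0 < c" using cap[OF nv] v(2) cos by (auto simp: c_def)
    have x: "x = (1/c) *\<^sub>R v - w" using v(3) by (simp add: gnomonic_def c_def inner_commute)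
    have 1: "x \<bullet> w = 0" using c w1 by (simp add: x inner_diff_left flip: c_def)
    have 2: "w + x \<in> conic hull K" unfolding conic_hull_explicit using v(1) c by (force simp: x)
    have "1 + (norm x)\<^sup>2 = (norm (w + x))\<^sup>2"
      using 1 w1 unfolding power2_norm_eq_inner by (simp add: inner_add_left inner_add_right inner_commute)
    also have "\<dots> = (1 / c)\<^sup>2" using nv c by (simp add: x)
    also have "\<dots> \<le> (1 / cos \<epsilon>)\<^sup>2" using c cos by (intro power_mono divide_left_mono) auto
    finally have "(norm x)\<^sup>2 \<le> (tan \<epsilon>)\<^sup>2" using tan2 by linarith
    then have "norm x \<le> tan \<epsilon>" by (rule power2_le_imp_le[OF _ less_imp_le[OF tan]])
    then show "x \<in> cone_section (conic hull K) w (tan \<epsilon>)" using 1 2 by (simp add: cone_section_def)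
  next
    fix x assume "x \<in> cone_section (conic hull K) w (tan \<epsilon>)"
    then have x: "x \<bullet> w = 0" "w + x \<in> conic hull K" "norm x \<le> tan \<epsilon>" by (auto simp: cone_section_def)
    obtain r u where u: "0 \<le> r" "u \<in> K" "w + x = r *\<^sub>R u" using x(2) by (auto simp: conic_hull_explicit)
    have nu: "norm u = 1" using u K by auto
    have "r\<^sup>2 = (norm (w + x))\<^sup>2" using u nu by simp
    also have "\<dots> = 1 + (norm x)\<^sup>2"
      using x(1) w1 unfolding power2_norm_eq_inner by (simp add: inner_add_left inner_add_right inner_commute)
    also have "\<dots> \<le> (1 / cos \<epsilon>)\<^sup>2" unfolding tan2[symmetric] using x(3) by (intro add_left_mono power_mono) auto
    finally have r: "r \<le> 1 / cos \<epsilon>" by (rule power2_le_imp_le) (use cos in simp)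
    have ru: "r * (u \<bullet> w) = 1"
    proof -
      have "(w + x) \<bullet> w = 1" using x(1) w1 by (simp add: inner_add_left)
      then show ?thesis using u(3) by simp
    qed
    then have r0: "0 < r" using u(1) by (cases "r = 0") auto
    have uw: "u \<bullet> w = 1 / r" using ru r0 by (simp add: field_simps)
    have "cos \<epsilon> \<le> u \<bullet> w" using r r0 cos by (simp add: uw field_simps)
    then have "u \<in> sph_cap w \<epsilon>" using cap[OF nu] by simp
    moreover have "x = gnomonic w u" 
    proof -
      have "x = r *\<^sub>R u - w" using u(3) by (simp add: algebra_simps)
      then show ?thesis using r0 uw by (simp add: gnomonic_def inner_commute)
    qed
    ultimately show "x \<in> gnomonic w ` (K \<inter> sph_cap w \<epsilon>)" using u(2) by blast
  qed
qed

text \<open>Normals at the origin do not see the bound \<open>R\<close>, since points of the slice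
  can be shrunk towards \<open>0\<close>. Rays with \<open>c \<bullet> w \<le> 0\<close> miss the
  slice, but adding a large multiple of \<open>w\<close> brings them into view, and \<open>w\<close>
  is orthogonal to \<open>\<nu>\<close>.\<close>

lemma inner_unit_normals_cone_section:
  fixes C :: "(real ^ 'n) set"
  assumes C: "convex C" "conic C" and w: "norm w = 1" "w \<in> C" and R: "0 < R"
  shows "inner_unit_normals {x. x \<bullet> w = 0} (cone_section C w R) 0 = cone_unit_normals C w"
proof (intro set_eqI iffI)
  have w1: "w \<bullet> w = 1" using w by (simp add: dot_square_norm)
  fix \<nu> assume "\<nu> \<in> inner_unit_normals {x. x \<bullet> w = 0} (cone_section C w R) 0"
  then have \<nu>: "\<nu> \<bullet> w = 0" "norm \<nu> = 1" "\<And>z. z \<in> cone_section C w R \<Longrightarrow> 0 \<le> z \<bullet> \<nu>"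
    by (auto simp: inner_unit_normals_def)
  have wn: "w \<bullet> \<nu> = 0" using \<nu>(1) by (simp add: inner_commute)
  have pos: "0 \<le> c \<bullet> \<nu>" if c: "c \<in> C" "0 < c \<bullet> w" for c
  proof -
    define x where "x = (1 / (c \<bullet> w)) *\<^sub>R c - w"
    define s where "s = R / (R + norm x)"
    have Rx: "0 < R + norm x" using R by (simp add: add_pos_nonneg)
    have s: "0 < s" "s \<le> 1" "s * norm x \<le> R" using R Rx by (auto simp: s_def field_simps)
    have "w + s *\<^sub>R x = (1 - s) *\<^sub>R w + (s / (c \<bullet> w)) *\<^sub>R c" by (simp add: x_def algebra_simps)
    moreover have "(1 - s) *\<^sub>R w \<in> C" using w s C(2) by (auto simp: conic_def)
    moreover have "(s / (c \<bullet> w)) *\<^sub>R c \<in> C" using c s C(2) by (simp add: conic_def)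
    ultimately have "w + s *\<^sub>R x \<in> C" using convex_cone_add[OF C] by simp
    moreover have "x \<bullet> w = 0" using c w1 by (simp add: x_def inner_diff_left)
    ultimately have "s *\<^sub>R x \<in> cone_section C w R" using s by (simp add: cone_section_def)
    then have "0 \<le> s * (x \<bullet> \<nu>)" using \<nu>(3) by fastforce
    then have "0 \<le> x \<bullet> \<nu>" using s by (simp add: zero_le_mult_iff)
    then show ?thesis using c wn by (simp add: x_def inner_diff_left zero_le_divide_iff)
  qed
  have "0 \<le> c \<bullet> \<nu>" if c: "c \<in> C" for c
  proof -
    define k where "k = \<bar>c \<bullet> w\<bar> + 1"
    have "k *\<^sub>R w \<in> C" using w(2) C(2) by (simp add: conic_def k_def)
    then have "c + k *\<^sub>R w \<in> C" by (rule convex_cone_add[OF C c])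
    moreover have "0 < (c + k *\<^sub>R w) \<bullet> w" using w1 by (simp add: inner_add_left k_def)
    ultimately have "0 \<le> (c + k *\<^sub>R w) \<bullet> \<nu>" by (rule pos)
    then show ?thesis using wn by (simp add: inner_add_left)
  qed
  then show "\<nu> \<in> cone_unit_normals C w" using \<nu> by (auto simp: cone_unit_normals_def)
next
  fix \<nu> assume "\<nu> \<in> cone_unit_normals C w"
  then have \<nu>: "\<nu> \<bullet> w = 0" "norm \<nu> = 1" "\<And>z. z \<in> C \<Longrightarrow> 0 \<le> z \<bullet> \<nu>"
    by (auto simp: cone_unit_normals_def)
  have "0 \<le> z \<bullet> \<nu>" if "z \<in> cone_section C w R" for z
  proof -
    have "w + z \<in> C" using that by (simp add: cone_section_def)
    then show ?thesis using \<nu>(3)[of "w + z"] \<nu>(1) by (simp add: inner_add_left inner_commute[of w])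
  qed
  then show "\<nu> \<in> inner_unit_normals {x. x \<bullet> w = 0} (cone_section C w R) 0"
    using \<nu> by (auto simp: inner_unit_normals_def)
qed

text \<open>The unique normal \<open>\<nu>\<close> is itself an interior direction, so the cone
  contains a ball about \<open>w + s *\<^sub>R \<nu>\<close> and the convex hull of this ball with
  \<open>w\<close>. Hence the graph is well defined near \<open>0\<close> with at most linear
  growth, and every boundary point near \<open>w\<close> is on it: strictly between a point of
  \<open>C\<close> and a point of the ball above it there are only interior points. For small
  \<open>y\<close> the bound \<open>R\<close> is not attained.\<close>

lemma boundary_graph_cone_section:
  fixes C :: "(real ^ 'n) set"
  assumes C: "closed C" "convex C" "conic C" "interior C \<noteq> {}" and w: "norm w = 1" "w \<in> C"
    and \<nu>: "cone_unit_normals C w = {\<nu>}" and R: "0 < R"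
  defines "T \<equiv> {y. y \<bullet> w = 0 \<and> y \<bullet> \<nu> = 0}"
    and "f \<equiv> boundary_graph (cone_section C w R) 0 \<nu>"
  obtains \<rho> \<kappa> where "0 < \<rho>" "0 \<le> \<kappa>" "convex_on (T \<inter> ball 0 \<rho>) f"
    "\<And>y. y \<in> T \<Longrightarrow> norm y < \<rho> \<Longrightarrow> 0 \<le> f y \<and> f y \<le> \<kappa> * norm y \<and> w + y + f y *\<^sub>R \<nu> \<in> frontier C"
    "\<And>y t. y \<in> T \<Longrightarrow> norm (y + t *\<^sub>R \<nu>) < \<rho> \<Longrightarrow> w + y + t *\<^sub>R \<nu> \<in> frontier C \<Longrightarrow> f y = t"
proof -
  have "\<nu> \<in> cone_unit_normals C w" using \<nu> by simp
  then have \<nu>': "norm \<nu> = 1" "\<nu> \<bullet> w = 0" "\<And>z. z \<in> C \<Longrightarrow> 0 \<le> z \<bullet> \<nu>" and \<nu>1: "\<nu> \<bullet> \<nu> = 1"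
    by (simp_all add: cone_unit_normals_def dot_square_norm)
  have fr: "x \<in> C \<and> x \<notin> interior C" if "x \<in> frontier C" for x using that C(1) by (auto simp: frontier_def)
  define D where "D y = {t. w + y + t *\<^sub>R \<nu> \<in> C \<and> norm (y + t *\<^sub>R \<nu>) \<le> R}" for y
  have f: "f y = Inf (D y)" if "y \<in> T" for y
    using that \<nu>' by (simp add: f_def boundary_graph_def cone_section_def D_def T_def inner_add_left add.assoc)
  obtain s where s: "0 < s" "w + s *\<^sub>R \<nu> \<in> interior C"
    using interior_direction[OF C(2-4) w(2), of \<nu>] \<nu> \<nu>1 by (metis order_refl singletonD zero_less_one)
  obtain \<rho>0 where \<rho>0: "0 < \<rho>0" "ball (w + s *\<^sub>R \<nu>) \<rho>0 \<subseteq> interior C"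
    using s(2) open_interior by (meson openE)
  \<comment> \<open>The slope of the convex hull of \<open>w\<close> with a ball of radius
    \<open>\<rho>0 / 2\<close> at height \<open>s\<close>.\<close>
  define \<kappa> where "\<kappa> = 2 * s / \<rho>0"
  have \<kappa>: "0 \<le> \<kappa>" using s \<rho>0 by (simp add: \<kappa>_def)
  define \<rho> where "\<rho> = min (min (\<rho>0 / 2) s) (R / (1 + \<kappa>))"
  have \<rho>: "0 < \<rho>" "\<rho> \<le> \<rho>0 / 2" "\<rho> \<le> s" "\<rho> \<le> R / (1 + \<kappa>)"
  proof -
    have "0 < R / (1 + \<kappa>)" using R \<kappa> by (intro divide_pos_pos) auto
    then show "0 < \<rho>" using s \<rho>0 by (simp add: \<rho>_def)
    show "\<rho> \<le> \<rho>0 / 2" "\<rho> \<le> s" "\<rho> \<le> R / (1 + \<kappa>)"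
      unfolding \<rho>_def by linarith+
  qed
  have \<rho>R: "(1 + \<kappa>) * \<rho> \<le> R" using \<rho>(4) \<kappa> by (simp add: field_simps)
  have nonneg: "0 \<le> t" if "y \<in> T" "w + y + t *\<^sub>R \<nu> \<in> C" for y t
    using \<nu>'(3)[OF that(2)] that(1) \<nu>' \<nu>1 by (simp add: inner_add_left T_def inner_commute[of w])
  have bdd: "bdd_below (D y)" if "y \<in> T" for y
    using nonneg[OF that] by (auto simp: D_def intro!: bdd_belowI[of _ 0])
  have inD: "\<kappa> * norm y \<in> D y" if y: "y \<in> T" "norm y < \<rho>" for y
  proof (cases "y = 0")
    case True
    then show ?thesis using w R by (simp add: D_def)
  next
    case False
    define l where "l = 2 * norm y / \<rho>0"
    have l: "0 < l" "l \<le> 1" using False y \<rho> \<rho>0 by (auto simp: l_def field_simps)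
    define x where "x = w + s *\<^sub>R \<nu> + (1/l) *\<^sub>R y"
    have "norm ((1/l) *\<^sub>R y) = \<rho>0 / 2" using False \<rho>0 by (simp add: l_def)
    then have "x \<in> ball (w + s *\<^sub>R \<nu>) \<rho>0" using \<rho>0 by (simp add: x_def dist_norm)
    then have "x \<in> C" using \<rho>0 interior_subset by blast
    then have "(1 - l) *\<^sub>R w + l *\<^sub>R x \<in> C" using w(2) l by (intro convexD[OF C(2)]) auto
    moreover have "(1 - l) *\<^sub>R w + l *\<^sub>R x = w + y + (l * s) *\<^sub>R \<nu>"
      using l by (simp add: x_def algebra_simps)
    moreover have "l * s = \<kappa> * norm y" by (simp add: l_def \<kappa>_def)
    ultimately have 1: "w + y + (\<kappa> * norm y) *\<^sub>R \<nu> \<in> C" by simp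
    have "norm (y + (\<kappa> * norm y) *\<^sub>R \<nu>) \<le> norm y + \<kappa> * norm y"
      using norm_triangle_ineq[of y "(\<kappa> * norm y) *\<^sub>R \<nu>"] \<nu>' \<kappa> by simp
    also have "\<dots> = (1 + \<kappa>) * norm y" by (simp add: algebra_simps)
    also have "\<dots> \<le> (1 + \<kappa>) * \<rho>" using y \<kappa> by (intro mult_left_mono) auto
    finally show ?thesis using 1 \<rho>R by (simp add: D_def)
  qed
  have closedD: "closed (D y)" for y
  proof -
    have "D y = (\<lambda>t. w + y + t *\<^sub>R \<nu>) -` C \<inter> (\<lambda>t. y + t *\<^sub>R \<nu>) -` cball 0 R"
      by (auto simp: D_def)
    then show ?thesis using C(1) by (auto intro!: closed_Int closed_vimage continuous_intros)
  qed
  have fD: "f y \<in> D y" if "y \<in> T" "norm y < \<rho>" for y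
    unfolding f[OF that(1)] using inD[OF that] bdd[OF that(1)] closedD
    by (intro closed_contains_Inf) auto
  have fle: "f y \<le> t" if "y \<in> T" "t \<in> D y" for y t
    unfolding f[OF that(1)] using that bdd by (intro cInf_lower) auto
  have frontier: "w + y + f y *\<^sub>R \<nu> \<in> frontier C" if y: "y \<in> T" "norm y < \<rho>" for y
  proof -
    have inC: "w + y + f y *\<^sub>R \<nu> \<in> C" and R': "norm (y + f y *\<^sub>R \<nu>) \<le> R" using fD[OF y] by (auto simp: D_def)
    have f0: "0 \<le> f y" using nonneg[OF y(1) inC] .
    have "w + y + f y *\<^sub>R \<nu> \<notin> interior C"
    proof
      assume "w + y + f y *\<^sub>R \<nu> \<in> interior C"
      then obtain e where e: "0 < e" "ball (w + y + f y *\<^sub>R \<nu>) e \<subseteq> C" using mem_interior by blast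
      define t where "t = f y - e/2"
      have "w + y + t *\<^sub>R \<nu> \<in> ball (w + y + f y *\<^sub>R \<nu>) e"
        using e \<nu>' by (simp add: dist_norm t_def flip: scaleR_diff_left)
      then have tC: "w + y + t *\<^sub>R \<nu> \<in> C" using e by blast
      have t0: "0 \<le> t" using nonneg[OF y(1) tC] .
      \<comment> \<open>As \<open>y\<close> is orthogonal to \<open>\<nu>\<close>, the norm grows
        with a nonnegative height, so lowering the point respects the bound
        \<open>R\<close>.\<close>
      have n2: "(norm (y + x *\<^sub>R \<nu>))\<^sup>2 = (norm y)\<^sup>2 + x\<^sup>2" for x
        using y \<nu>1 unfolding power2_norm_eq_inner
        by (simp add: T_def inner_add_left inner_add_right inner_commute[of \<nu> y] power2_eq_square)
      have "t\<^sup>2 \<le> (f y)\<^sup>2" using t0 e by (intro power_mono) (auto simp: t_def)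
      then have "(norm (y + t *\<^sub>R \<nu>))\<^sup>2 \<le> (norm (y + f y *\<^sub>R \<nu>))\<^sup>2" by (simp add: n2)
      then have "norm (y + t *\<^sub>R \<nu>) \<le> R" using R' by (meson norm_ge_zero order_trans power2_le_imp_le)
      then have "f y \<le> t" using tC by (intro fle y) (simp add: D_def)
      then show False using e by (simp add: t_def)
    qed
    then show ?thesis using inC closure_subset by (auto simp: frontier_def)
  qed
  have unique: "f y = t"
    if y: "y \<in> T" and n: "norm (y + t *\<^sub>R \<nu>) < \<rho>" and t: "w + y + t *\<^sub>R \<nu> \<in> frontier C" for y t
  proof -
    have tC: "w + y + t *\<^sub>R \<nu> \<in> C" "w + y + t *\<^sub>R \<nu> \<notin> interior C" using fr[OF t] by auto
    have n2: "(norm (y + t *\<^sub>R \<nu>))\<^sup>2 = (norm y)\<^sup>2 + t\<^sup>2"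
      using y \<nu>1 unfolding power2_norm_eq_inner
      by (simp add: T_def inner_add_left inner_add_right inner_commute[of \<nu> y] power2_eq_square)
    then have "(norm y)\<^sup>2 \<le> (norm (y + t *\<^sub>R \<nu>))\<^sup>2" "t\<^sup>2 \<le> (norm (y + t *\<^sub>R \<nu>))\<^sup>2" by auto
    then have ny: "norm y < \<rho>" and nt: "t < \<rho>"
      using n power2_le_imp_le[OF _ norm_ge_zero] by (smt (verit))+
    have "\<rho> \<le> (1 + \<kappa>) * \<rho>" using \<rho> \<kappa> by simp
    then have "t \<in> D y" using tC n \<rho>R by (simp add: D_def)
    then have le: "f y \<le> t" using fle y by blast
    show ?thesis
    proof (rule ccontr)
      assume "f y \<noteq> t"
      then have lt: "f y < t" using le by simp
      have fC: "w + y + f y *\<^sub>R \<nu> \<in> C" using fD[OF y ny] by (simp add: D_def)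
      have "w + y + s *\<^sub>R \<nu> \<in> ball (w + s *\<^sub>R \<nu>) \<rho>0" using ny \<rho> \<rho>0 by (simp add: dist_norm)
      then have sI: "w + y + s *\<^sub>R \<nu> \<in> interior C" using \<rho>0 by blast
      have ts: "t < s" using nt \<rho> by simp
      define l where "l = (t - f y) / (s - f y)"
      have sf: "0 < s - f y" using lt ts by simp
      have l: "0 < l" "l < 1" using lt ts sf by (auto simp: l_def field_simps)
      have "l * (s - f y) = t - f y" using sf by (simp add: l_def)
      then have lt': "(1 - l) * f y + l * s = t" by (simp add: algebra_simps)
      have "(1 - l) *\<^sub>R (w + y + f y *\<^sub>R \<nu>) \<in> C" using fC l C(3) by (simp add: conic_def)
      then have "(1 - l) *\<^sub>R (w + y + f y *\<^sub>R \<nu>) + l *\<^sub>R (w + y + s *\<^sub>R \<nu>) \<in> interior C"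
        using interior_cone_add[OF C(2,3)] interior_cone_scale[OF C(3) l(1) sI] by blast
      also have "(1 - l) *\<^sub>R (w + y + f y *\<^sub>R \<nu>) + l *\<^sub>R (w + y + s *\<^sub>R \<nu>) = w + y + ((1 - l) * f y + l * s) *\<^sub>R \<nu>"
        by (simp add: algebra_simps)
      finally show False using tC by (simp add: lt')
    qed
  qed
  have sT: "subspace T" by (auto simp: T_def subspace_def inner_add_left)
  have "convex_on (T \<inter> ball 0 \<rho>) f"
  proof (rule convex_onI)
    fix t x y assume t: "0 < t" "t < (1::real)" and x: "x \<in> T \<inter> ball 0 \<rho>" and y: "y \<in> T \<inter> ball 0 \<rho>"
    have *: "f x \<in> D x" "f y \<in> D y" using fD x y by auto
    let ?z = "(1 - t) *\<^sub>R x + t *\<^sub>R y" and ?c = "(1 - t) * f x + t * f y"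
    have "w + ?z + ?c *\<^sub>R \<nu> = (1 - t) *\<^sub>R (w + x + f x *\<^sub>R \<nu>) + t *\<^sub>R (w + y + f y *\<^sub>R \<nu>)"
      by (simp add: algebra_simps)
    also have "\<dots> \<in> C" using * t by (intro convexD[OF C(2)]) (auto simp: D_def)
    finally have 1: "w + ?z + ?c *\<^sub>R \<nu> \<in> C" .
    have "?z + ?c *\<^sub>R \<nu> = (1 - t) *\<^sub>R (x + f x *\<^sub>R \<nu>) + t *\<^sub>R (y + f y *\<^sub>R \<nu>)"
      by (simp add: algebra_simps)
    also have "\<dots> \<in> cball 0 R" using * t by (intro convexD[OF convex_cball]) (auto simp: D_def)
    finally have "norm (?z + ?c *\<^sub>R \<nu>) \<le> R" by simp
    then show "f ?z \<le> ?c"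
      using 1 x y sT by (intro fle) (auto simp: D_def intro!: subspace_add subspace_scale)
  qed (intro convex_Int convex_ball subspace_imp_convex sT)
  then show ?thesis
  proof (rule that[OF \<rho>(1) \<kappa>])
    fix y assume y: "y \<in> T" "norm y < \<rho>"
    show "0 \<le> f y \<and> f y \<le> \<kappa> * norm y \<and> w + y + f y *\<^sub>R \<nu> \<in> frontier C"
      using frontier[OF y] fle[OF y(1) inD[OF y]] nonneg[OF y(1), of "f y"] fD[OF y] by (auto simp: D_def)
  qed (use unique in blast)
qed

section \<open>Two cones at a thick boundary point\<close>

lemma frontier_cone_scale:
  fixes C :: "'a::real_normed_vector set"
  assumes "closed C" "conic C" "0 < c" "x \<in> frontier C"
  shows "c *\<^sub>R x \<in> frontier C"
proof -
  have x: "x \<in> C" "x \<notin> interior C" using assms by (auto simp: frontier_def)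
  have "c *\<^sub>R x \<in> C" using x assms by (simp add: conic_def)
  moreover have "c *\<^sub>R x \<notin> interior C"
  proof
    assume cx: "c *\<^sub>R x \<in> interior C"
    have "(1/c) *\<^sub>R (c *\<^sub>R x) \<in> interior C"
      by (rule interior_cone_scale[OF assms(2) _ cx]) (use assms(3) in simp)
    then show False using x assms(3) by simp
  qed
  ultimately show ?thesis using closure_subset by (auto simp: frontier_def)
qed

lemma norm_normalize_diff_le:
  fixes b w :: "'a::real_normed_vector"
  assumes "norm w = 1" "b \<noteq> 0"
  shows "norm ((1 / norm b) *\<^sub>R b - w) \<le> 2 * norm (b - w)"
proof -
  have "(1 / norm b) *\<^sub>R b - b = (1 / norm b - 1) *\<^sub>R b" by (simp add: scaleR_diff_left)
  then have "norm ((1 / norm b) *\<^sub>R b - b) = \<bar>1 / norm b - 1\<bar> * norm b" by simp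
  also have "\<dots> = \<bar>(1 / norm b - 1) * norm b\<bar>" by (simp add: abs_mult)
  also have "(1 / norm b - 1) * norm b = norm w - norm b" using assms by (simp add: algebra_simps)
  also have "\<bar>norm w - norm b\<bar> \<le> norm (b - w)" by (metis norm_minus_commute norm_triangle_ineq3)
  finally have "norm ((1 / norm b) *\<^sub>R b - b) \<le> norm (b - w)" .
  then show ?thesis
    using norm_triangle_ineq[of "(1 / norm b) *\<^sub>R b - b" "b - w"] by simp
qed

text \<open>Let \<open>y\<close> be tangential at \<open>w\<close>. A short step along
  \<open>y + \<eta> *\<^sub>R \<nu>\<close> leads into \<open>M\<close> and one along
  \<open>y - \<eta> *\<^sub>R \<nu>\<close> leads out of it, so there is a boundary point of
  \<open>M\<close> in between, and \<open>E\<close> comes close to it after normalization. Since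
  \<open>\<mu>\<close> is nonnegative on \<open>E\<close>, in the limit it is nonnegative on
  \<open>y\<close>, and likewise on \<open>- y\<close>. Only multiples of \<open>\<nu>\<close>
  remain.\<close>

lemma cone_unit_normals_thick:
  fixes M X E :: "'a::euclidean_space set"
  assumes M: "closed M" "convex M" "conic M" "interior M \<noteq> {}" and w: "norm w = 1" "w \<in> M"
    and \<nu>: "cone_unit_normals M w = {\<nu>}" and E: "E \<subseteq> X"
    and thick: "thick E (frontier M \<inter> sphere 0 1) w"
    and \<mu>: "\<mu> \<in> cone_unit_normals X w"
  shows "\<mu> = \<nu> \<or> \<mu> = - \<nu>"
proof -
  have w1: "w \<bullet> w = 1" using w by (simp add: dot_square_norm)
  have "\<nu> \<in> cone_unit_normals M w" using \<nu> by simp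
  then have \<nu>': "norm \<nu> = 1" "\<nu> \<bullet> w = 0" "\<And>z. z \<in> M \<Longrightarrow> 0 \<le> z \<bullet> \<nu>" and \<nu>1: "\<nu> \<bullet> \<nu> = 1"
    by (simp_all add: cone_unit_normals_def dot_square_norm)
  have \<mu>': "norm \<mu> = 1" "\<mu> \<bullet> w = 0" "\<And>z. z \<in> X \<Longrightarrow> 0 \<le> z \<bullet> \<mu>"
    using \<mu> by (simp_all add: cone_unit_normals_def)
  \<comment> \<open>The factor 4 is 2 for normalizing \<open>b\<close> times 2 for
    \<open>norm b \<le> 2\<close>; one further \<open>\<eta>\<close> comes from the height
    \<open>\<sigma>\<close>.\<close>
  have bound: "- (\<eta> * (5 + 4 * norm y)) \<le> y \<bullet> \<mu>"
    if y: "y \<bullet> w = 0" "y \<bullet> \<nu> = 0" and \<eta>: "0 < \<eta>" "\<eta> \<le> 1" for y \<eta>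
  proof -
    define L where "L = norm y + \<eta>"
    have L: "0 < L" using \<eta> by (simp add: L_def add_nonneg_pos)
    obtain t0 where t0: "0 < t0" "\<And>t. 0 < t \<Longrightarrow> t \<le> t0 \<Longrightarrow> w + t *\<^sub>R (y + \<eta> *\<^sub>R \<nu>) \<in> interior M"
    proof (rule interior_direction[OF M(2-4) w(2)])
      show "0 < (y + \<eta> *\<^sub>R \<nu>) \<bullet> \<mu>" if "\<mu> \<in> cone_unit_normals M w" for \<mu>
        using that \<nu> y \<eta> \<nu>1 by (simp add: inner_add_left)
    qed blast
    obtain \<delta> where \<delta>: "0 < \<delta>" "\<And>v. v \<in> frontier M \<inter> sphere 0 1 \<Longrightarrow> dist v w < \<delta> \<Longrightarrow> \<exists>e\<in>E. dist e v \<le> \<eta> * dist v w"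
      using thick \<eta> unfolding thick_def by blast
    define t where "t = min (min t0 (1 / L)) (\<delta> / (4 * L))"
    have t: "0 < t" "t \<le> t0" "t * L \<le> 1" "2 * (t * L) < \<delta>"
    proof -
      show "0 < t" using t0 \<delta> L by (simp add: t_def)
      have "t \<le> t0" "t \<le> 1 / L" and 2: "t \<le> \<delta> / (4 * L)" unfolding t_def by linarith+
      then show "t \<le> t0" "t * L \<le> 1" using L by (simp_all add: field_simps)
      have "4 * (t * L) \<le> \<delta>" using 2 L by (simp add: field_simps)
      then show "2 * (t * L) < \<delta>" using \<delta>(1) by linarith
    qed
    define S where "S = (\<lambda>\<sigma>. w + t *\<^sub>R (y + \<sigma> *\<^sub>R \<nu>)) ` {-\<eta>..\<eta>}"
    have "connected S"
      unfolding S_def by (intro connected_continuous_image continuous_intros) auto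
    moreover have "S \<inter> M \<noteq> {}"
    proof -
      have "w + t *\<^sub>R (y + \<eta> *\<^sub>R \<nu>) \<in> M" using t0(2)[OF t(1,2)] interior_subset by blast
      moreover have "w + t *\<^sub>R (y + \<eta> *\<^sub>R \<nu>) \<in> S" unfolding S_def using \<eta> by (intro imageI) simp
      ultimately show ?thesis by blast
    qed
    moreover have "S - M \<noteq> {}"
    proof -
      have "(w + t *\<^sub>R (y + (- \<eta>) *\<^sub>R \<nu>)) \<bullet> \<nu> < 0"
        using \<nu>' \<nu>1 y t \<eta> by (simp add: inner_add_left inner_diff_left inner_commute[of w])
      then have "w + t *\<^sub>R (y + (- \<eta>) *\<^sub>R \<nu>) \<notin> M" using \<nu>'(3) by force
      moreover have "w + t *\<^sub>R (y + (- \<eta>) *\<^sub>R \<nu>) \<in> S" unfolding S_def using \<eta> by (intro imageI) simp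
      ultimately show ?thesis by blast
    qed
    ultimately have "S \<inter> frontier M \<noteq> {}" by (rule connected_Int_frontier)
    then obtain \<sigma> where "\<sigma> \<in> {-\<eta>..\<eta>}" and \<sigma>2: "w + t *\<^sub>R (y + \<sigma> *\<^sub>R \<nu>) \<in> frontier M"
      unfolding S_def by blast
    then have \<sigma>: "\<bar>\<sigma>\<bar> \<le> \<eta>" by auto
    define b where "b = w + t *\<^sub>R (y + \<sigma> *\<^sub>R \<nu>)"
    have nb: "norm (b - w) \<le> t * L"
    proof -
      have "norm (y + \<sigma> *\<^sub>R \<nu>) \<le> L"
        using norm_triangle_ineq[of y "\<sigma> *\<^sub>R \<nu>"] \<nu>' \<sigma> by (simp add: L_def)
      then show ?thesis using t by (simp add: b_def)
    qed
    have bw: "b \<bullet> w = 1" using y \<nu>' w1 by (simp add: b_def inner_add_left)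
    have b0: "b \<noteq> 0" using bw by auto
    have b2: "norm b \<le> 2" using norm_triangle_ineq[of w "b - w"] w nb t by simp
    define v where "v = (1 / norm b) *\<^sub>R b"
    have vfr: "v \<in> frontier M \<inter> sphere 0 1"
      using \<sigma>2 b0 frontier_cone_scale[OF M(1,3)] by (simp add: v_def flip: b_def)
    have vw: "dist v w \<le> 2 * (t * L)"
      using norm_normalize_diff_le[OF w(1) b0] nb by (simp add: v_def dist_norm)
    then obtain e where e: "e \<in> E" "dist e v \<le> \<eta> * dist v w" using \<delta>(2)[OF vfr] t by auto
    have ev: "norm (e - v) \<le> \<eta> * (2 * (t * L))"
      using order_trans[OF e(2) mult_left_mono[OF vw]] \<eta> by (simp add: dist_norm)
    have "0 \<le> e \<bullet> \<mu>" using \<mu>'(3) e E by blast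
    also have "e \<bullet> \<mu> = v \<bullet> \<mu> + (e - v) \<bullet> \<mu>" by (simp add: inner_diff_left)
    also have "(e - v) \<bullet> \<mu> \<le> \<eta> * (2 * (t * L))"
      using norm_cauchy_schwarz[of "e - v" \<mu>] \<mu>' ev by simp
    finally have "- (\<eta> * (2 * (t * L))) \<le> v \<bullet> \<mu>" by simp
    then have "norm b * - (\<eta> * (2 * (t * L))) \<le> norm b * (v \<bullet> \<mu>)" by (intro mult_left_mono) auto
    moreover have "norm b * (v \<bullet> \<mu>) = b \<bullet> \<mu>" using b0 by (simp add: v_def)
    moreover have "norm b * (\<eta> * (2 * (t * L))) \<le> 2 * (\<eta> * (2 * (t * L)))"
      using b2 t \<eta> L by (intro mult_right_mono) auto
    ultimately have "- (2 * (\<eta> * (2 * (t * L)))) \<le> b \<bullet> \<mu>" unfolding mult_minus_right by linarith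
    also have "b \<bullet> \<mu> = t * (y \<bullet> \<mu> + \<sigma> * (\<nu> \<bullet> \<mu>))"
      using \<mu>' by (simp add: b_def inner_add_left inner_commute[of w])
    also have "\<dots> \<le> t * (y \<bullet> \<mu> + \<eta>)"
    proof -
      have "\<sigma> * (\<nu> \<bullet> \<mu>) \<le> \<bar>\<sigma>\<bar> * \<bar>\<nu> \<bullet> \<mu>\<bar>" by (metis abs_ge_self abs_mult)
      also have "\<dots> \<le> \<eta> * 1"
        using \<sigma> Cauchy_Schwarz_ineq2[of \<nu> \<mu>] \<nu>' \<mu>' by (intro mult_mono) auto
      finally show ?thesis using t by (intro mult_left_mono) auto
    qed
    finally have "t * (- (4 * \<eta> * L)) \<le> t * (y \<bullet> \<mu> + \<eta>)" by (simp add: mult_ac)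
    then have "- (4 * \<eta> * L) \<le> y \<bullet> \<mu> + \<eta>" using t by (simp only: mult_le_cancel_left_pos)
    moreover have "4 * \<eta> * L \<le> 4 * \<eta> * (norm y + 1)"
      using \<eta> by (intro mult_left_mono) (auto simp: L_def)
    ultimately show ?thesis by (simp add: algebra_simps)
  qed
  have ge: "0 \<le> y \<bullet> \<mu>" if y: "y \<bullet> w = 0" "y \<bullet> \<nu> = 0" for y
  proof -
    have "- (y \<bullet> \<mu>) \<le> 0"
    proof (rule field_le_epsilon)
      fix e :: real assume e: "0 < e"
      define c where "c = 5 + 4 * norm y"
      have c: "0 < c" by (simp add: c_def add_pos_nonneg)
      have "min 1 (e / c) * c \<le> e / c * c" using c by (intro mult_right_mono) auto
      then have "min 1 (e / c) * c \<le> e" using c by simp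
      then show "- (y \<bullet> \<mu>) \<le> 0 + e" using bound[OF y, of "min 1 (e / c)"] c e by (simp flip: c_def)
    qed
    then show ?thesis by simp
  qed
  define z where "z = \<mu> - (\<mu> \<bullet> \<nu>) *\<^sub>R \<nu>"
  have z: "z \<bullet> w = 0" "z \<bullet> \<nu> = 0" using \<mu>' \<nu>' \<nu>1 by (simp_all add: z_def inner_diff_left)
  have "z \<bullet> \<mu> = 0" using ge[of z] ge[of "- z"] z by simp
  then have "z \<bullet> z = 0" using z(2) by (simp add: z_def inner_diff_right)
  then have "\<mu> = (\<mu> \<bullet> \<nu>) *\<^sub>R \<nu>" by (simp add: z_def)
  moreover from this have "\<bar>\<mu> \<bullet> \<nu>\<bar> = 1" using \<mu>'(1) \<nu>'(1) by (metis mult.right_neutral norm_scaleR)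
  ultimately show ?thesis by (metis abs_if minus_equation_iff scaleR_minus1_left scaleR_one)
qed

text \<open>Thickness moves from the sphere to the tangent space: the graph point over
  \<open>y\<close> is normalized to \<open>v\<close>, a nearby \<open>e\<close> in \<open>E\<close>
  is rescaled to the slice, and its part in \<open>T\<close> is the coincidence point, because near
  \<open>w\<close> the boundary of either cone lies on the respective graph. Radial scaling
  preserves both boundaries and distorts distances by bounded factors only.\<close>

lemma thick_boundary_graphs_eq:
  fixes X Y E :: "(real ^ 'n) set"
  assumes X: "closed X" "convex X" "conic X" "interior X \<noteq> {}"
    and Y: "closed Y" "convex Y" "conic Y" "interior Y \<noteq> {}"
    and w: "norm w = 1" "w \<in> X" "w \<in> Y" and R: "0 < R"
    and \<nu>: "cone_unit_normals X w = {\<nu>}" "cone_unit_normals Y w = {\<nu>}"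
    and E: "E \<subseteq> frontier X \<inter> frontier Y" and thick: "thick E (frontier X \<inter> sphere 0 1) w"
  defines "T \<equiv> {y. y \<bullet> w = 0 \<and> y \<bullet> \<nu> = 0}"
    and "f \<equiv> boundary_graph (cone_section X w R) 0 \<nu>"
    and "g \<equiv> boundary_graph (cone_section Y w R) 0 \<nu>"
  shows "thick {y\<in>T. f y = g y} T 0"
proof -
  have w1: "w \<bullet> w = 1" using w by (simp add: dot_square_norm)
  have "\<nu> \<in> cone_unit_normals X w" using \<nu> by simp
  then have \<nu>': "norm \<nu> = 1" "\<nu> \<bullet> w = 0" and \<nu>1: "\<nu> \<bullet> \<nu> = 1"
    by (simp_all add: cone_unit_normals_def dot_square_norm)
  obtain \<rho>1 \<kappa> where f: "0 < \<rho>1" "0 \<le> \<kappa>" "convex_on (T \<inter> ball 0 \<rho>1) f"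
    "\<And>y. y \<in> T \<Longrightarrow> norm y < \<rho>1 \<Longrightarrow> 0 \<le> f y \<and> f y \<le> \<kappa> * norm y \<and> w + y + f y *\<^sub>R \<nu> \<in> frontier X"
    "\<And>y t. y \<in> T \<Longrightarrow> norm (y + t *\<^sub>R \<nu>) < \<rho>1 \<Longrightarrow> w + y + t *\<^sub>R \<nu> \<in> frontier X \<Longrightarrow> f y = t"
    by (rule boundary_graph_cone_section[OF X w(1,2) \<nu>(1) R, folded T_def f_def]) (rule that)
  obtain \<rho>2 \<kappa>2 where g: "0 < \<rho>2" "0 \<le> \<kappa>2" "convex_on (T \<inter> ball 0 \<rho>2) g"
    "\<And>y. y \<in> T \<Longrightarrow> norm y < \<rho>2 \<Longrightarrow> 0 \<le> g y \<and> g y \<le> \<kappa>2 * norm y \<and> w + y + g y *\<^sub>R \<nu> \<in> frontier Y"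
    "\<And>y t. y \<in> T \<Longrightarrow> norm (y + t *\<^sub>R \<nu>) < \<rho>2 \<Longrightarrow> w + y + t *\<^sub>R \<nu> \<in> frontier Y \<Longrightarrow> g y = t"
    by (rule boundary_graph_cone_section[OF Y w(1,3) \<nu>(2) R, folded T_def g_def]) (rule that)
  show ?thesis
    unfolding thick_def
  proof (intro allI impI)
    fix \<epsilon> :: real assume \<epsilon>: "0 < \<epsilon>"
    \<comment> \<open>The factor 10 is 5 for passing from \<open>e - v\<close> to
      \<open>e' - x\<close> times 2 for normalizing \<open>x\<close>; \<open>1 + \<kappa>\<close> is
      the growth of the graph, which bounds \<open>norm (x - w)\<close>.\<close>
    define \<epsilon>' where "\<epsilon>' = min 1 (\<epsilon> / (10 * (1 + \<kappa>)))"
    have \<epsilon>': "0 < \<epsilon>'" "\<epsilon>' \<le> 1" "10 * \<epsilon>' * (1 + \<kappa>) \<le> \<epsilon>"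
    proof -
      show "0 < \<epsilon>'" using \<epsilon> f(2) by (simp add: \<epsilon>'_def add_nonneg_pos)
      have "\<epsilon>' \<le> 1" "\<epsilon>' \<le> \<epsilon> / (10 * (1 + \<kappa>))" unfolding \<epsilon>'_def by linarith+
      then show "\<epsilon>' \<le> 1" "10 * \<epsilon>' * (1 + \<kappa>) \<le> \<epsilon>" using f(2) by (simp_all add: field_simps)
    qed
    obtain \<delta> where \<delta>: "0 < \<delta>" "\<And>v. v \<in> frontier X \<inter> sphere 0 1 \<Longrightarrow> dist v w < \<delta> \<Longrightarrow> \<exists>e\<in>E. dist e v \<le> \<epsilon>' * dist v w"
      using thick \<epsilon>' unfolding thick_def by blast
    define K where "K = 1 + \<kappa> + \<epsilon>"
    have K: "0 < K" using f(2) \<epsilon> by (simp add: K_def)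
    \<comment> \<open>\<open>K * norm y\<close> will bound \<open>norm (e' - w)\<close>, so
      \<open>e'\<close> stays where both graphs describe the boundaries. The bound 1/4 keeps
      \<open>v\<close> near \<open>w\<close>, so that \<open>e \<bullet> w \<ge> 1/2\<close> and
      rescaling \<open>e\<close> is harmless.\<close>
    define d where "d = min (min \<rho>1 \<rho>2) (min \<delta> (1/4)) / (2 * K + 1)"
    have d0: "0 < d" using f(1) g(1) \<delta>(1) K by (simp add: d_def add_pos_pos)
    have "(2 * K + 1) * d = min (min \<rho>1 \<rho>2) (min \<delta> (1/4))" using K by (simp add: d_def)
    then have d: "(2 * K + 1) * d \<le> \<rho>1" "(2 * K + 1) * d \<le> \<rho>2" "(2 * K + 1) * d \<le> \<delta>" "(2 * K + 1) * d \<le> 1/4" by linarith+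
    show "\<exists>\<delta>>0. \<forall>v\<in>T. dist v 0 < \<delta> \<longrightarrow> (\<exists>e\<in>{y \<in> T. f y = g y}. dist e v \<le> \<epsilon> * dist v 0)"
    proof (intro exI[of _ d] conjI ballI impI d0)
      fix y assume y: "y \<in> T" and "dist y 0 < d"
      then have yd: "norm y < d" by simp
      then have "2 * K * norm y + norm y < (2 * K + 1) * d"
        using K mult_strict_left_mono[OF yd, of "2 * K + 1"] by (simp add: algebra_simps)
      moreover have "0 \<le> 2 * K * norm y" using K by simp
      ultimately have small: "norm y < \<rho>1" "2 * K * norm y < \<rho>1" "2 * K * norm y < \<rho>2" "2 * K * norm y < \<delta>" "2 * K * norm y < 1/4"
        using d norm_ge_zero[of y] by linarith+
      define x where "x = w + y + f y *\<^sub>R \<nu>"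
      note fy = f(4)[OF y small(1)]
      have yT: "y \<bullet> w = 0" "y \<bullet> \<nu> = 0" using y by (auto simp: T_def)
      have xw: "x \<bullet> w = 1" using yT w1 \<nu>' by (simp add: x_def inner_add_left)
      have x0: "x \<noteq> 0" using xw by auto
      have nx: "norm (x - w) \<le> (1 + \<kappa>) * norm y"
      proof -
        have "norm (x - w) \<le> norm y + norm (f y *\<^sub>R \<nu>)" unfolding x_def using norm_triangle_ineq[of y "f y *\<^sub>R \<nu>"] by simp
        then show ?thesis using fy \<nu>' by (simp add: algebra_simps)
      qed
      define v where "v = (1 / norm x) *\<^sub>R x"
      have v: "v \<in> frontier X \<inter> sphere 0 1"
        using fy x0 frontier_cone_scale[OF X(1,3)] by (simp add: v_def flip: x_def)
      have vw: "norm (v - w) \<le> 2 * (1 + \<kappa>) * norm y"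
      proof -
        have "norm (v - w) \<le> 2 * norm (x - w)" unfolding v_def by (rule norm_normalize_diff_le[OF w(1) x0])
        also have "\<dots> \<le> 2 * ((1 + \<kappa>) * norm y)" using nx by simp
        finally show ?thesis by (simp only: mult.assoc)
      qed
      also have "\<dots> \<le> 2 * K * norm y" using \<epsilon> by (intro mult_right_mono) (auto simp: K_def)
      finally have vw2: "norm (v - w) < \<delta>" "norm (v - w) < 1/4" using small by linarith+
      obtain e where e: "e \<in> E" "dist e v \<le> \<epsilon>' * dist v w" using \<delta>(2)[OF v] vw2 by (auto simp: dist_norm)
      have ev: "norm (e - v) \<le> \<epsilon>' * norm (v - w)" using e(2) by (simp add: dist_norm)
      also have "\<dots> \<le> \<epsilon>' * (2 * (1 + \<kappa>) * norm y)" using vw \<epsilon>' by (intro mult_left_mono) auto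
      finally have ev2: "norm (e - v) \<le> 2 * \<epsilon>' * (1 + \<kappa>) * norm y" by (simp add: mult_ac)
      have ev3: "norm (e - v) \<le> 1/4"
        using ev vw2 \<epsilon>' mult_right_mono[OF \<epsilon>'(2), of "norm (v - w)"] by simp
      have vww: "3/4 \<le> v \<bullet> w"
      proof -
        have "\<bar>(v - w) \<bullet> w\<bar> \<le> 1/4" using Cauchy_Schwarz_ineq2[of "v - w" w] w vw2 by simp
        then show ?thesis unfolding inner_diff_left w1 by linarith
      qed
      have evw: "\<bar>(e - v) \<bullet> w\<bar> \<le> norm (e - v)" using Cauchy_Schwarz_ineq2[of "e - v" w] w by simp
      have eww: "1/2 \<le> e \<bullet> w" using evw ev3 vww by (simp add: inner_diff_left abs_le_iff)
      define e' where "e' = (1 / (e \<bullet> w)) *\<^sub>R e"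
      have xv: "x = (1 / (v \<bullet> w)) *\<^sub>R v" using xw x0 by (simp add: v_def)
      have ex: "norm (e' - x) \<le> 5 * norm (e - v)"
      proof -
        have nv: "norm v = 1" using v by simp
        define p where "p = e \<bullet> w" define q where "q = v \<bullet> w"
        have pq: "1/2 \<le> p" "3/4 \<le> q" "\<bar>p - q\<bar> \<le> norm (e - v)" using eww vww evw by (simp_all add: p_def q_def inner_diff_left)
        have "e' - x = (1/p) *\<^sub>R (e - v) + (1/p - 1/q) *\<^sub>R v"
          unfolding e'_def xv p_def[symmetric] q_def[symmetric] by (simp add: algebra_simps)
        then have "norm (e' - x) \<le> norm ((1/p) *\<^sub>R (e - v)) + norm ((1/p - 1/q) *\<^sub>R v)" by (simp only: norm_triangle_ineq)
        also have "norm ((1/p) *\<^sub>R (e - v)) \<le> 2 * norm (e - v)"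
        proof -
          have "1/p \<le> 2" using pq by (simp add: field_simps)
          then have "1/p * norm (e - v) \<le> 2 * norm (e - v)" by (intro mult_right_mono) auto
          then show ?thesis using pq by simp
        qed
        also have "norm ((1/p - 1/q) *\<^sub>R v) \<le> 3 * norm (e - v)"
        proof -
          have "1/p - 1/q = (q - p) * (1 / (p * q))" using pq by (simp add: field_simps)
          then have "\<bar>1/p - 1/q\<bar> = \<bar>p - q\<bar> * (1 / (p * q))" using pq by (simp add: abs_mult abs_minus_commute)
          also have "\<dots> \<le> norm (e - v) * 3"
          proof (intro mult_mono pq(3))
            have "1/2 * (3/4) \<le> p * q" using pq by (intro mult_mono) auto
            then show "1 / (p * q) \<le> 3" by (simp add: divide_le_eq)
          qed (use pq in auto)
          finally show ?thesis using nv by (simp add: mult.commute)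
        qed
        finally show ?thesis by simp
      qed
      also have "5 * norm (e - v) \<le> 5 * (2 * \<epsilon>' * (1 + \<kappa>) * norm y)" by (intro mult_left_mono ev2) simp
      also have "\<dots> = (10 * \<epsilon>' * (1 + \<kappa>)) * norm y" by simp
      also have "\<dots> \<le> \<epsilon> * norm y" using \<epsilon>' by (intro mult_right_mono) auto
      finally have ex2: "norm (e' - x) \<le> \<epsilon> * norm y" .
      define t where "t = (e' - w) \<bullet> \<nu>"
      define z where "z = (e' - w) - t *\<^sub>R \<nu>"
      have e'w: "e' \<bullet> w = 1" using eww by (simp add: e'_def)
      have zT: "z \<in> T" using e'w w1 \<nu>' \<nu>1 by (simp add: T_def z_def t_def inner_diff_left)
      have e'z: "w + z + t *\<^sub>R \<nu> = e'" by (simp add: z_def)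
      have "norm (z + t *\<^sub>R \<nu>) = norm (e' - w)" by (simp add: z_def)
      also have "\<dots> \<le> norm (e' - x) + norm (x - w)" using norm_triangle_ineq[of "e' - x" "x - w"] by simp
      also have "\<dots> \<le> K * norm y" using ex2 nx by (simp add: K_def algebra_simps)
      also have "\<dots> \<le> 2 * K * norm y" using K by simp
      finally have nz: "norm (z + t *\<^sub>R \<nu>) < \<rho>1" "norm (z + t *\<^sub>R \<nu>) < \<rho>2" using small by linarith+
      have "e \<in> frontier X" "e \<in> frontier Y" using e E by auto
      then have e'fr: "e' \<in> frontier X" "e' \<in> frontier Y"
        using frontier_cone_scale[OF X(1,3)] frontier_cone_scale[OF Y(1,3)] eww by (simp_all add: e'_def)
      have "f z = t" "g z = t"
        using f(5)[OF zT nz(1)] g(5)[OF zT nz(2)] e'fr by (simp_all add: e'z)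
      moreover have "norm (z - y) \<le> norm (e' - x)"
      proof -
        define a where "a = e' - x"
        have "a \<bullet> \<nu> = t - f y" using yT \<nu>1 by (simp add: a_def t_def x_def inner_diff_left inner_add_left)
        then have "z - y = a - (a \<bullet> \<nu>) *\<^sub>R \<nu>" by (simp add: a_def z_def x_def scaleR_diff_left)
        then have "(norm (z - y))\<^sup>2 = (norm a)\<^sup>2 - (a \<bullet> \<nu>)\<^sup>2"
          unfolding power2_norm_eq_inner using \<nu>1
          by (simp add: inner_diff_left inner_diff_right inner_commute[of \<nu> a] power2_eq_square)
        then have "(norm (z - y))\<^sup>2 \<le> (norm a)\<^sup>2" by simp
        then show ?thesis unfolding a_def by (rule power2_le_imp_le) simp
      qed
      ultimately show "\<exists>e\<in>{y \<in> T. f y = g y}. dist e y \<le> \<epsilon> * dist y 0"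
        using zT ex2 by (intro bexI[of _ z]) (auto simp: dist_norm)
    qed
  qed
qed

text \<open>The coincidence set is symmetric in the two graphs, so expansions transfer in both
  directions and the same operators are Hessians of both.\<close>

lemma has_gauss_kronecker_curvature_thick:
  fixes X Y E :: "(real ^ 'n) set"
  assumes X: "closed X" "convex X" "conic X" "interior X \<noteq> {}"
    and Y: "closed Y" "convex Y" "conic Y" "interior Y \<noteq> {}"
    and w: "norm w = 1" "w \<in> X" "w \<in> Y" and R: "0 < R"
    and N: "cone_unit_normals X w = cone_unit_normals Y w"
    and E: "E \<subseteq> frontier X \<inter> frontier Y" and thick: "thick E (frontier X \<inter> sphere 0 1) w"
  shows "has_gauss_kronecker_curvature {x. x \<bullet> w = 0} (cone_section X w R) 0 \<kappa> \<longleftrightarrow>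
    has_gauss_kronecker_curvature {x. x \<bullet> w = 0} (cone_section Y w R) 0 \<kappa>"
proof -
  have hess: "has_alexandrov_hessian T (boundary_graph (cone_section X w R) 0 \<nu>) A \<longleftrightarrow>
      has_alexandrov_hessian T (boundary_graph (cone_section Y w R) 0 \<nu>) A"
    if \<nu>: "cone_unit_normals X w = {\<nu>}" and T: "T = {y. y \<bullet> w = 0 \<and> y \<bullet> \<nu> = 0}" for \<nu> T A
  proof -
    let ?f = "boundary_graph (cone_section X w R) 0 \<nu>" and ?g = "boundary_graph (cone_section Y w R) 0 \<nu>"
    have \<nu>2: "cone_unit_normals Y w = {\<nu>}" using \<nu> N by simp
    have sT: "subspace T" by (auto simp: T subspace_def inner_add_left)
    have th: "thick {y\<in>T. ?f y = ?g y} T 0"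
      unfolding T by (rule thick_boundary_graphs_eq[OF X Y w R \<nu> \<nu>2 E thick])
    then have th': "thick {y\<in>T. ?g y = ?f y} T 0" by (simp only: eq_commute[of "?g _"])
    have 0: "0 \<in> T" using sT by (rule subspace_0)
    obtain \<rho>1 \<kappa>1 where f: "0 < \<rho>1" "0 \<le> \<kappa>1" "convex_on (T \<inter> ball 0 \<rho>1) ?f"
      "\<And>y. y \<in> T \<Longrightarrow> norm y < \<rho>1 \<Longrightarrow> 0 \<le> ?f y \<and> ?f y \<le> \<kappa>1 * norm y \<and> w + y + ?f y *\<^sub>R \<nu> \<in> frontier X"
      "\<And>y t. y \<in> T \<Longrightarrow> norm (y + t *\<^sub>R \<nu>) < \<rho>1 \<Longrightarrow> w + y + t *\<^sub>R \<nu> \<in> frontier X \<Longrightarrow> ?f y = t"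
      by (rule boundary_graph_cone_section[OF X w(1,2) \<nu> R, folded T]) (rule that)
    obtain \<rho>2 \<kappa>2 where g: "0 < \<rho>2" "0 \<le> \<kappa>2" "convex_on (T \<inter> ball 0 \<rho>2) ?g"
      "\<And>y. y \<in> T \<Longrightarrow> norm y < \<rho>2 \<Longrightarrow> 0 \<le> ?g y \<and> ?g y \<le> \<kappa>2 * norm y \<and> w + y + ?g y *\<^sub>R \<nu> \<in> frontier Y"
      "\<And>y t. y \<in> T \<Longrightarrow> norm (y + t *\<^sub>R \<nu>) < \<rho>2 \<Longrightarrow> w + y + t *\<^sub>R \<nu> \<in> frontier Y \<Longrightarrow> ?g y = t"
      by (rule boundary_graph_cone_section[OF Y w(1,3) \<nu>2 R, folded T]) (rule that)
    have z: "?f 0 = ?g 0" using f(4)[OF 0] g(4)[OF 0] f(1) g(1) by simp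
    show ?thesis
      using has_alexandrov_hessian_transfer[OF sT _ z g(1,3) th]
        has_alexandrov_hessian_transfer[OF sT _ z[symmetric] f(1,3) th'] by blast
  qed
  have "inner_unit_normals {x. x \<bullet> w = 0} (cone_section X w R) 0 = cone_unit_normals X w"
    "inner_unit_normals {x. x \<bullet> w = 0} (cone_section Y w R) 0 = cone_unit_normals X w"
    using inner_unit_normals_cone_section X Y w R N by metis+
  then show ?thesis
    unfolding has_gauss_kronecker_curvature_def Let_def using hess by (simp cong: conj_cong) 
qed

section \<open>Spherical curvature\<close>

lemma conic_hull_sphere_iff:
  fixes K :: "'a::real_normed_vector set"
  assumes "K \<subseteq> sphere 0 1" "norm w = 1"
  shows "w \<in> conic hull K \<longleftrightarrow> w \<in> K"
proof
  assume "w \<in> conic hull K"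
  then obtain r v where "0 \<le> r" "v \<in> K" "w = r *\<^sub>R v" by (auto simp: conic_hull_explicit)
  moreover from this have "norm v = 1" using assms by auto
  ultimately show "w \<in> K" using assms(2) by simp
qed (rule hull_inc)

lemma conic_hull_normalize:
  fixes K :: "'a::real_normed_vector set"
  assumes "(1 / norm x) *\<^sub>R x \<in> K" "x \<noteq> 0"
  shows "x \<in> conic hull K"
proof -
  have "norm x *\<^sub>R ((1 / norm x) *\<^sub>R x) \<in> conic hull K"
    unfolding conic_hull_explicit using assms(1) norm_ge_zero by blast
  then show ?thesis using assms(2) by simp
qed

lemma conic_hull_normalizeD:
  fixes K :: "'a::real_normed_vector set"
  assumes "K \<subseteq> sphere 0 1" "x \<in> conic hull K" "x \<noteq> 0"
  shows "(1 / norm x) *\<^sub>R x \<in> K"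
proof -
  have "(1 / norm x) *\<^sub>R x \<in> conic hull K"
    using conic_conic_hull[of K] assms(2) unfolding conic_def by simp
  then show ?thesis using conic_hull_sphere_iff[OF assms(1)] assms(3) by simp
qed

text \<open>Normalization reduces membership in a cone to membership in its trace on the sphere.
  Only \<open>0\<close> is exceptional: it lies in the hull of every nonempty set, but
  \<open>conic hull {}\<close> is empty, hence \<open>ne\<close>.\<close>

lemma conic_hull_Int_sphere:
  fixes K L :: "'a::real_normed_vector set"
  assumes K: "K \<subseteq> sphere 0 1" and L: "L \<subseteq> sphere 0 1" and ne: "K \<inter> L \<noteq> {}"
  shows "conic hull (K \<inter> L) = conic hull K \<inter> conic hull L"
proof
  show "conic hull (K \<inter> L) \<subseteq> conic hull K \<inter> conic hull L"
    by (simp add: hull_mono)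
  show "conic hull K \<inter> conic hull L \<subseteq> conic hull (K \<inter> L)"
  proof
    fix x assume x: "x \<in> conic hull K \<inter> conic hull L"
    show "x \<in> conic hull (K \<inter> L)"
    proof (cases "x = 0")
      case True
      obtain v where "v \<in> K \<inter> L" using ne by blast
      then have "0 *\<^sub>R v \<in> conic hull (K \<inter> L)" unfolding conic_hull_explicit by blast
      then show ?thesis using True by simp
    next
      case False
      then show ?thesis
        using x conic_hull_normalizeD[OF K] conic_hull_normalizeD[OF L] by (intro conic_hull_normalize) auto
    qed
  qed
qed

lemma conic_hull_Un_sets: "conic hull (K \<union> L) = conic hull K \<union> conic hull L"
  unfolding conic_hull_explicit by blast

lemma sph_convex_bodyD:
  assumes "sph_convex_body K"
  shows "closed K" "K \<subseteq> sphere 0 1" "closed (conic hull K)" "convex (conic hull K)" "conic (conic hull K)"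
proof -
  show 1: "closed K" "K \<subseteq> sphere 0 1" using assms by (auto simp: sph_convex_body_def sph_convex_def)
  have "compact K" using 1(1) bounded_subset[OF bounded_sphere 1(2)] by (simp add: compact_eq_bounded_closed)
  moreover have "0 \<notin> K" using 1 by auto
  ultimately show "closed (conic hull K)" by (intro closed_conic_hull) auto
  show "convex (conic hull K)" using assms by (simp add: sph_convex_body_def sph_convex_def conic_hull_explicit)
  show "conic (conic hull K)" by (rule conic_conic_hull)
qed

text \<open>Normalization is continuous away from \<open>0\<close>, so a relatively open part of
  \<open>K\<close> pulls back to an open part of the cone.\<close>

lemma sph_interior_eq:
  assumes K: "K \<subseteq> sphere 0 1"
  shows "sph_interior K = sphere 0 1 \<inter> interior (conic hull K)"
proof (intro set_eqI iffI)
  fix x assume "x \<in> sph_interior K"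
  then obtain U where U: "open U" "x \<in> sphere 0 1 \<inter> U" "sphere 0 1 \<inter> U \<subseteq> K"
    unfolding sph_interior_def interior_of_def openin_open by auto
  define V where "V = (- {0}) \<inter> (\<lambda>y. (1 / norm y) *\<^sub>R y) -` U"
  have "continuous_on (- {0}) (\<lambda>y::real^'a. (1 / norm y) *\<^sub>R y)" by (intro continuous_intros) auto
  then have "open V" unfolding V_def by (intro continuous_open_preimage U(1)) auto
  moreover have "V \<subseteq> conic hull K"
  proof
    fix y assume "y \<in> V"
    then have y: "y \<noteq> 0" "(1 / norm y) *\<^sub>R y \<in> U" by (auto simp: V_def)
    then have "(1 / norm y) *\<^sub>R y \<in> K" using U(3) by auto
    then show "y \<in> conic hull K" using y by (intro conic_hull_normalize)
  qed
  moreover have "x \<in> V" using U(2) by (auto simp: V_def)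
  ultimately show "x \<in> sphere 0 1 \<inter> interior (conic hull K)" using U(2) interior_maximal by blast
next
  fix x assume x: "x \<in> sphere 0 1 \<inter> interior (conic hull K)"
  have "openin (top_of_set (sphere 0 1)) (sphere 0 1 \<inter> interior (conic hull K))"
    by (simp add: openin_open_Int)
  moreover have "sphere 0 1 \<inter> interior (conic hull K) \<subseteq> K"
    using conic_hull_sphere_iff[OF K] interior_subset by fastforce
  ultimately show "x \<in> sph_interior K" unfolding sph_interior_def interior_of_def using x by blast
qed

lemma sph_boundary_eq_Diff:
  assumes "closed K" "K \<subseteq> sphere 0 1"
  shows "sph_boundary K = K - sph_interior K"
proof -
  have "closedin (top_of_set (sphere 0 1)) K" using assms by (simp add: closed_subset)
  then show ?thesis by (simp add: sph_boundary_def sph_interior_def frontier_of_def closure_of_closedin)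
qed

lemma sph_boundary_eq:
  assumes "sph_convex_body K"
  shows "sph_boundary K = frontier (conic hull K) \<inter> sphere 0 1"
proof -
  note K = sph_convex_bodyD[OF assms]
  have "w \<in> sph_boundary K \<longleftrightarrow> w \<in> frontier (conic hull K) \<inter> sphere 0 1" for w
  proof (cases "norm w = 1")
    case True
    then show ?thesis
      using conic_hull_sphere_iff[OF K(2) True] K(3)
      by (simp add: sph_boundary_eq_Diff[OF K(1,2)] sph_interior_eq[OF K(2)] frontier_def)
  next
    case False
    then show ?thesis using K(2) by (auto simp: sph_boundary_eq_Diff[OF K(1,2)])
  qed
  then show ?thesis by blast
qed

lemma sph_interior_empty_iff:
  assumes K: "K \<subseteq> sphere 0 1"
  shows "sph_interior K = {} \<longleftrightarrow> interior (conic hull K) = {}"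
proof
  assume e: "sph_interior K = {}"
  show "interior (conic hull K) = {}"
  proof (rule ccontr)
    assume ne: "interior (conic hull K) \<noteq> {}"
    have "\<not> interior (conic hull K) \<subseteq> {0}"
      using ne by (metis finite.emptyI finite_insert finite_subset not_open_singleton open_interior subset_singletonD)
    then obtain x where x: "x \<in> interior (conic hull K)" "x \<noteq> 0" by blast
    have "(1 / norm x) *\<^sub>R x \<in> interior (conic hull K)"
      using x by (intro interior_cone_scale[OF conic_conic_hull]) auto
    moreover have "(1 / norm x) *\<^sub>R x \<in> sphere 0 1" using x by simp
    ultimately show False using e unfolding sph_interior_eq[OF K] by blast
  qed
qed (simp add: sph_interior_eq[OF K])

section \<open>Comparison of spherical curvatures\<close>

lemma has_sph_curvature_iff:
  assumes K: "sph_convex_body K" and w: "norm w = 1"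
  shows "has_sph_curvature K w \<kappa> \<longleftrightarrow>
    (\<forall>\<epsilon>. 0 < \<epsilon> \<and> \<epsilon> < pi / 2 \<longrightarrow>
      has_gauss_kronecker_curvature {x. x \<bullet> w = 0} (cone_section (conic hull K) w (tan \<epsilon>)) 0 \<kappa>)"
  unfolding has_sph_curvature_def using gnomonic_image_eq[OF sph_convex_bodyD(2)[OF K] w] by simp

text \<open>Existence of a curvature includes uniqueness of the normal. Any cap reveals it;
  \<open>pi / 4\<close> is a convenient one, with tangent 1.\<close>

lemma has_sph_curvature_unit_normal:
  assumes K: "sph_convex_body K" and w: "w \<in> sph_boundary K" and "has_sph_curvature K w \<kappa>"
  obtains \<nu> where "cone_unit_normals (conic hull K) w = {\<nu>}"
proof -
  note KD = sph_convex_bodyD[OF K]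
  have w': "norm w = 1" "w \<in> conic hull K"
    using w KD(3) by (auto simp: sph_boundary_eq[OF K] frontier_def)
  have e: "0 < pi / 4" "pi / 4 < pi / 2" using pi_gt_zero by auto
  then have t: "0 < tan (pi / 4)" by (simp add: tan_45)
  have "has_gauss_kronecker_curvature {x. x \<bullet> w = 0} (cone_section (conic hull K) w (tan (pi / 4))) 0 \<kappa>"
    using assms(3) e unfolding has_sph_curvature_iff[OF K w'(1)] by blast
  then show ?thesis
    unfolding has_gauss_kronecker_curvature_def
      inner_unit_normals_cone_section[OF KD(4,5) w' t] using that by blast
qed

text \<open>The default value is \<open>0\<close> as well, so only existing curvatures have to be
  examined.\<close>

lemma sph_curvature_eq_0:
  assumes "\<And>\<kappa>. has_sph_curvature K w \<kappa> \<Longrightarrow> \<kappa> = 0"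
  shows "sph_curvature K w = 0"
  using assms has_sph_curvature_unique unfolding sph_curvature_def by (metis the_equality)

text \<open>Both bodies have the same values of \<open>has_sph_curvature\<close> at
  \<open>w\<close>, so the default applies to both or to neither.\<close>

lemma sph_curvature_eq_thick:
  assumes K: "sph_convex_body K" and L: "sph_convex_body L"
    and int: "sph_interior K \<noteq> {}" "sph_interior L \<noteq> {}"
    and w: "w \<in> sph_boundary K" "w \<in> sph_boundary L"
    and N: "cone_unit_normals (conic hull K) w = cone_unit_normals (conic hull L) w"
    and E: "E \<subseteq> sph_boundary K \<inter> sph_boundary L" and thick: "thick E (sph_boundary K) w"
  shows "sph_curvature K w = sph_curvature L w"
proof -
  note KD = sph_convex_bodyD[OF K] and LD = sph_convex_bodyD[OF L]
  have intK: "interior (conic hull K) \<noteq> {}" "interior (conic hull L) \<noteq> {}"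
    using int sph_interior_empty_iff KD(2) LD(2) by blast+
  have w': "norm w = 1" "w \<in> conic hull K" "w \<in> conic hull L"
    using w KD(3) LD(3) by (auto simp: sph_boundary_eq[OF K] sph_boundary_eq[OF L] frontier_def)
  have E': "E \<subseteq> frontier (conic hull K) \<inter> frontier (conic hull L)"
    using E sph_boundary_eq[OF K] sph_boundary_eq[OF L] by auto
  have "has_sph_curvature K w \<kappa> \<longleftrightarrow> has_sph_curvature L w \<kappa>" for \<kappa>
  proof -
    have "has_gauss_kronecker_curvature {x. x \<bullet> w = 0} (cone_section (conic hull K) w (tan \<epsilon>)) 0 \<kappa> \<longleftrightarrow>
      has_gauss_kronecker_curvature {x. x \<bullet> w = 0} (cone_section (conic hull L) w (tan \<epsilon>)) 0 \<kappa>"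
      if "0 < \<epsilon>" "\<epsilon> < pi / 2" for \<epsilon>
      by (rule has_gauss_kronecker_curvature_thick[OF KD(3-5) intK(1) LD(3-5) intK(2) w' _ N E' thick[unfolded sph_boundary_eq[OF K]]])
        (use that in \<open>simp add: tan_gt_zero\<close>)
    then show ?thesis
      unfolding has_sph_curvature_iff[OF K w'(1)] has_sph_curvature_iff[OF L w'(1)] by blast
  qed
  then have "has_sph_curvature K w = has_sph_curvature L w" by blast
  then show ?thesis unfolding sph_curvature_def using int by auto
qed

lemma sph_boundary_local:
  assumes K: "closed K" "K \<subseteq> sphere 0 1" and L: "closed L" "L \<subseteq> sphere 0 1" and KL: "K \<subseteq> L"
    and U: "open U" "K \<inter> U = L \<inter> U" and v: "v \<in> U"
  shows "v \<in> sph_boundary K \<longleftrightarrow> v \<in> sph_boundary L"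
proof -
  have 1: "v \<in> sph_interior K \<Longrightarrow> v \<in> sph_interior L"
    unfolding sph_interior_def using interior_of_mono[OF KL] by blast
  have 2: "v \<in> sph_interior K" if vi: "v \<in> sph_interior L"
  proof -
    obtain T where T: "openin (top_of_set (sphere 0 1)) T" "v \<in> T" "T \<subseteq> L"
      using vi by (auto simp: sph_interior_def interior_of_def)
    have "openin (top_of_set (sphere 0 1)) (T \<inter> U)" using T(1) U(1) by (metis openin_Int_open)
    moreover have "T \<inter> U \<subseteq> K" using T U by blast
    ultimately show ?thesis using T v unfolding sph_interior_def interior_of_def by blast
  qed
  have "v \<in> K \<longleftrightarrow> v \<in> L" using U(2) v by blast
  then show ?thesis using 1 2 by (auto simp: sph_boundary_eq_Diff K L)
qed

text \<open>This is the trivial instance of thickness: near \<open>w\<close> the boundaries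
  coincide, so the common boundary leaves no gap at all. The normals agree because a short step from
  \<open>w\<close> along any vector of the larger cone, once normalized, lands in \<open>U\<close>
  and hence in the smaller body.\<close>

lemma sph_curvature_local:
  assumes K: "sph_convex_body K" and L: "sph_convex_body L" and KL: "K \<subseteq> L"
    and int: "sph_interior K \<noteq> {}" and w: "w \<in> sph_boundary K"
    and U: "open U" "w \<in> U" "K \<inter> U = L \<inter> U"
  shows "sph_curvature K w = sph_curvature L w"
proof -
  note KD = sph_convex_bodyD[OF K] and LD = sph_convex_bodyD[OF L]
  have loc: "v \<in> sph_boundary K \<longleftrightarrow> v \<in> sph_boundary L" if "v \<in> U" for v
    by (rule sph_boundary_local[OF KD(1,2) LD(1,2) KL U(1,3) that])
  have intL: "sph_interior L \<noteq> {}"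
    using int interior_of_mono[OF KL] unfolding sph_interior_def by blast
  have wL: "w \<in> sph_boundary L" using loc U w by blast
  have w': "norm w = 1" "w \<in> conic hull L"
    using wL LD(3) by (auto simp: sph_boundary_eq[OF L] frontier_def)
  have "cone_unit_normals (conic hull L) w \<subseteq> cone_unit_normals (conic hull K) w"
    using KL by (intro cone_unit_normals_antimono hull_mono)
  moreover have "cone_unit_normals (conic hull K) w \<subseteq> cone_unit_normals (conic hull L) w"
  proof
    fix \<mu> assume \<mu>: "\<mu> \<in> cone_unit_normals (conic hull K) w"
    have "0 \<le> c \<bullet> \<mu>" if c: "c \<in> conic hull L" for c
    proof -
      define x where "x s = w + s *\<^sub>R c" for s
      have x0: "(x \<longlongrightarrow> w) (at_right 0)"
        unfolding x_def by (rule tendsto_eq_intros | simp)+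
      have "((\<lambda>s. (1 / norm (x s)) *\<^sub>R x s) \<longlongrightarrow> (1 / norm w) *\<^sub>R w) (at_right 0)"
        by (intro tendsto_intros x0) (use w' in auto)
      then have "\<forall>\<^sub>F s in at_right 0. (1 / norm (x s)) *\<^sub>R x s \<in> U"
        using U w' by (intro topological_tendstoD) auto
      moreover have "\<forall>\<^sub>F s in at_right 0. x s \<in> - {0}"
        using w' by (intro topological_tendstoD[OF x0]) auto
      moreover have "\<forall>\<^sub>F s in at_right (0::real). 0 < s" by (rule eventually_at_right_less)
      ultimately have "\<forall>\<^sub>F s in at_right 0. (1 / norm (x s)) *\<^sub>R x s \<in> U \<and> x s \<in> - {0} \<and> 0 < s"
        by (intro eventually_conj)
      then obtain s where s: "(1 / norm (x s)) *\<^sub>R x s \<in> U" "x s \<noteq> 0" "0 < s"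
        using eventually_happens'[OF trivial_limit_at_right_real] by blast
      have "s *\<^sub>R c \<in> conic hull L" using c s LD(5) by (simp add: conic_def)
      then have "x s \<in> conic hull L" unfolding x_def using convex_cone_add[OF LD(4,5) w'(2)] by blast
      then have "(1 / norm (x s)) *\<^sub>R x s \<in> K" using conic_hull_normalizeD[OF LD(2)] s U(3) by blast
      then have "x s \<in> conic hull K" using s by (intro conic_hull_normalize)
      then have "0 \<le> x s \<bullet> \<mu>" using \<mu> by (auto simp: cone_unit_normals_def)
      then have "0 \<le> s * (c \<bullet> \<mu>)" using \<mu> by (simp add: x_def inner_add_left cone_unit_normals_def inner_commute[of w])
      then show ?thesis using s by (simp add: zero_le_mult_iff)
    qed
    then show "\<mu> \<in> cone_unit_normals (conic hull L) w" using \<mu> by (auto simp: cone_unit_normals_def)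
  qed
  ultimately have N: "cone_unit_normals (conic hull K) w = cone_unit_normals (conic hull L) w" by blast
  have "thick (sph_boundary K \<inter> sph_boundary L) (sph_boundary K) w"
    unfolding thick_def
  proof (intro allI impI)
    fix \<epsilon> :: real assume "0 < \<epsilon>"
    obtain r where r: "0 < r" "ball w r \<subseteq> U" using U by (meson openE)
    have "\<exists>e\<in>sph_boundary K \<inter> sph_boundary L. dist e v \<le> \<epsilon> * dist v w"
      if "v \<in> sph_boundary K" "dist v w < r" for v
    proof -
      have "v \<in> U" using that r by (auto simp: dist_commute)
      then show ?thesis using loc that \<open>0 < \<epsilon>\<close> by (intro bexI[of _ v]) auto
    qed
    then show "\<exists>\<delta>>0. \<forall>v\<in>sph_boundary K. dist v w < \<delta> \<longrightarrow>
        (\<exists>e\<in>sph_boundary K \<inter> sph_boundary L. dist e v \<le> \<epsilon> * dist v w)" using r by blast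
  qed
  then show ?thesis by (intro sph_curvature_eq_thick[OF K L int intL w wL N]) auto
qed

section \<open>Common boundary points on the boundary of the union\<close>

lemma sph_convex_body_Int:
  assumes K: "sph_convex_body K" and L: "sph_convex_body L"
  shows "sph_convex_body (K \<inter> L)"
proof -
  note KD = sph_convex_bodyD[OF K] and LD = sph_convex_bodyD[OF L]
  have "convex (conic hull (K \<inter> L))"
  proof (cases "K \<inter> L = {}")
    case False
    then show ?thesis using KD LD by (simp add: conic_hull_Int_sphere convex_Int)
  qed (simp add: conic_hull_explicit)
  then show ?thesis
    using KD LD by (auto simp: sph_convex_body_def sph_convex_def conic_hull_explicit)
qed

lemma sph_interior_Int: "sph_interior (K \<inter> L) = sph_interior K \<inter> sph_interior L"
  by (simp add: sph_interior_def interior_of_Int)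

lemma sph_curvature_eq_0_no_unit_normal:
  assumes "sph_convex_body K" "w \<in> sph_boundary K" "\<And>\<nu>. cone_unit_normals (conic hull K) w \<noteq> {\<nu>}"
  shows "sph_curvature K w = 0"
  using assms has_sph_curvature_unit_normal by (metis sph_curvature_eq_0)

text \<open>The normals of the union are among those of the other three bodies. If the union has
  several, no curvature exists at \<open>w\<close> and all four values are \<open>0\<close>. If
  \<open>\<nu>\<close> is the only one, thickness leaves just \<open>\<nu>\<close> and
  \<open>- \<nu>\<close> for the others, and nonempty interior excludes \<open>- \<nu>\<close>; the
  four graphs then live over the same tangent space.\<close>

lemma sph_curvature_thick_Un:
  assumes K: "sph_convex_body K" and L: "sph_convex_body L" and M: "sph_convex_body (K \<union> L)"
    and int: "sph_interior K \<noteq> {}" "sph_interior L \<noteq> {}"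
    and E: "E = sph_boundary K \<inter> sph_boundary L \<inter> sph_boundary (K \<union> L)" and w: "w \<in> E"
    and thick: "thick E (sph_boundary (K \<union> L)) w"
  shows "sph_curvature K w = sph_curvature (K \<union> L) w \<and> sph_curvature L w = sph_curvature (K \<union> L) w \<and>
    sph_curvature (K \<inter> L) w = sph_curvature (K \<union> L) w"
proof -
  have I: "sph_convex_body (K \<inter> L)" by (rule sph_convex_body_Int[OF K L])
  note KD = sph_convex_bodyD[OF K] and LD = sph_convex_bodyD[OF L] and MD = sph_convex_bodyD[OF M]
    and ID = sph_convex_bodyD[OF I]
  have intM: "sph_interior (K \<union> L) \<noteq> {}"
    using int(1) interior_of_mono[of K "K \<union> L"] unfolding sph_interior_def by blast
  have bI: "sph_boundary K \<inter> sph_boundary L \<subseteq> sph_boundary (K \<inter> L)"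
    by (auto simp: sph_boundary_eq_Diff KD LD ID sph_interior_Int)
  have wb: "w \<in> sph_boundary K" "w \<in> sph_boundary L" "w \<in> sph_boundary (K \<union> L)" "w \<in> sph_boundary (K \<inter> L)"
    using w bI by (auto simp: E)
  have ne: "K \<inter> L \<noteq> {}" using wb by (auto simp: sph_boundary_eq_Diff KD LD)
  have w1: "norm w = 1" and wM: "w \<in> conic hull (K \<union> L)" "w \<in> frontier (conic hull (K \<union> L))"
    using wb(3) MD(3) by (auto simp: sph_boundary_eq[OF M] frontier_def)
  have wK: "w \<in> conic hull K" "w \<in> conic hull L"
    using wb KD(3) LD(3) by (auto simp: sph_boundary_eq[OF K] sph_boundary_eq[OF L] frontier_def)
  have ci: "interior (conic hull K) \<noteq> {}" "interior (conic hull L) \<noteq> {}" "interior (conic hull (K \<union> L)) \<noteq> {}"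
    using int intM sph_interior_empty_iff KD(2) LD(2) MD(2) by blast+
  let ?N = "\<lambda>X. cone_unit_normals (conic hull X) w"
  have anti: "?N (K \<union> L) \<subseteq> ?N X" "?N X \<subseteq> ?N (K \<inter> L)" if "X = K \<or> X = L" for X
    using that by (auto intro!: cone_unit_normals_antimono hull_mono)
  have NM: "?N (K \<union> L) \<noteq> {}" by (rule cone_unit_normals_nonempty[OF MD(3-5) ci(3) wM(2)])
  show ?thesis
  proof (cases "\<exists>\<nu>. ?N (K \<union> L) = {\<nu>}")
    case False
    have "?N X \<noteq> {\<nu>}" if X: "X = K \<or> X = L \<or> X = K \<union> L \<or> X = K \<inter> L" for X \<nu>
    proof
      assume "?N X = {\<nu>}"
      moreover have "?N (K \<union> L) \<subseteq> ?N X" using X anti[of K] anti[of L] by auto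
      ultimately have "?N (K \<union> L) = {\<nu>}" using NM by (metis subset_singletonD)
      then show False using False by blast
    qed
    then have "sph_curvature K w = 0" "sph_curvature L w = 0" "sph_curvature (K \<union> L) w = 0" "sph_curvature (K \<inter> L) w = 0"
      using wb K L M I by (intro sph_curvature_eq_0_no_unit_normal; blast)+
    then show ?thesis by simp
  next
    case True
    then obtain \<nu> where \<nu>: "?N (K \<union> L) = {\<nu>}" by blast
    then have "\<nu> \<in> ?N (K \<union> L)" by simp
    then have nn: "\<nu> \<bullet> \<nu> = 1" by (simp add: cone_unit_normals_def dot_square_norm)
    have E': "E \<subseteq> conic hull K" "E \<subseteq> conic hull L" "E \<subseteq> conic hull (K \<inter> L)"
      by (auto simp: E sph_boundary_eq_Diff KD LD intro: hull_inc)
    have pm: "\<mu> = \<nu> \<or> \<mu> = - \<nu>" if "\<mu> \<in> ?N X" "E \<subseteq> conic hull X" for \<mu> X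
      using cone_unit_normals_thick[OF MD(3-5) ci(3) w1 wM(1) \<nu> that(2) _ that(1)] thick
      by (simp add: sph_boundary_eq[OF M])
    have NK: "?N K = {\<nu>}" "?N L = {\<nu>}"
    proof -
      show "?N K = {\<nu>}"
        using pm[OF _ E'(1)] anti(1)[of K] \<nu> cone_unit_normals_not_opposite[OF ci(1), of \<nu> w] by blast
      show "?N L = {\<nu>}"
        using pm[OF _ E'(2)] anti(1)[of L] \<nu> cone_unit_normals_not_opposite[OF ci(2), of \<nu> w] by blast
    qed
    \<comment> \<open>The common normal points into the interior of both cones, which supplies an
      interior point of the intersection.\<close>
    obtain t1 where t1: "0 < t1" "\<And>t. 0 < t \<Longrightarrow> t \<le> t1 \<Longrightarrow> w + t *\<^sub>R \<nu> \<in> interior (conic hull K)"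
      by (rule interior_direction[OF KD(4,5) ci(1) wK(1), of \<nu>]) (use NK nn in auto)
    obtain t2 where t2: "0 < t2" "\<And>t. 0 < t \<Longrightarrow> t \<le> t2 \<Longrightarrow> w + t *\<^sub>R \<nu> \<in> interior (conic hull L)"
      by (rule interior_direction[OF LD(4,5) ci(2) wK(2), of \<nu>]) (use NK nn in auto)
    have "w + min t1 t2 *\<^sub>R \<nu> \<in> interior (conic hull (K \<inter> L))"
      using t1 t2 by (simp add: conic_hull_Int_sphere[OF KD(2) LD(2) ne])
    then have ciI: "interior (conic hull (K \<inter> L)) \<noteq> {}" by blast
    then have intI: "sph_interior (K \<inter> L) \<noteq> {}" using sph_interior_empty_iff ID(2) by blast
    have NI: "?N (K \<inter> L) = {\<nu>}"
      using pm[OF _ E'(3)] anti(2)[of K] NK cone_unit_normals_not_opposite[OF ciI, of \<nu> w] by blast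
    have eq: "sph_curvature (K \<union> L) w = sph_curvature X w"
      if X: "sph_convex_body X" "sph_interior X \<noteq> {}" "w \<in> sph_boundary X" "?N X = {\<nu>}" "E \<subseteq> sph_boundary X" for X
      by (rule sph_curvature_eq_thick[OF M X(1) intM X(2) wb(3) X(3) _ _ thick]) (use X \<nu> E in auto)
    have sub: "E \<subseteq> sph_boundary K" "E \<subseteq> sph_boundary L" "E \<subseteq> sph_boundary (K \<inter> L)"
      using bI by (auto simp: E)
    show ?thesis
      using eq[OF K int(1) wb(1) NK(1) sub(1)] eq[OF L int(2) wb(2) NK(2) sub(2)]
        eq[OF I intI wb(4) NI sub(3)] by simp
  qed
qed

section \<open>Common boundary points in the interior of the union\<close>

lemma det_on_zero:
  fixes A :: "real ^ 'n \<Rightarrow> real ^ 'n"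
  assumes T: "subspace T" and y: "y \<in> T" "y \<noteq> 0" and A: "\<And>x. x \<in> T \<Longrightarrow> A x = 0"
  shows "det_on T A = 0"
proof -
  have cT: "closed T" "convex T" "T \<noteq> {}"
    using T y by (auto intro: closed_subspace subspace_imp_convex)
  define P where "P = closest_point T"
  have P: "P x \<in> T" for x unfolding P_def by (rule closest_point_in_set[OF cT(1,3)])
  have perp: "(x - P x) \<bullet> y = 0" for x
  proof -
    have "(x - P x) \<bullet> (z - P x) \<le> 0" if "z \<in> T" for z
      unfolding P_def by (rule closest_point_dot[OF cT(2,1) that])
    from this[of "P x + y"] this[of "P x - y"] show ?thesis
      using T y P[of x] by (simp add: subspace_add subspace_diff)
  qed
  define M where "M = matrix (\<lambda>x. A (P x) + (x - P x))"
  \<comment> \<open>The extended map sends every vector into the orthogonal complement of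
    \<open>T\<close>, so \<open>y\<close> annihilates all columns of \<open>M\<close>.\<close>
  have "transpose M *v y = 0"
  proof -
    have "(\<Sum>i\<in>UNIV. M $ i $ j * y $ i) = (axis j 1 - P (axis j 1)) \<bullet> y" for j
      using A[OF P] by (simp add: M_def matrix_def inner_vec_def)
    then show ?thesis
      using perp by (simp add: vec_eq_iff matrix_vector_mult_def transpose_def)
  qed
  then have "\<not> invertible (transpose M)"
    using y(2) by (metis invertible_def matrix_vector_mul_assoc matrix_vector_mul_lid matrix_vector_mult_0_right)
  then have "det (transpose M) = 0" by (simp add: invertible_det_nz)
  then show ?thesis by (simp add: det_on_def M_def P_def)
qed

text \<open>Two vectors span at most a plane. In ambient dimension 2 the space orthogonal to
  \<open>w\<close> and \<open>\<nu>\<close> would be trivial, with determinant 1; the dimension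
  bound is what lets a flat boundary have curvature \<open>0\<close>.\<close>

lemma exists_orthogonal_pair:
  fixes u v :: "real ^ 'n"
  assumes "3 \<le> CARD('n)"
  obtains y :: "real ^ 'n" where "y \<noteq> 0" "y \<bullet> u = 0" "y \<bullet> v = 0"
proof -
  have "dim {u, v} \<le> card {u, v}" by (rule dim_le_card') simp
  also have "\<dots> \<le> 2" by (simp add: card_insert_if)
  finally have "dim {u, v} < DIM(real ^ 'n)" using assms by simp
  then obtain y where y: "y \<noteq> 0" "\<And>x. x \<in> span {u, v} \<Longrightarrow> orthogonal y x"
    using orthogonal_to_subspace_exists by blast
  have "u \<in> span {u, v}" "v \<in> span {u, v}" by (auto intro: span_base)
  then show ?thesis using y that by (auto simp: orthogonal_def)
qed

text \<open>If a normal \<open>\<mu>\<close> of the second cone differed from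
  \<open>- \<nu>\<close>, the direction \<open>- (\<mu> + \<nu>)\<close> would have negative product
  with both normals and so leave both cones at once, although together they cover a neighbourhood of
  \<open>w\<close>.\<close>

lemma opposite_unit_normals_Un:
  assumes K: "sph_convex_body K" and L: "sph_convex_body L"
    and int: "sph_interior L \<noteq> {}"
    and w: "w \<in> sph_boundary K" "w \<in> sph_boundary L" "w \<in> sph_interior (K \<union> L)"
    and M: "K \<union> L \<subseteq> sphere 0 1"
    and \<nu>: "cone_unit_normals (conic hull K) w = {\<nu>}"
  shows "- \<nu> \<in> cone_unit_normals (conic hull L) w"
proof -
  note KD = sph_convex_bodyD[OF K] and LD = sph_convex_bodyD[OF L]
  have fr: "w \<in> frontier (conic hull L)" using w(2) by (simp add: sph_boundary_eq[OF L])
  have "interior (conic hull L) \<noteq> {}" using int sph_interior_empty_iff LD(2) by blast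
  then obtain \<mu> where \<mu>: "\<mu> \<in> cone_unit_normals (conic hull L) w"
    using cone_unit_normals_nonempty[OF LD(3-5) _ fr] by blast
  then have \<mu>': "norm \<mu> = 1" "\<mu> \<bullet> w = 0" "\<And>z. z \<in> conic hull L \<Longrightarrow> 0 \<le> z \<bullet> \<mu>" and \<mu>1: "\<mu> \<bullet> \<mu> = 1"
    by (auto simp: cone_unit_normals_def dot_square_norm)
  have "\<nu> \<in> cone_unit_normals (conic hull K) w" using \<nu> by simp
  then have \<nu>': "norm \<nu> = 1" "\<nu> \<bullet> w = 0" "\<And>z. z \<in> conic hull K \<Longrightarrow> 0 \<le> z \<bullet> \<nu>" and \<nu>1: "\<nu> \<bullet> \<nu> = 1"
    by (auto simp: cone_unit_normals_def dot_square_norm)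
  have "w \<in> interior (conic hull (K \<union> L))" using w(3) by (simp add: sph_interior_eq[OF M])
  then obtain r where r: "0 < r" "ball w r \<subseteq> conic hull K \<union> conic hull L"
    unfolding conic_hull_Un_sets[symmetric] by (meson mem_interior)
  have "\<mu> = - \<nu>"
  proof (rule ccontr)
    assume ne: "\<mu> \<noteq> - \<nu>"
    define d where "d = - (\<mu> + \<nu>)"
    have "0 < (\<mu> + \<nu>) \<bullet> (\<mu> + \<nu>)" using ne by (simp add: add_eq_0_iff2)
    then have pos: "0 < 1 + \<mu> \<bullet> \<nu>"
      using \<mu>1 \<nu>1 by (simp add: inner_add_left inner_add_right inner_commute[of \<nu> \<mu>])
    have d: "d \<bullet> \<nu> < 0" "d \<bullet> \<mu> < 0" "d \<noteq> 0"
      using pos \<mu>1 \<nu>1 by (auto simp: d_def inner_add_left inner_diff_left inner_commute[of \<nu> \<mu>])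
    define t where "t = r / (2 * norm d)"
    have t: "0 < t" "t * norm d < r" using r d by (auto simp: t_def)
    have "w + t *\<^sub>R d \<in> ball w r" using t by (simp add: dist_norm)
    moreover have "w + t *\<^sub>R d \<notin> conic hull K"
    proof
      assume "w + t *\<^sub>R d \<in> conic hull K"
      then have "0 \<le> t * (d \<bullet> \<nu>)" using \<nu>'(3)[of "w + t *\<^sub>R d"] \<nu>'(2) by (simp add: inner_add_left inner_commute[of w])
      then show False using t d by (simp add: zero_le_mult_iff)
    qed
    ultimately have "w + t *\<^sub>R d \<in> conic hull L" using r by blast
    then have "0 \<le> t * (d \<bullet> \<mu>)" using \<mu>'(3)[of "w + t *\<^sub>R d"] \<mu>'(2) by (simp add: inner_add_left inner_commute[of w])
    then show False using t d by (simp add: zero_le_mult_iff)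
  qed
  then show ?thesis using \<mu> by simp
qed

lemma sph_curvature_interior_Un_eq_0:
  fixes K L :: "(real ^ 'n) set"
  assumes K: "sph_convex_body K" and L: "sph_convex_body L"
    and int: "sph_interior K \<noteq> {}" "sph_interior L \<noteq> {}"
    and w: "w \<in> sph_boundary K" "w \<in> sph_boundary L" "w \<in> sph_interior (K \<union> L)"
    and card: "3 \<le> CARD('n)"
  shows "sph_curvature K w = 0"
proof (rule sph_curvature_eq_0)
  fix \<kappa> assume \<kappa>: "has_sph_curvature K w \<kappa>"
  note KD = sph_convex_bodyD[OF K] and LD = sph_convex_bodyD[OF L]
  have M: "K \<union> L \<subseteq> sphere 0 1" using KD LD by blast
  have w': "norm w = 1" "w \<in> conic hull K"
    using w(1) KD(3) by (auto simp: sph_boundary_eq[OF K] frontier_def)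
  obtain \<nu> where \<nu>: "cone_unit_normals (conic hull K) w = {\<nu>}"
    using has_sph_curvature_unit_normal[OF K w(1) \<kappa>] .
  have "\<nu> \<in> cone_unit_normals (conic hull K) w" using \<nu> by simp
  then have \<nu>': "norm \<nu> = 1" "\<nu> \<bullet> w = 0" "\<And>z. z \<in> conic hull K \<Longrightarrow> 0 \<le> z \<bullet> \<nu>" and \<nu>1: "\<nu> \<bullet> \<nu> = 1"
    by (auto simp: cone_unit_normals_def dot_square_norm)
  have "- \<nu> \<in> cone_unit_normals (conic hull L) w"
    by (rule opposite_unit_normals_Un[OF K L int(2) w M \<nu>])
  then have Lneg: "z \<bullet> \<nu> \<le> 0" if "z \<in> conic hull L" for z using that by (auto simp: cone_unit_normals_def)
  have ci: "interior (conic hull K) \<noteq> {}" using int(1) sph_interior_empty_iff KD(2) by blast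
  have "w \<in> interior (conic hull (K \<union> L))" using w(3) by (simp add: sph_interior_eq[OF M])
  then obtain r where r: "0 < r" "ball w r \<subseteq> conic hull K \<union> conic hull L"
    unfolding conic_hull_Un_sets[symmetric] by (meson mem_interior)
  define T where "T = {y. y \<bullet> w = 0 \<and> y \<bullet> \<nu> = 0}"
  have T: "subspace T" by (auto simp: T_def subspace_def inner_add_left)
  define R where "R = tan (pi / 4)"
  have R: "0 < R" by (simp add: R_def tan_45)
  define f where "f = boundary_graph (cone_section (conic hull K) w R) 0 \<nu>"
  obtain \<rho> c where f: "0 < \<rho>" "0 \<le> c" "convex_on (T \<inter> ball 0 \<rho>) f"
    "\<And>y. y \<in> T \<Longrightarrow> norm y < \<rho> \<Longrightarrow> 0 \<le> f y \<and> f y \<le> c * norm y \<and> w + y + f y *\<^sub>R \<nu> \<in> frontier (conic hull K)"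
    "\<And>y t. y \<in> T \<Longrightarrow> norm (y + t *\<^sub>R \<nu>) < \<rho> \<Longrightarrow> w + y + t *\<^sub>R \<nu> \<in> frontier (conic hull K) \<Longrightarrow> f y = t"
    by (rule boundary_graph_cone_section[OF KD(3-5) ci w' \<nu> R, folded T_def f_def]) (rule that)
  \<comment> \<open>Points slightly above the tangent hyperplane miss the cone of \<open>L\<close>,
    so they belong to that of \<open>K\<close>. Closedness adds the hyperplane itself, below which
    the cone of \<open>K\<close> has no points.\<close>
  have f0: "f y = 0" if y: "y \<in> T" "norm y < min \<rho> r" for y
  proof -
    have yT: "y \<bullet> w = 0" "y \<bullet> \<nu> = 0" using y by (auto simp: T_def)
    have wn: "(w + y + s *\<^sub>R \<nu>) \<bullet> \<nu> = s" for s
      using yT \<nu>' \<nu>1 by (simp add: inner_add_left inner_commute[of w])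
    have "w + y + s *\<^sub>R \<nu> \<in> conic hull K" if s: "0 < s" "norm y + s < r" for s
    proof -
      have "norm (y + s *\<^sub>R \<nu>) \<le> norm y + s" using norm_triangle_ineq[of y "s *\<^sub>R \<nu>"] \<nu>' s by simp
      then have "norm (y + s *\<^sub>R \<nu>) < r" using s by linarith
      then have "w + y + s *\<^sub>R \<nu> \<in> ball w r"
        by (metis add.assoc add_diff_cancel_left' dist_commute dist_norm mem_ball)
      moreover have "w + y + s *\<^sub>R \<nu> \<notin> conic hull L" using Lneg[of "w + y + s *\<^sub>R \<nu>"] wn[of s] s by auto
      ultimately show ?thesis using r by blast
    qed
    moreover have "\<forall>\<^sub>F s in at_right 0. 0 < s \<and> norm y + s < r"
      unfolding eventually_at_right_field using y by (intro exI[of _ "r - norm y"]) auto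
    ultimately have ev: "\<forall>\<^sub>F s in at_right 0. w + y + s *\<^sub>R \<nu> \<in> conic hull K"
      by (auto elim: eventually_mono)
    have lim: "((\<lambda>s. w + y + s *\<^sub>R \<nu>) \<longlongrightarrow> w + y + 0 *\<^sub>R \<nu>) (at_right 0)"
      by (intro tendsto_intros)
    have "w + y + 0 *\<^sub>R \<nu> \<in> conic hull K"
      by (rule Lim_in_closed_set[OF KD(3) ev _ lim]) simp
    moreover have "w + y + 0 *\<^sub>R \<nu> \<notin> interior (conic hull K)"
    proof
      assume "w + y + 0 *\<^sub>R \<nu> \<in> interior (conic hull K)"
      then have "w + y \<in> interior (conic hull K)" by simp
      then obtain e where e: "0 < e" "ball (w + y) e \<subseteq> conic hull K" by (meson mem_interior)
      have "w + y + (- (e/2)) *\<^sub>R \<nu> \<in> ball (w + y) e" using e \<nu>' by (simp add: dist_norm)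
      then have "0 \<le> (w + y + (- (e/2)) *\<^sub>R \<nu>) \<bullet> \<nu>" using e(2) \<nu>'(3) by blast
      then show False unfolding wn using e by simp
    qed
    ultimately have "w + y + 0 *\<^sub>R \<nu> \<in> frontier (conic hull K)"
      using closure_subset by (auto simp: frontier_def)
    then show ?thesis using f(5)[OF y(1), of 0] y(2) by simp
  qed
  have zero: "has_alexandrov_hessian T f (\<lambda>_. 0)"
  proof -
    have "\<forall>\<^sub>F y in at 0 within T. (f y - f 0 - 0 \<bullet> y - ((0::real^'n) \<bullet> y) / 2) / (norm y)\<^sup>2 = 0"
      unfolding eventually_at using f0 f(1) r(1) subspace_0[OF T]
      by (intro exI[of _ "min \<rho> r"]) (auto simp: dist_norm)
    then have "((\<lambda>y. (f y - f 0 - 0 \<bullet> y - ((0::real^'n) \<bullet> y) / 2) / (norm y)\<^sup>2) \<longlongrightarrow> 0) (at 0 within T)"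
      by (rule tendsto_eventually)
    then show ?thesis
      unfolding has_alexandrov_hessian_def using subspace_0[OF T] linear_zero
      by (auto intro!: bexI[of _ 0])
  qed
  have "has_gauss_kronecker_curvature {x. x \<bullet> w = 0} (cone_section (conic hull K) w R) 0 \<kappa>"
    using \<kappa> pi_gt_zero unfolding has_sph_curvature_iff[OF K w'(1)] R_def by simp
  then obtain \<nu>' A where *: "{\<nu>} = {\<nu>'}"
    "has_alexandrov_hessian {y \<in> {x. x \<bullet> w = 0}. y \<bullet> \<nu>' = 0} (boundary_graph (cone_section (conic hull K) w R) 0 \<nu>') A"
    "\<kappa> = det_on {y \<in> {x. x \<bullet> w = 0}. y \<bullet> \<nu>' = 0} A"
    unfolding has_gauss_kronecker_curvature_def Let_def inner_unit_normals_cone_section[OF KD(4,5) w' R] \<nu> by blast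
  have "\<nu>' = \<nu>" using *(1) by simp
  then have A: "has_alexandrov_hessian T f A" and \<kappa>': "\<kappa> = det_on T A"
    using *(2,3) by (simp_all add: T_def f_def)
  obtain y where "y \<noteq> 0" "y \<bullet> w = 0" "y \<bullet> \<nu> = 0" using exists_orthogonal_pair[OF card] by metis
  then have "y \<in> T" by (simp add: T_def)
  \<comment> \<open>Hessians are unique on \<open>T\<close>, so the one that witnesses
    \<open>\<kappa>\<close> vanishes there.\<close>
  then show "\<kappa> = 0"
    unfolding \<kappa>'
    by (rule det_on_zero[OF T _ \<open>y \<noteq> 0\<close> alexandrov_hessian_unique[OF T A zero]])
qed

text \<open>If the intersection had a single normal \<open>\<nu>\<close>, this would be the only
  normal of \<open>K\<close>; then \<open>- \<nu>\<close> would be a normal of \<open>L\<close> and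
  hence of the intersection as well.\<close>

lemma sph_curvature_Int_interior_Un_eq_0:
  fixes K L :: "(real ^ 'n) set"
  assumes K: "sph_convex_body K" and L: "sph_convex_body L"
    and int: "sph_interior K \<noteq> {}" "sph_interior L \<noteq> {}"
    and w: "w \<in> sph_boundary K" "w \<in> sph_boundary L" "w \<in> sph_interior (K \<union> L)"
  shows "sph_curvature (K \<inter> L) w = 0"
proof (rule sph_curvature_eq_0_no_unit_normal)
  show I: "sph_convex_body (K \<inter> L)" by (rule sph_convex_body_Int[OF K L])
  note KD = sph_convex_bodyD[OF K] and LD = sph_convex_bodyD[OF L] and ID = sph_convex_bodyD[OF I]
  show "w \<in> sph_boundary (K \<inter> L)"
    using w by (auto simp: sph_boundary_eq_Diff KD LD ID sph_interior_Int)
  fix \<nu> show "cone_unit_normals (conic hull (K \<inter> L)) w \<noteq> {\<nu>}"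
  proof
    assume N: "cone_unit_normals (conic hull (K \<inter> L)) w = {\<nu>}"
    have ci: "interior (conic hull K) \<noteq> {}" using int(1) sph_interior_empty_iff KD(2) by blast
    have fr: "w \<in> frontier (conic hull K)" using w(1) by (simp add: sph_boundary_eq[OF K])
    have "cone_unit_normals (conic hull K) w \<subseteq> {\<nu>}" "cone_unit_normals (conic hull L) w \<subseteq> {\<nu>}"
      using cone_unit_normals_antimono[OF hull_mono, of "K \<inter> L" _ conic w] N by auto
    moreover from this have "cone_unit_normals (conic hull K) w = {\<nu>}"
      using cone_unit_normals_nonempty[OF KD(3-5) ci fr] by blast
    then have "- \<nu> \<in> cone_unit_normals (conic hull L) w"
      using opposite_unit_normals_Un[OF K L int(2) w] KD LD by blast
    ultimately have "- \<nu> = \<nu>" by blast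
    then have "- (\<nu> \<bullet> \<nu>) = \<nu> \<bullet> \<nu>" by (metis inner_minus_left)
    moreover have "norm \<nu> = 1" using N by (auto simp: cone_unit_normals_def)
    ultimately show False by (simp add: dot_square_norm)
  qed
qed

section \<open>The floating measure\<close>

text \<open>Splitting a lower integral over disjoint measurable sets does not require the integrand
  to be measurable, so the measurability of the curvature never enters.\<close>

lemma nn_integral_Un_disjoint:
  assumes A: "A \<in> sets M" and B: "B \<in> sets M" and disj: "A \<inter> B = {}"
  shows "(\<integral>\<^sup>+x\<in>A \<union> B. f x \<partial>M) = (\<integral>\<^sup>+x\<in>A. f x \<partial>M) + (\<integral>\<^sup>+x\<in>B. f x \<partial>M)"
proof (rule antisym)
  show "(\<integral>\<^sup>+x\<in>A \<union> B. f x \<partial>M) \<le> (\<integral>\<^sup>+x\<in>A. f x \<partial>M) + (\<integral>\<^sup>+x\<in>B. f x \<partial>M)"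
    unfolding nn_integral_def[of M "\<lambda>x. f x * indicator (A \<union> B) x"]
  proof (rule SUP_least)
    fix g assume "g \<in> {g. simple_function M g \<and> g \<le> (\<lambda>x. f x * indicator (A \<union> B) x)}"
    then have g: "simple_function M g" "\<And>x. g x \<le> f x * indicator (A \<union> B) x" by (auto simp: le_fun_def)
    have gm: "g \<in> borel_measurable M" using g(1) by (rule borel_measurable_simple_function)
    have "integral\<^sup>S M g = (\<integral>\<^sup>+x. g x \<partial>M)" using g(1) by (rule nn_integral_eq_simple_integral[symmetric])
    \<comment> \<open>\<open>g\<close> vanishes off \<open>A \<union> B\<close>, being bounded by
      \<open>f x * indicator (A \<union> B) x\<close>.\<close>
    also have "\<dots> = (\<integral>\<^sup>+x. g x * indicator A x + g x * indicator B x \<partial>M)"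
    proof (rule nn_integral_cong)
      fix x show "g x = g x * indicator A x + g x * indicator B x"
        using g(2)[of x] disj by (auto simp: indicator_def split: if_splits)
    qed
    also have "\<dots> = (\<integral>\<^sup>+x\<in>A. g x \<partial>M) + (\<integral>\<^sup>+x\<in>B. g x \<partial>M)"
      using gm A B by (intro nn_integral_add) auto
    also have "\<dots> \<le> (\<integral>\<^sup>+x\<in>A. f x \<partial>M) + (\<integral>\<^sup>+x\<in>B. f x \<partial>M)"
    proof (intro add_mono nn_integral_mono)
      fix x
      show "g x * indicator A x \<le> f x * indicator A x" "g x * indicator B x \<le> f x * indicator B x"
        using g(2)[of x] by (auto simp: indicator_def split: if_splits)
    qed
    finally show "integral\<^sup>S M g \<le> (\<integral>\<^sup>+x\<in>A. f x \<partial>M) + (\<integral>\<^sup>+x\<in>B. f x \<partial>M)" .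
  qed
  define S where "S D = {g. simple_function M g \<and> g \<le> (\<lambda>x. f x * indicator D x)}" for D
  have ne: "S D \<noteq> {}" for D by (auto simp: S_def le_fun_def intro!: exI[of _ "\<lambda>_. 0"])
  have le: "integral\<^sup>S M g + integral\<^sup>S M h \<le> (\<integral>\<^sup>+x\<in>A \<union> B. f x \<partial>M)"
    if g: "g \<in> S A" and h: "h \<in> S B" for g h
  proof -
    have gh: "simple_function M g" "simple_function M h" using g h by (auto simp: S_def)
    have "integral\<^sup>S M g + integral\<^sup>S M h = integral\<^sup>S M (\<lambda>x. g x + h x)"
      by (rule simple_integral_add[OF gh(1) _ gh(2), symmetric]) auto
    also have "\<dots> = (\<integral>\<^sup>+x. g x + h x \<partial>M)"
      by (intro nn_integral_eq_simple_integral[symmetric] simple_function_add gh)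
    also have "\<dots> \<le> (\<integral>\<^sup>+x\<in>A \<union> B. f x \<partial>M)"
    proof (rule nn_integral_mono)
      fix x
      have "g x \<le> f x * indicator A x" "h x \<le> f x * indicator B x" using g h by (auto simp: S_def le_fun_def)
      then show "g x + h x \<le> f x * indicator (A \<union> B) x"
        using disj by (cases "x \<in> A"; cases "x \<in> B") auto
    qed
    finally show ?thesis .
  qed
  have "(\<integral>\<^sup>+x\<in>A. f x \<partial>M) + (\<integral>\<^sup>+x\<in>B. f x \<partial>M) = (SUP g\<in>S A. integral\<^sup>S M g) + (SUP h\<in>S B. integral\<^sup>S M h)"
    by (simp add: nn_integral_def S_def)
  also have "\<dots> = (SUP g\<in>S A. integral\<^sup>S M g + (SUP h\<in>S B. integral\<^sup>S M h))"
    by (rule ennreal_SUP_add_left[symmetric, OF ne])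
  also have "\<dots> = (SUP g\<in>S A. SUP h\<in>S B. integral\<^sup>S M g + integral\<^sup>S M h)"
    by (intro SUP_cong refl ennreal_SUP_add_right ne)
  also have "\<dots> \<le> (\<integral>\<^sup>+x\<in>A \<union> B. f x \<partial>M)" by (intro SUP_least le)
  finally show "(\<integral>\<^sup>+x\<in>A. f x \<partial>M) + (\<integral>\<^sup>+x\<in>B. f x \<partial>M) \<le> (\<integral>\<^sup>+x\<in>A \<union> B. f x \<partial>M)" .
qed

section \<open>Bodies with empty interior\<close>

lemma floating_measure_empty_interior:
  "sph_interior K = {} \<Longrightarrow> floating_measure K \<omega> = 0"
  by (simp add: floating_measure_def sph_curvature_def)

text \<open>Adding a set with empty interior to a closed set does not enlarge the interior of the
  latter. A convex cone with interior points lies in the closure of its interior, so the cone of the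
  union is already contained in that of \<open>L\<close>.\<close>

lemma subset_of_empty_interior_Un:
  assumes K: "sph_convex_body K" and L: "sph_convex_body L" and M: "sph_convex_body (K \<union> L)"
    and int: "sph_interior K = {}"
  shows "K \<subseteq> L \<or> sph_interior (K \<union> L) = {}"
proof (cases "sph_interior (K \<union> L) = {}")
  case False
  note KD = sph_convex_bodyD[OF K] and LD = sph_convex_bodyD[OF L] and MD = sph_convex_bodyD[OF M]
  have "interior (conic hull K) = {}" using int sph_interior_empty_iff KD(2) by blast
  then have eq: "interior (conic hull (K \<union> L)) = interior (conic hull L)"
    using interior_closed_Un_empty_interior[OF LD(3)] by (simp add: conic_hull_Un_sets Un_commute)
  have ne: "interior (conic hull (K \<union> L)) \<noteq> {}" using False sph_interior_empty_iff MD(2) by blast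
  have "K \<subseteq> conic hull (K \<union> L)" using hull_subset[of "K \<union> L"] by blast
  also have "\<dots> \<subseteq> closure (interior (conic hull (K \<union> L)))"
    using convex_closure_interior[OF MD(4) ne] closure_subset by blast
  also have "\<dots> \<subseteq> conic hull L" unfolding eq using LD(3) by (meson closure_minimal interior_subset)
  finally have "K \<subseteq> conic hull L" .
  then have "K \<subseteq> L" using KD(2) conic_hull_sphere_iff[OF LD(2)] by fastforce
  then show ?thesis by simp
qed simp

section \<open>Balance of the boundary pieces\<close>

lemma floating_measure_valuation:
  fixes K L \<omega> :: "(real ^ 'n) set"
  assumes card: "3 \<le> CARD('n)"
    and K: "sph_convex_body K" and L: "sph_convex_body L" and M: "sph_convex_body (K \<union> L)"
    and int: "sph_interior K \<noteq> {}" "sph_interior L \<noteq> {}"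
    and \<omega>: "\<omega> \<in> sets borel"
  shows "floating_measure K \<omega> + floating_measure L \<omega> = floating_measure (K \<union> L) \<omega> + floating_measure (K \<inter> L) \<omega>"
proof -
  have I: "sph_convex_body (K \<inter> L)" by (rule sph_convex_body_Int[OF K L])
  note KD = sph_convex_bodyD[OF K] and LD = sph_convex_bodyD[OF L] and MD = sph_convex_bodyD[OF M]
    and ID = sph_convex_bodyD[OF I]
  note bd = sph_boundary_eq_Diff[OF KD(1,2)] sph_boundary_eq_Diff[OF LD(1,2)]
    sph_boundary_eq_Diff[OF MD(1,2)] sph_boundary_eq_Diff[OF ID(1,2)]
  let ?M = "hausdorff_measure (CARD('n) - 2) :: (real ^ 'n) measure"
  define J where "J X A = (\<integral>\<^sup>+w\<in>A. ennreal (sph_curvature X w powr (1 / real CARD('n))) \<partial>?M)" for X A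
  have intM: "sph_interior (K \<union> L) \<noteq> {}"
    using int(1) interior_of_mono[of K "K \<union> L"] unfolding sph_interior_def by blast
  have sub: "sph_interior X \<subseteq> X" for X :: "(real ^ 'n) set"
    unfolding sph_interior_def by (rule interior_of_subset)
  have mono: "sph_interior X \<subseteq> sph_interior Y" if "X \<subseteq> Y" for X Y :: "(real ^ 'n) set"
    unfolding sph_interior_def by (rule interior_of_mono[OF that])
  have Fl: "floating_measure X \<omega> = J X (\<omega> \<inter> sph_boundary X)" for X
    by (simp add: floating_measure_def J_def)
  have bint: "sph_interior X \<in> sets borel" if "X \<subseteq> sphere 0 1" for X :: "(real ^ 'n) set"
    unfolding sph_interior_eq[OF that] by (intro sets.Int[OF borel_closed borel_open]) auto
  have bset: "K \<in> sets borel" "L \<in> sets borel" "sph_interior K \<in> sets borel" "sph_interior L \<in> sets borel"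
    "sph_interior (K \<union> L) \<in> sets borel"
    using KD(1) LD(1) bint KD(2) LD(2) MD(2) by (auto intro: borel_closed)
  \<comment> \<open>\<open>A1\<close> and \<open>B1\<close> recur in the boundary of the union,
    \<open>A2\<close> and \<open>B2\<close> in that of the intersection, \<open>A3\<close> belongs
    to all four boundaries, and \<open>A4\<close> to all but that of the union. Apart from
    \<open>A4\<close>, which contributes \<open>0\<close>, every piece is counted equally often on
    both sides.\<close>
  define A1 where "A1 = \<omega> \<inter> (sph_boundary K - L)"
  define A2 where "A2 = \<omega> \<inter> (sph_boundary K \<inter> sph_interior L)"
  define B1 where "B1 = \<omega> \<inter> (sph_boundary L - K)"
  define B2 where "B2 = \<omega> \<inter> (sph_boundary L \<inter> sph_interior K)"
  define E where "E = sph_boundary K \<inter> sph_boundary L \<inter> sph_boundary (K \<union> L)"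
  define A3 where "A3 = \<omega> \<inter> E"
  define A4 where "A4 = \<omega> \<inter> (sph_boundary K \<inter> sph_boundary L \<inter> sph_interior (K \<union> L))"
  note defs = A1_def A2_def B1_def B2_def A3_def A4_def E_def
  have meas: "A1 \<in> sets ?M" "A2 \<in> sets ?M" "B1 \<in> sets ?M" "B2 \<in> sets ?M" "A3 \<in> sets ?M" "A4 \<in> sets ?M"
    using bset \<omega> by (auto simp: defs bd)
  have J_Un: "J X (A \<union> B) = J X A + J X B" if "A \<in> sets ?M" "B \<in> sets ?M" "A \<inter> B = {}" for X A B
    unfolding J_def using that by (rule nn_integral_Un_disjoint)
  have J_cong: "J X A = J Y A" if "\<And>w. w \<in> A \<Longrightarrow> sph_curvature X w = sph_curvature Y w" for X Y A
    unfolding J_def by (intro nn_integral_cong) (auto simp: indicator_def that)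
  have J_0: "J X A = 0" if "\<And>w. w \<in> A \<Longrightarrow> sph_curvature X w = 0" for X A
  proof -
    have "J X A = (\<integral>\<^sup>+w. 0 \<partial>?M)" unfolding J_def by (intro nn_integral_cong) (auto simp: indicator_def that)
    then show ?thesis by simp
  qed
  have outK: "sph_curvature K w = sph_curvature (K \<union> L) w \<and> w \<in> sph_boundary (K \<union> L)" if "w \<in> sph_boundary K - L" for w
  proof
    have U: "open (- L)" "w \<in> - L" "K \<inter> - L = (K \<union> L) \<inter> - L" using LD(1) that by auto
    show "sph_curvature K w = sph_curvature (K \<union> L) w"
      by (rule sph_curvature_local[OF K M _ int(1) _ U]) (use that in auto)
    show "w \<in> sph_boundary (K \<union> L)"
      using sph_boundary_local[OF KD(1,2) MD(1,2) _ U(1,3,2)] that by auto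
  qed
  have outL: "sph_curvature L w = sph_curvature (K \<union> L) w \<and> w \<in> sph_boundary (K \<union> L)" if "w \<in> sph_boundary L - K" for w
  proof
    have U: "open (- K)" "w \<in> - K" "L \<inter> - K = (K \<union> L) \<inter> - K" using KD(1) that by auto
    show "sph_curvature L w = sph_curvature (K \<union> L) w"
      by (rule sph_curvature_local[OF L M _ int(2) _ U]) (use that in auto)
    show "w \<in> sph_boundary (K \<union> L)"
      using sph_boundary_local[OF LD(1,2) MD(1,2) _ U(1,3,2)] that by auto
  qed
  \<comment> \<open>Near an interior point of \<open>Y\<close> the body \<open>X\<close> coincides
    with the intersection. \<open>X\<close> and \<open>Y\<close> stand for \<open>K\<close> and
    \<open>L\<close> in either order.\<close>
  have inn: "sph_curvature (K \<inter> L) w = sph_curvature X w"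
    if X: "X = K \<and> Y = L \<or> X = L \<and> Y = K" and w: "w \<in> sph_boundary X" "w \<in> sph_interior Y" for X Y w
  proof -
    have XY: "sph_convex_body X" "sph_convex_body Y" "sph_interior X \<noteq> {}" "K \<inter> L = X \<inter> Y"
      using X K L int by auto
    note XD = sph_convex_bodyD[OF XY(1)] and YD = sph_convex_bodyD[OF XY(2)]
    define U where "U = interior (conic hull Y)"
    have U: "open U" "w \<in> U" using w(2) by (auto simp: U_def sph_interior_eq[OF YD(2)])
    have UY: "x \<in> Y" if "x \<in> X" "x \<in> U" for x
    proof -
      have "norm x = 1" "x \<in> conic hull Y" using that XD(2) interior_subset by (auto simp: U_def)
      then show ?thesis using conic_hull_sphere_iff[OF YD(2)] by blast
    qed
    have eqU: "(X \<inter> Y) \<inter> U = X \<inter> U" using UY by blast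
    have wC: "w \<in> conic hull X" "w \<in> frontier (conic hull X)"
      using w(1) XD(3) by (auto simp: sph_boundary_eq[OF XY(1)] frontier_def)
    have ci: "interior (conic hull X) \<noteq> {}" using XY(3) sph_interior_empty_iff XD(2) by blast
    \<comment> \<open>Interior points of the cone of \<open>X\<close> accumulate at
      \<open>w\<close>, so some of them lie in \<open>U\<close>. This gives the intersection the
      interior point that locality of curvature asks for.\<close>
    have "w \<in> closure (interior (conic hull X))"
      using wC(1) convex_closure_interior[OF XD(4) ci] closure_subset by blast
    then have "interior (conic hull X) \<inter> U \<noteq> {}"
      using U by (metis Int_commute disjoint_iff open_Int_closure_eq_empty)
    moreover have "X \<inter> Y \<noteq> {}" using w UY U sub[of Y] by (auto simp: sph_boundary_eq_Diff[OF XD(1,2)])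
    ultimately have "interior (conic hull (X \<inter> Y)) \<noteq> {}"
      using conic_hull_Int_sphere[OF XD(2) YD(2)] by (simp add: U_def)
    then have intI: "sph_interior (X \<inter> Y) \<noteq> {}" using sph_interior_empty_iff XD(2) by (metis le_infI1)
    have I': "sph_convex_body (X \<inter> Y)" by (rule sph_convex_body_Int[OF XY(1,2)])
    note ID' = sph_convex_bodyD[OF I']
    have "w \<in> sph_boundary (X \<inter> Y)"
      using sph_boundary_local[OF ID'(1,2) XD(1,2) Int_lower1 U(1) eqU U(2)] w(1) by simp
    then show ?thesis
      unfolding XY(4) by (rule sph_curvature_local[OF I' XY(1) Int_lower1 intI _ U eqU])
  qed
  have E4: "J K A3 = J (K \<union> L) A3 \<and> J L A3 = J (K \<union> L) A3 \<and> J (K \<inter> L) A3 = J (K \<union> L) A3"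
  proof -
    have ci: "interior (conic hull (K \<union> L)) \<noteq> {}" using intM sph_interior_empty_iff MD(2) by blast
    have EM: "E \<subseteq> frontier (conic hull (K \<union> L)) \<inter> sphere 0 1" by (auto simp: E_def sph_boundary_eq[OF M])
    note null = hausdorff_outer_not_thick_cone[OF MD(3-5) ci EM card, folded sph_boundary_eq[OF M]]
    obtain B where B: "B \<in> sets borel" "{w \<in> E. \<not> thick E (sph_boundary (K \<union> L)) w} \<subseteq> B"
      "hausdorff_outer (CARD('n) - 2) B = 0"
      by (rule hausdorff_outer_null_borel[OF null])
    have "B \<in> null_sets ?M" using B by (auto simp: null_sets_def emeasure_hausdorff_measure)
    then have AE: "AE w in ?M. w \<notin> B" by (rule AE_not_in)
    have "J X A3 = J (K \<union> L) A3" if "X = K \<or> X = L \<or> X = K \<inter> L" for X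
      unfolding J_def
    proof (rule nn_integral_cong_AE, rule AE_mp[OF AE], rule AE_I2, rule impI)
      fix w assume "w \<notin> B"
      have "sph_curvature X w = sph_curvature (K \<union> L) w" if "w \<in> A3"
      proof -
        have "w \<in> E" using that by (simp add: A3_def)
        then have "thick E (sph_boundary (K \<union> L)) w" using B(2) \<open>w \<notin> B\<close> by blast
        then show ?thesis
          using sph_curvature_thick_Un[OF K L M int E_def \<open>w \<in> E\<close>] \<open>X = K \<or> _\<close> by auto
      qed
      then show "ennreal (sph_curvature X w powr (1 / real CARD('n))) * indicator A3 w =
          ennreal (sph_curvature (K \<union> L) w powr (1 / real CARD('n))) * indicator A3 w"
        by (auto simp: indicator_def)
    qed
    then show ?thesis by blast
  qed
  have J4: "J K A4 = 0" "J L A4 = 0" "J (K \<inter> L) A4 = 0"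
  proof -
    show "J K A4 = 0"
      by (rule J_0) (auto simp: A4_def intro: sph_curvature_interior_Un_eq_0[OF K L int _ _ _ card])
    have "w \<in> sph_interior (L \<union> K)" if "w \<in> sph_interior (K \<union> L)" for w using that by (simp add: Un_commute)
    then show "J L A4 = 0"
      by (intro J_0) (auto simp: A4_def intro: sph_curvature_interior_Un_eq_0[OF L K int(2,1) _ _ _ card])
    show "J (K \<inter> L) A4 = 0"
      by (rule J_0) (auto simp: A4_def intro: sph_curvature_Int_interior_Un_eq_0[OF K L int])
  qed
  have J1: "J K A1 = J (K \<union> L) A1" "J L B1 = J (K \<union> L) B1"
    using outK outL by (auto intro!: J_cong simp: A1_def B1_def)
  have J2: "J (K \<inter> L) A2 = J K A2" "J (K \<inter> L) B2 = J L B2"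
    using inn by (auto intro!: J_cong simp: A2_def B2_def)
  have outM: "w \<in> sph_boundary (K \<union> L)" if "w \<in> A1 \<union> B1" for w
    using that outK outL by (auto simp: A1_def B1_def)
  have intI: "sph_interior (K \<inter> L) = sph_interior K \<inter> sph_interior L" by (rule sph_interior_Int)
  have dK: "\<omega> \<inter> sph_boundary K = (A1 \<union> A2) \<union> (A3 \<union> A4)"
    using sub[of L] by (auto simp: defs bd)
  have dL: "\<omega> \<inter> sph_boundary L = (B1 \<union> B2) \<union> (A3 \<union> A4)"
    using sub[of K] by (auto simp: defs bd)
  have dM: "\<omega> \<inter> sph_boundary (K \<union> L) = (A1 \<union> B1) \<union> A3"
    using outM mono[of K "K \<union> L"] mono[of L "K \<union> L"] by (auto simp: defs bd)
  have dI: "\<omega> \<inter> sph_boundary (K \<inter> L) = (A2 \<union> B2) \<union> (A3 \<union> A4)"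
    using sub[of K] sub[of L] by (auto simp: defs bd intI)
  have disj: "A1 \<inter> A2 = {}" "A3 \<inter> A4 = {}" "(A1 \<union> A2) \<inter> (A3 \<union> A4) = {}"
    "B1 \<inter> B2 = {}" "(B1 \<union> B2) \<inter> (A3 \<union> A4) = {}" "A1 \<inter> B1 = {}" "(A1 \<union> B1) \<inter> A3 = {}"
    "A2 \<inter> B2 = {}" "(A2 \<union> B2) \<inter> (A3 \<union> A4) = {}"
    using sub[of L] sub[of K] by (auto simp: defs bd)
  have "floating_measure K \<omega> = J K A1 + J K A2 + J K A3"
    unfolding Fl dK using J4 meas disj by (simp add: J_Un add_ac)
  moreover have "floating_measure L \<omega> = J L B1 + J L B2 + J L A3"
    unfolding Fl dL using J4 meas disj by (simp add: J_Un add_ac)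
  moreover have "floating_measure (K \<union> L) \<omega> = J (K \<union> L) A1 + J (K \<union> L) B1 + J (K \<union> L) A3"
    unfolding Fl dM using meas disj by (simp add: J_Un add_ac)
  moreover have "floating_measure (K \<inter> L) \<omega> = J (K \<inter> L) A2 + J (K \<inter> L) B2 + J (K \<inter> L) A3"
    unfolding Fl dI using J4 meas disj by (simp add: J_Un add_ac)
  ultimately show ?thesis using E4 J1 J2 by (simp add: add_ac)
qed

theorem theorem7p2:
  fixes K L \<omega> :: "(real ^ 'n) set" and n :: nat
  assumes "CARD('n) = n + 1" and "n \<ge> 2"
    and "sph_convex_body K" and "sph_convex_body L"
    and "sph_convex_body (K \<union> L)"
    and "\<omega> \<in> sets (restrict_space borel (sphere 0 1))"
  shows "floating_measure K \<omega> + floating_measure L \<omega>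
       = floating_measure (K \<union> L) \<omega> + floating_measure (K \<inter> L) \<omega>"
proof -
  note K = assms(3) and L = assms(4) and M = assms(5)
  have card: "3 \<le> CARD('n)" using assms(1,2) by simp
  have \<omega>: "\<omega> \<in> sets borel" using assms(6) by (auto simp: sets_restrict_space)
  have M': "sph_convex_body (L \<union> K)" using M by (simp add: Un_commute)
  \<comment> \<open>If one body has empty interior, then the bodies are nested or the union has
    empty interior. Nested bodies are, in some order, their own union and intersection; in the
    second case all four measures vanish.\<close>
  consider "K \<subseteq> L \<or> L \<subseteq> K" | "sph_interior (K \<union> L) = {}" | "sph_interior K \<noteq> {}" "sph_interior L \<noteq> {}"
    using subset_of_empty_interior_Un[OF K L M] subset_of_empty_interior_Un[OF L K M'] by (auto simp: Un_commute)
  then show ?thesis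
  proof cases
    case 1
    then show ?thesis by (auto simp: add.commute Un_absorb1 Un_absorb2 Int_absorb1 Int_absorb2)
  next
    case 2
    have "sph_interior X = {}" if "X \<subseteq> K \<union> L" for X
      using 2 interior_of_mono[OF that] unfolding sph_interior_def by blast
    then have "sph_interior K = {}" "sph_interior L = {}" "sph_interior (K \<inter> L) = {}" by blast+
    then show ?thesis using 2 by (simp add: floating_measure_empty_interior)
  next
    case 3
    then show ?thesis by (rule floating_measure_valuation[OF card K L M _ _ \<omega>])
  qed
qed

end
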